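(* Let $\mathbb{K}$ be an infinite field. Every commutative affine domain over $\mathbb{K}$ (i.e. every finitely generated commutative $\mathbb{K}$-algebra which is a domain) satisfies the strong Dixmier-Moeglin equivalence.
   Context: Let $R$ be a noetherian $\mathbb{K}$-algebra and $P$ a prime ideal of $R$. $\mathrm{Frac}$ denotes the (Goldie) quotient ring, $\mathcal{Z}$ the centre, $\mathrm{ht}$ the height of a prime ideal. A primitive ideal is the annihilator of a simple module. - $\mathrm{prim.deg}\,P:=\inf\{\mathrm{ht}\,Q\mid Q \text{ a primitive ideal of } R/P\}$ (heights taken in $R/P$). - $\mathrm{rat.deg}\,P$ is the transcendence degree over $\mathbb{K}$ of $\mathcal{Z}(\mathrm{Frac}(R/P))$. - $\mathrm{loc.deg}\,P$ is the smallest nonnegative integer $d$ such that the intersection of all prime ideals of $R/P$ of height strictly greater than $d$ is nonzero (an empty intersection is the whole ring $R/P$). $R$ satisfies the strong Dixmier-Moeglin equivalence if every prime ideal $P$ of $R$ satisfies $\mathrm{loc.deg}\,P=\mathrm{prim.deg}\,P=\mathrm{rat.deg}\,P$. *)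

theory Defs
  imports
    "HOL-Algebra.Algebra"
    "HOL-Library.Extended_Nat"
begin

section \<open>Prime and primitive ideals, height\<close>

text \<open>Primes of a possibly noncommutative ring are defined through products of two-sided ideals;
  over a commutative ring this is \<^const>\<open>primeideal\<close>, see \<open>prime_ideal_cring_iff\<close> below.\<close>

definition prime_ideal :: "'a set \<Rightarrow> ('a, 'm) ring_scheme \<Rightarrow> bool" where
  "prime_ideal P R \<longleftrightarrow>
     ideal P R \<and> P \<noteq> carrier R \<and>
     (\<forall>I J. ideal I R \<longrightarrow> ideal J R \<longrightarrow> I \<cdot>\<^bsub>R\<^esub> J \<subseteq> P \<longrightarrow> I \<subseteq> P \<or> J \<subseteq> P)"

text \<open>Supremum of the lengths n of chains of primes ending in the given prime.\<close>

definition height :: "('a, 'm) ring_scheme \<Rightarrow> 'a set \<Rightarrow> enat" where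
  "height R P =
     Sup {enat n | n. \<exists>C. (\<forall>i\<le>n. prime_ideal (C i) R) \<and> (\<forall>i<n. C i \<subset> C (Suc i)) \<and> C n = P}"

text \<open>The library locale \<^locale>\<open>module\<close> asks for a commutative base ring. The fields
  \<open>mult\<close> and \<open>one\<close> of the record M play no role.\<close>

locale left_module = R?: ring R + M?: abelian_group M
  for R :: "('a, 'm) ring_scheme" (structure) and M :: "('a, 'b, 'n) module_scheme" (structure) +
  assumes smult_closed:
      "\<lbrakk>a \<in> carrier R; x \<in> carrier M\<rbrakk> \<Longrightarrow> a \<odot>\<^bsub>M\<^esub> x \<in> carrier M"
    and smult_l_distr:
      "\<lbrakk>a \<in> carrier R; b \<in> carrier R; x \<in> carrier M\<rbrakk> \<Longrightarrow>
       (a \<oplus>\<^bsub>R\<^esub> b) \<odot>\<^bsub>M\<^esub> x = a \<odot>\<^bsub>M\<^esub> x \<oplus>\<^bsub>M\<^esub> b \<odot>\<^bsub>M\<^esub> x"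
    and smult_r_distr:
      "\<lbrakk>a \<in> carrier R; x \<in> carrier M; y \<in> carrier M\<rbrakk> \<Longrightarrow>
       a \<odot>\<^bsub>M\<^esub> (x \<oplus>\<^bsub>M\<^esub> y) = a \<odot>\<^bsub>M\<^esub> x \<oplus>\<^bsub>M\<^esub> a \<odot>\<^bsub>M\<^esub> y"
    and smult_assoc1:
      "\<lbrakk>a \<in> carrier R; b \<in> carrier R; x \<in> carrier M\<rbrakk> \<Longrightarrow>
       (a \<otimes>\<^bsub>R\<^esub> b) \<odot>\<^bsub>M\<^esub> x = a \<odot>\<^bsub>M\<^esub> (b \<odot>\<^bsub>M\<^esub> x)"
    and smult_one:
      "x \<in> carrier M \<Longrightarrow> \<one>\<^bsub>R\<^esub> \<odot>\<^bsub>M\<^esub> x = x"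

definition simple_module :: "('a, 'm) ring_scheme \<Rightarrow> ('a, 'b, 'n) module_scheme \<Rightarrow> bool" where
  "simple_module R M \<longleftrightarrow>
     left_module R M \<and> carrier M \<noteq> {\<zero>\<^bsub>M\<^esub>} \<and>
     (\<forall>N. submodule N R M \<longrightarrow> N = {\<zero>\<^bsub>M\<^esub>} \<or> N = carrier M)"

definition annihilator :: "('a, 'm) ring_scheme \<Rightarrow> ('a, 'b, 'n) module_scheme \<Rightarrow> 'a set" where
  "annihilator R M = {r \<in> carrier R. \<forall>x \<in> carrier M. r \<odot>\<^bsub>M\<^esub> x = \<zero>\<^bsub>M\<^esub>}"

text \<open>Restricting the underlying type of the simple module to \<open>'a set\<close> loses nothing: every simple
  left module is isomorphic to R/L for a maximal left ideal L, whose elements are cosets.\<close>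

definition primitive_ideal :: "'a set \<Rightarrow> ('a, 'm) ring_scheme \<Rightarrow> bool" where
  "primitive_ideal Q R \<longleftrightarrow>
     (\<exists>M :: ('a, 'a set) module. simple_module R M \<and> Q = annihilator R M)"


section \<open>The Goldie quotient ring\<close>

definition regular_elements :: "('a, 'm) ring_scheme \<Rightarrow> 'a set" where
  "regular_elements R =
     {s \<in> carrier R. \<forall>a \<in> carrier R.
        (s \<otimes>\<^bsub>R\<^esub> a = \<zero>\<^bsub>R\<^esub> \<longrightarrow> a = \<zero>\<^bsub>R\<^esub>) \<and> (a \<otimes>\<^bsub>R\<^esub> s = \<zero>\<^bsub>R\<^esub> \<longrightarrow> a = \<zero>\<^bsub>R\<^esub>)}"

text \<open>Ore localisation at the regular elements. The class \<open>ore_frac R a s\<close> is the right fraction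
  \<open>a s\<^sup>-\<^sup>1\<close>; two fractions agree iff they have a common expansion \<open>(a c) (s c)\<^sup>-\<^sup>1\<close>.\<close>

definition ore_frac :: "('a, 'm) ring_scheme \<Rightarrow> 'a \<Rightarrow> 'a \<Rightarrow> ('a \<times> 'a) set" where
  "ore_frac R a s =
     {(b, t). b \<in> carrier R \<and> t \<in> regular_elements R \<and>
        (\<exists>c \<in> carrier R. \<exists>d \<in> carrier R.
           s \<otimes>\<^bsub>R\<^esub> c = t \<otimes>\<^bsub>R\<^esub> d \<and> s \<otimes>\<^bsub>R\<^esub> c \<in> regular_elements R \<and> a \<otimes>\<^bsub>R\<^esub> c = b \<otimes>\<^bsub>R\<^esub> d)}"

text \<open>Since \<open>a s\<^sup>-\<^sup>1 + b t\<^sup>-\<^sup>1 = (a c + b d) (s c)\<^sup>-\<^sup>1\<close> whenever \<open>s c = t d\<close> is regular, and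
  \<open>(a s\<^sup>-\<^sup>1) (b t\<^sup>-\<^sup>1) = (a b') (t s')\<^sup>-\<^sup>1\<close> whenever \<open>s b' = b s'\<close> with \<open>s'\<close> regular, under the Ore
  condition the unions below run over copies of one and the same class. For a prime (left and right)
  noetherian ring the Ore condition is part of Goldie's theorem, and right and left fractions give
  the same ring.\<close>

definition Frac :: "('a, 'm) ring_scheme \<Rightarrow> ('a \<times> 'a) set ring" where
  "Frac R =
     \<lparr>carrier = {ore_frac R a s | a s. a \<in> carrier R \<and> s \<in> regular_elements R},
      monoid.mult = (\<lambda>U V. \<Union>{ore_frac R (a \<otimes>\<^bsub>R\<^esub> b') (t \<otimes>\<^bsub>R\<^esub> s') | a s b t b' s'.
                (a, s) \<in> U \<and> (b, t) \<in> V \<and> b' \<in> carrier R \<and> s' \<in> regular_elements R \<and>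
                s \<otimes>\<^bsub>R\<^esub> b' = b \<otimes>\<^bsub>R\<^esub> s'}),
      one = ore_frac R \<one>\<^bsub>R\<^esub> \<one>\<^bsub>R\<^esub>,
      ring.zero = ore_frac R \<zero>\<^bsub>R\<^esub> \<one>\<^bsub>R\<^esub>,
      ring.add = (\<lambda>U V. \<Union>{ore_frac R (a \<otimes>\<^bsub>R\<^esub> c \<oplus>\<^bsub>R\<^esub> b \<otimes>\<^bsub>R\<^esub> d) (s \<otimes>\<^bsub>R\<^esub> c) | a s b t c d.
                (a, s) \<in> U \<and> (b, t) \<in> V \<and> c \<in> carrier R \<and> d \<in> carrier R \<and>
                s \<otimes>\<^bsub>R\<^esub> c = t \<otimes>\<^bsub>R\<^esub> d \<and> s \<otimes>\<^bsub>R\<^esub> c \<in> regular_elements R})\<rparr>"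

definition centre :: "('a, 'm) ring_scheme \<Rightarrow> ('a, 'm) ring_scheme" where
  "centre R = R\<lparr>carrier := {z \<in> carrier R. \<forall>x \<in> carrier R. z \<otimes>\<^bsub>R\<^esub> x = x \<otimes>\<^bsub>R\<^esub> z}\<rparr>"


section \<open>Transcendence degree\<close>

text \<open>Here \<open>f\<close> is the structure map making the commutative ring Z a K-algebra. Polynomials over K
  with variables indexed by B are those of \<^theory>\<open>HOL-Algebra.Indexed_Polynomials\<close>: a monomial is
  a multiset of variables, a polynomial maps monomials to coefficients. The variable indexed by
  \<open>b\<close> is evaluated at \<open>b\<close>.\<close>

definition poly_value ::
  "('k, 'm) ring_scheme \<Rightarrow> ('k \<Rightarrow> 'a) \<Rightarrow> ('a, 'n) ring_scheme \<Rightarrow> ('a multiset \<Rightarrow> 'k) \<Rightarrow> 'a" where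
  "poly_value K f Z p =
     (\<Oplus>\<^bsub>Z\<^esub>m \<in> {m. p m \<noteq> \<zero>\<^bsub>K\<^esub>}.
        f (p m) \<otimes>\<^bsub>Z\<^esub> (\<Otimes>\<^bsub>Z\<^esub>b \<in> set_mset m. b [^]\<^bsub>Z\<^esub> count m b))"

definition alg_independent ::
  "('k, 'm) ring_scheme \<Rightarrow> ('k \<Rightarrow> 'a) \<Rightarrow> ('a, 'n) ring_scheme \<Rightarrow> 'a set \<Rightarrow> bool" where
  "alg_independent K f Z B \<longleftrightarrow>
     B \<subseteq> carrier Z \<and>
     (\<forall>p \<in> ring.indexed_pset K B (carrier K).
        poly_value K f Z p = \<zero>\<^bsub>Z\<^esub> \<longrightarrow> (\<forall>m. p m = \<zero>\<^bsub>K\<^esub>))"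

text \<open>Largest cardinality of an algebraically independent set; \<open>\<infinity>\<close> if there is no bound on the
  finite ones.\<close>

definition trans_degree ::
  "('k, 'm) ring_scheme \<Rightarrow> ('k \<Rightarrow> 'a) \<Rightarrow> ('a, 'n) ring_scheme \<Rightarrow> enat" where
  "trans_degree K f Z = Sup {enat (card B) | B. finite B \<and> alg_independent K f Z B}"


section \<open>The strong Dixmier-Moeglin equivalence\<close>

definition prim_deg :: "('a, 'm) ring_scheme \<Rightarrow> 'a set \<Rightarrow> enat" where
  "prim_deg R P = Inf {height (R Quot P) Q | Q. primitive_ideal Q (R Quot P)}"

text \<open>The map K \<rightarrow> Frac (R/P) sends \<open>k\<close> to the image of \<open>k \<cdot> 1\<close>.\<close>

definition rat_deg ::
  "('k, 'm) ring_scheme \<Rightarrow> ('k, 'a, 'n) module_scheme \<Rightarrow> 'a set \<Rightarrow> enat" where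
  "rat_deg K R P =
     trans_degree K
       (\<lambda>k. ore_frac (R Quot P) (P +>\<^bsub>R\<^esub> (k \<odot>\<^bsub>R\<^esub> \<one>\<^bsub>R\<^esub>)) \<one>\<^bsub>R Quot P\<^esub>)
       (centre (Frac (R Quot P)))"

text \<open>The infimum is the least such integer, and \<open>\<infinity>\<close> if there is none. Intersecting with
  the carrier makes the empty intersection the whole ring.\<close>

definition loc_deg :: "('a, 'm) ring_scheme \<Rightarrow> 'a set \<Rightarrow> enat" where
  "loc_deg R P =
     Inf {enat d | d.
       carrier (R Quot P) \<inter> \<Inter>{Q. prime_ideal Q (R Quot P) \<and> height (R Quot P) Q > enat d}
         \<noteq> {\<zero>\<^bsub>R Quot P\<^esub>}}"

definition strong_Dixmier_Moeglin ::
  "('k, 'm) ring_scheme \<Rightarrow> ('k, 'a, 'n) module_scheme \<Rightarrow> bool" where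
  "strong_Dixmier_Moeglin K R \<longleftrightarrow>
     (\<forall>P. prime_ideal P R \<longrightarrow> loc_deg R P = prim_deg R P \<and> prim_deg R P = rat_deg K R P)"

definition finitely_generated_algebra ::
  "('k, 'm) ring_scheme \<Rightarrow> ('k, 'a, 'n) module_scheme \<Rightarrow> bool" where
  "finitely_generated_algebra K R \<longleftrightarrow>
     (\<exists>E. finite E \<and> E \<subseteq> carrier R \<and>
        generate_ring R ((\<lambda>k. k \<odot>\<^bsub>R\<^esub> \<one>\<^bsub>R\<^esub>) ` carrier K \<union> E) = carrier R)"


section \<open>Comparison with the commutative notions\<close>

lemma prime_ideal_cring_iff:
  assumes "cring R"
  shows "prime_ideal P R \<longleftrightarrow> primeideal P R"
proof
  interpret cring R by fact
  assume P: "prime_ideal P R"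
  then interpret P: ideal P R by (simp add: prime_ideal_def)
  show "primeideal P R"
  proof (rule primeidealI[OF P.is_ideal assms])
    show "carrier R \<noteq> P" using P by (auto simp: prime_ideal_def)
  next
    fix a b assume a: "a \<in> carrier R" and b: "b \<in> carrier R" and ab: "a \<otimes>\<^bsub>R\<^esub> b \<in> P"
    have "(PIdl\<^bsub>R\<^esub> a) \<cdot>\<^bsub>R\<^esub> (PIdl\<^bsub>R\<^esub> b) \<subseteq> P"
    proof
      fix x assume "x \<in> (PIdl\<^bsub>R\<^esub> a) \<cdot>\<^bsub>R\<^esub> (PIdl\<^bsub>R\<^esub> b)"
      then show "x \<in> P"
      proof (induction rule: ideal_prod.induct)
        case (prod i j)
        then obtain r s where r: "r \<in> carrier R" "i = r \<otimes>\<^bsub>R\<^esub> a"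
          and s: "s \<in> carrier R" "j = s \<otimes>\<^bsub>R\<^esub> b"
          by (auto simp: cgenideal_def)
        then have "i \<otimes>\<^bsub>R\<^esub> j = (r \<otimes>\<^bsub>R\<^esub> s) \<otimes>\<^bsub>R\<^esub> (a \<otimes>\<^bsub>R\<^esub> b)"
          using a b by (simp add: m_ac)
        then show ?case using P.I_l_closed[OF ab] r s by simp
      qed (rule P.a_closed)
    qed
    then have "PIdl\<^bsub>R\<^esub> a \<subseteq> P \<or> PIdl\<^bsub>R\<^esub> b \<subseteq> P"
      using P cgenideal_ideal a b unfolding prime_ideal_def by blast
    then show "a \<in> P \<or> b \<in> P"
      using cgenideal_self a b by blast
  qed
next
  assume "primeideal P R"
  then interpret primeideal P R .
  have "I \<subseteq> P \<or> J \<subseteq> P" if "ideal I R" "ideal J R" "I \<cdot>\<^bsub>R\<^esub> J \<subseteq> P" for I J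
  proof (rule ccontr)
    assume "\<not> ?thesis"
    then obtain i j where ij: "i \<in> I" "i \<notin> P" "j \<in> J" "j \<notin> P" by blast
    then have "i \<otimes>\<^bsub>R\<^esub> j \<in> P" using that(3) ideal_prod.prod by fastforce
    then show False
      using I_prime ij ideal.Icarr[OF that(1)] ideal.Icarr[OF that(2)] by blast
  qed
  then show "prime_ideal P R"
    using is_ideal I_notcarr by (auto simp: prime_ideal_def)
qed

lemma left_module_cring_iff:
  assumes "cring R"
  shows "left_module R M \<longleftrightarrow> module R M"
proof -
  have "left_module_axioms R M \<longleftrightarrow> module_axioms R M"
    by (simp only: left_module_axioms_def module_axioms_def)
  then show ?thesis
    using assms cring.axioms(1)[OF assms] by (simp only: left_module_def module_def simp_thms)
qed

lemma (in domain) regular_elements_domain: "regular_elements R = carrier R - {\<zero>}"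
proof -
  have "\<zero> \<notin> regular_elements R"
    using one_not_zero one_closed l_null[of \<one>] unfolding regular_elements_def by blast
  then show ?thesis
    using integral unfolding regular_elements_def by blast
qed

lemma (in domain) mem_ore_frac_iff:
  assumes "a \<in> carrier R" "s \<in> carrier R - {\<zero>}"
  shows "(b, t) \<in> ore_frac R a s \<longleftrightarrow>
           b \<in> carrier R \<and> t \<in> carrier R - {\<zero>} \<and> a \<otimes> t = b \<otimes> s"
proof
  assume "(b, t) \<in> ore_frac R a s"
  then obtain c d where H: "b \<in> carrier R" "t \<in> carrier R - {\<zero>}" "c \<in> carrier R" "d \<in> carrier R"
    "s \<otimes> c = t \<otimes> d" "s \<otimes> c \<noteq> \<zero>" "a \<otimes> c = b \<otimes> d"
    by (auto simp: ore_frac_def regular_elements_domain)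
  have cz: "c \<noteq> \<zero>" using H assms by auto
  have cs: "a \<in> carrier R" "s \<in> carrier R" "t \<in> carrier R" using H assms by auto
  have "c \<otimes> (a \<otimes> t) = t \<otimes> (a \<otimes> c)" using H(3) cs by (simp add: m_ac)
  also have "\<dots> = b \<otimes> (t \<otimes> d)" unfolding H(7) using H(1,4) cs by (simp add: m_ac)
  also have "\<dots> = c \<otimes> (b \<otimes> s)" unfolding H(5)[symmetric] using H(1,3) cs by (simp add: m_ac)
  finally have "a \<otimes> t = b \<otimes> s" using m_lcancel[OF cz] H assms by auto
  with H show "b \<in> carrier R \<and> t \<in> carrier R - {\<zero>} \<and> a \<otimes> t = b \<otimes> s" by simp
next
  assume H: "b \<in> carrier R \<and> t \<in> carrier R - {\<zero>} \<and> a \<otimes> t = b \<otimes> s"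
  then have "s \<otimes> t \<in> regular_elements R" "s \<otimes> t = t \<otimes> s"
    using assms integral by (auto simp: regular_elements_domain m_comm)
  moreover have "t \<in> carrier R" "s \<in> carrier R" "t \<in> regular_elements R"
    using H assms by (auto simp: regular_elements_domain)
  ultimately show "(b, t) \<in> ore_frac R a s"
    unfolding ore_frac_def using H by blast
qed

lemma (in domain) ore_frac_eq_iff:
  assumes "a \<in> carrier R" "s \<in> carrier R - {\<zero>}" "b \<in> carrier R" "t \<in> carrier R - {\<zero>}"
  shows "ore_frac R a s = ore_frac R b t \<longleftrightarrow> a \<otimes> t = b \<otimes> s"
proof
  assume "ore_frac R a s = ore_frac R b t"
  moreover have "(b, t) \<in> ore_frac R b t" using assms by (simp add: mem_ore_frac_iff)
  ultimately show "a \<otimes> t = b \<otimes> s" using assms mem_ore_frac_iff by blast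
next
  assume eq: "a \<otimes> t = b \<otimes> s"
  have "a \<otimes> u = x \<otimes> s \<longleftrightarrow> b \<otimes> u = x \<otimes> t" if "x \<in> carrier R" "u \<in> carrier R" for x u
  proof -
    have "a \<otimes> u = x \<otimes> s \<longleftrightarrow> t \<otimes> (a \<otimes> u) = t \<otimes> (x \<otimes> s)"
      using m_lcancel[of t] that assms by auto
    also have "t \<otimes> (a \<otimes> u) = u \<otimes> (a \<otimes> t)" using that assms by (simp add: m_ac)
    also have "\<dots> = s \<otimes> (b \<otimes> u)" unfolding eq using that assms by (simp add: m_ac)
    also have "t \<otimes> (x \<otimes> s) = s \<otimes> (x \<otimes> t)" using that assms by (simp add: m_ac)
    finally show ?thesis using m_lcancel[of s] that assms by auto
  qed
  then show "ore_frac R a s = ore_frac R b t"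
    using assms by (auto simp: mem_ore_frac_iff)
qed

lemma Union_eq_if_all_eq: "\<Union>S = c" if "\<And>U. U \<in> S \<Longrightarrow> U = c" "d \<in> S"
  using that by auto

lemma (in domain) Frac_mult:
  assumes "a \<in> carrier R" "s \<in> carrier R - {\<zero>}" "b \<in> carrier R" "t \<in> carrier R - {\<zero>}"
  shows "ore_frac R a s \<otimes>\<^bsub>Frac R\<^esub> ore_frac R b t = ore_frac R (a \<otimes> b) (s \<otimes> t)"
proof -
  have nz: "x \<otimes> y \<in> carrier R - {\<zero>}" if "x \<in> carrier R - {\<zero>}" "y \<in> carrier R - {\<zero>}" for x y
    using that integral by auto
  let ?S = "{ore_frac R (a' \<otimes> b') (t' \<otimes> s') | a' s'' b'' t' b' s'.
    (a', s'') \<in> ore_frac R a s \<and> (b'', t') \<in> ore_frac R b t \<and> b' \<in> carrier R \<and>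
    s' \<in> regular_elements R \<and> s'' \<otimes> b' = b'' \<otimes> s'}"
  have "U = ore_frac R (a \<otimes> b) (s \<otimes> t)" if "U \<in> ?S" for U
  proof -
    from that obtain a1 s1 b1 t1 b2 s2 where U: "U = ore_frac R (a1 \<otimes> b2) (t1 \<otimes> s2)"
      and "(a1, s1) \<in> ore_frac R a s" "(b1, t1) \<in> ore_frac R b t" "b2 \<in> carrier R"
      "s2 \<in> carrier R - {\<zero>}" and o: "s1 \<otimes> b2 = b1 \<otimes> s2"
      unfolding regular_elements_domain by blast
    then have c: "a1 \<in> carrier R" "s1 \<in> carrier R" "b1 \<in> carrier R" "t1 \<in> carrier R"
        "b2 \<in> carrier R" "s2 \<in> carrier R"
      and n: "s1 \<in> carrier R - {\<zero>}" "t1 \<in> carrier R - {\<zero>}" "s2 \<in> carrier R - {\<zero>}"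
      and e: "a \<otimes> s1 = a1 \<otimes> s" "b \<otimes> t1 = b1 \<otimes> t"
      using assms by (auto simp: mem_ore_frac_iff)
    have cs: "s \<in> carrier R" "t \<in> carrier R" using assms by auto
    have "s1 \<otimes> ((a1 \<otimes> b2) \<otimes> (s \<otimes> t)) = (a1 \<otimes> s) \<otimes> (s1 \<otimes> b2) \<otimes> t"
      using c cs by (simp add: m_ac)
    also have "\<dots> = (a \<otimes> s1) \<otimes> (b1 \<otimes> t) \<otimes> s2"
      unfolding e(1)[symmetric] o using c cs assms by (simp add: m_ac)
    also have "\<dots> = s1 \<otimes> ((a \<otimes> b) \<otimes> (t1 \<otimes> s2))"
      unfolding e(2)[symmetric] using c cs assms by (simp add: m_ac)
    finally have "(a1 \<otimes> b2) \<otimes> (s \<otimes> t) = (a \<otimes> b) \<otimes> (t1 \<otimes> s2)"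
      using m_lcancel[of s1] n c cs assms by auto
    then show ?thesis
      unfolding U using c n assms nz by (subst ore_frac_eq_iff) auto
  qed
  moreover have "ore_frac R (a \<otimes> b) (t \<otimes> s) \<in> ?S"
  proof -
    have "(a, s) \<in> ore_frac R a s" "(b, t) \<in> ore_frac R b t" "s \<otimes> b = b \<otimes> s"
      "s \<in> regular_elements R"
      using assms by (auto simp: mem_ore_frac_iff regular_elements_domain m_comm)
    then show ?thesis using assms by blast
  qed
  ultimately have "\<Union>?S = ore_frac R (a \<otimes> b) (s \<otimes> t)"
    by (rule Union_eq_if_all_eq)
  then show ?thesis by (simp add: Frac_def)
qed

lemma (in domain) Frac_add:
  assumes "a \<in> carrier R" "s \<in> carrier R - {\<zero>}" "b \<in> carrier R" "t \<in> carrier R - {\<zero>}"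
  shows "ore_frac R a s \<oplus>\<^bsub>Frac R\<^esub> ore_frac R b t = ore_frac R (a \<otimes> t \<oplus> b \<otimes> s) (s \<otimes> t)"
proof -
  have nz: "x \<otimes> y \<in> carrier R - {\<zero>}" if "x \<in> carrier R - {\<zero>}" "y \<in> carrier R - {\<zero>}" for x y
    using that integral by auto
  let ?S = "{ore_frac R (a' \<otimes> c \<oplus> b' \<otimes> d) (s' \<otimes> c) | a' s' b' t' c d.
    (a', s') \<in> ore_frac R a s \<and> (b', t') \<in> ore_frac R b t \<and> c \<in> carrier R \<and> d \<in> carrier R \<and>
    s' \<otimes> c = t' \<otimes> d \<and> s' \<otimes> c \<in> regular_elements R}"
  have "U = ore_frac R (a \<otimes> t \<oplus> b \<otimes> s) (s \<otimes> t)" if "U \<in> ?S" for U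
  proof -
    from that obtain a1 s1 b1 t1 c d where U: "U = ore_frac R (a1 \<otimes> c \<oplus> b1 \<otimes> d) (s1 \<otimes> c)"
      and "(a1, s1) \<in> ore_frac R a s" "(b1, t1) \<in> ore_frac R b t"
      and cd: "c \<in> carrier R" "d \<in> carrier R"
      and o: "s1 \<otimes> c = t1 \<otimes> d" and r: "s1 \<otimes> c \<in> carrier R - {\<zero>}"
      unfolding regular_elements_domain by blast
    then have c: "a1 \<in> carrier R" "s1 \<in> carrier R" "b1 \<in> carrier R" "t1 \<in> carrier R"
      and e: "a \<otimes> s1 = a1 \<otimes> s" "b \<otimes> t1 = b1 \<otimes> t"
      using assms by (auto simp: mem_ore_frac_iff)
    have cs: "s \<in> carrier R" "t \<in> carrier R" using assms by auto
    have 1: "(a1 \<otimes> c) \<otimes> (s \<otimes> t) = (a \<otimes> t) \<otimes> (s1 \<otimes> c)"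
    proof -
      have "(a1 \<otimes> c) \<otimes> (s \<otimes> t) = (a1 \<otimes> s) \<otimes> (c \<otimes> t)" using c cs cd by (simp add: m_ac)
      also have "\<dots> = (a \<otimes> t) \<otimes> (s1 \<otimes> c)"
        unfolding e(1)[symmetric] using c cs cd assms by (simp add: m_ac)
      finally show ?thesis .
    qed
    have 2: "(b1 \<otimes> d) \<otimes> (s \<otimes> t) = (b \<otimes> s) \<otimes> (s1 \<otimes> c)"
    proof -
      have "(b1 \<otimes> d) \<otimes> (s \<otimes> t) = (b1 \<otimes> t) \<otimes> (d \<otimes> s)" using c cs cd by (simp add: m_ac)
      also have "\<dots> = (b \<otimes> s) \<otimes> (t1 \<otimes> d)"
        unfolding e(2)[symmetric] using c cs cd assms by (simp add: m_ac)
      finally show ?thesis using o by simp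
    qed
    have "(a1 \<otimes> c \<oplus> b1 \<otimes> d) \<otimes> (s \<otimes> t) = (a \<otimes> t \<oplus> b \<otimes> s) \<otimes> (s1 \<otimes> c)"
      using 1 2 c cs cd assms by (simp add: l_distr)
    then show ?thesis
      unfolding U using c cd r cs assms nz[of s t] by (subst ore_frac_eq_iff) auto
  qed
  moreover have "ore_frac R (a \<otimes> t \<oplus> b \<otimes> s) (s \<otimes> t) \<in> ?S"
  proof -
    have "(a, s) \<in> ore_frac R a s" "(b, t) \<in> ore_frac R b t" "s \<otimes> t = t \<otimes> s"
      "s \<otimes> t \<in> regular_elements R"
      using assms nz by (auto simp: mem_ore_frac_iff regular_elements_domain m_comm)
    then show ?thesis using assms by blast
  qed
  ultimately have "\<Union>?S = ore_frac R (a \<otimes> t \<oplus> b \<otimes> s) (s \<otimes> t)"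
    by (rule Union_eq_if_all_eq)
  then show ?thesis by (simp add: Frac_def)
qed

end

theory Submission
  imports Defs
begin

text \<open>Let \<open>A = R/P\<close> and let \<open>d\<close> be its transcendence degree. By the Nullstellensatz the Jacobson radical
  of \<open>A\<close> vanishes, so all three degrees equal \<open>d\<close> once every maximal ideal has height \<open>d\<close>. Chains
  of primes have length at most \<open>d\<close>, because the transcendence degree drops along proper inclusions
  of primes. Conversely, it suffices to find in a nonzero maximal ideal \<open>m\<close> a nonzero prime
  \<open>Q\<close> with \<open>A/Q\<close> of transcendence degree \<open>d - 1\<close>. Normalise \<open>A\<close> over \<open>K[y\<^sub>1, \<dots>, y\<^sub>d] = C[x]\<close> with
  \<open>x = y\<^sub>d\<close>, and choose a monic \<open>p \<in> K[x] \<inter> m\<close>. A prime \<open>Q \<subseteq> m\<close> containing \<open>p\<close> with \<open>Q \<inter> C = 0\<close>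
  exists unless \<open>s u \<in> p A\<close> for some nonzero \<open>s \<in> C\<close> and some \<open>u \<notin> m\<close>; instead of going down over a
  normal ring, this is excluded by an almost integrality argument, using that \<open>A\<close> is noetherian
  and nearly free over \<open>C[x]\<close>.\<close>

section \<open>Linear combinations\<close>

text \<open>The ring \<open>A\<close> need not be free over \<open>C[x]\<close>. What survives of
  freeness is one nonzero \<open>e\<close> such that \<open>e A\<close> lies in a free
  \<open>C[x]\<close>-module. As \<open>e\<close> need not be a unit, dividing coordinates once by
  \<open>p\<close> says nothing about \<open>u\<close> itself. But the same \<open>e\<close> serves
  all powers of \<open>u\<close>, and noetherianity turns this infinite supply of divisibilities
  into one equation from which \<open>e\<close> can be cancelled. The same \<open>e\<close> gives
  the Nullstellensatz: a polynomial of positive degree never becomes a unit of \<open>A\<close>. For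
  the last variable this is Zariski's lemma. The polynomial \<open>p\<close> is a monic equation
  over \<open>K\<close> of the residue class of \<open>x\<close> in the field \<open>A/m\<close>,
  which is finite over \<open>K\<close>; and \<open>Q \<inter> C = 0\<close> keeps the other
  \<open>d - 1\<close> variables independent modulo \<open>Q\<close>. Transcendence degrees are
  bounded by counting monomials, not by exchanging bases: a count that yields homogeneous relations
  works in \<open>A\<close> and, after clearing denominators, in its fraction field.\<close>

inductive_set (in ring) lin :: "'a set \<Rightarrow> ('i \<Rightarrow> 'a) \<Rightarrow> 'i set \<Rightarrow> 'a set" for S g I where
  zero: "\<zero> \<in> lin S g I"
| step: "\<lbrakk>a \<in> S; i \<in> I; x \<in> lin S g I\<rbrakk> \<Longrightarrow> a \<otimes> g i \<oplus> x \<in> lin S g I"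

text \<open>The last argument collects the values that count as zero. With a prime ideal there,
  independence in the quotient is expressed by elements of \<open>R\<close> itself. The coefficients
  must still vanish exactly, which is right for a subfield \<open>S\<close>, as it meets a proper
  ideal only in zero.\<close>

definition (in ring) indep :: "'a set \<Rightarrow> ('i \<Rightarrow> 'a) \<Rightarrow> 'i set \<Rightarrow> 'a set \<Rightarrow> bool" where
  "indep S g I P \<longleftrightarrow>
     (\<forall>J a. finite J \<longrightarrow> J \<subseteq> I \<longrightarrow> a \<in> J \<rightarrow> S \<longrightarrow> (\<Oplus>i\<in>J. a i \<otimes> g i) \<in> P \<longrightarrow> (\<forall>i\<in>J. a i = \<zero>))"

context cring
begin

lemma indepD:
  assumes "indep S g I P" "finite J" "J \<subseteq> I" "a \<in> J \<rightarrow> S" "(\<Oplus>i\<in>J. a i \<otimes> g i) \<in> P" "i \<in> J"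
  shows "a i = \<zero>"
  using assms unfolding indep_def by blast

lemma lin_closed:
  assumes "x \<in> lin S g I" "S \<subseteq> carrier R" "g \<in> I \<rightarrow> carrier R"
  shows "x \<in> carrier R"
  using assms by (induction rule: lin.induct) (auto simp: Pi_iff)

lemma lin_mono:
  assumes "I \<subseteq> I'" "S \<subseteq> S'" shows "lin S g I \<subseteq> lin S' g I'"
proof
  fix x assume "x \<in> lin S g I"
  then show "x \<in> lin S' g I'" using assms by (induction rule: lin.induct) (auto intro: lin.intros)
qed

lemma lin_cong:
  assumes "\<And>i. i \<in> I \<Longrightarrow> g i = h i" shows "lin S g I = lin S h I"
proof (intro equalityI subsetI)
  fix x assume "x \<in> lin S g I"
  then show "x \<in> lin S h I" using assms
    by (induction rule: lin.induct) (auto intro: lin.intros)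
next
  fix x assume "x \<in> lin S h I"
  then show "x \<in> lin S g I" using assms
    by (induction rule: lin.induct) (metis lin.zero, metis lin.step)
qed

lemma lin_add:
  assumes "x \<in> lin S g I" "y \<in> lin S g I" "S \<subseteq> carrier R" "g \<in> I \<rightarrow> carrier R"
  shows "x \<oplus> y \<in> lin S g I"
  using assms
proof (induction rule: lin.induct)
  case zero
  then show ?case using lin_closed[of y S g I] by simp
next
  case (step a i x)
  then have "(a \<otimes> g i \<oplus> x) \<oplus> y = a \<otimes> g i \<oplus> (x \<oplus> y)"
    using lin_closed[of y S g I] lin_closed[of x S g I] by (auto simp: a_assoc Pi_iff subset_iff)
  then show ?case using step by (auto intro: lin.step)
qed

lemma lin_base:
  assumes "a \<in> S" "i \<in> I" "S \<subseteq> carrier R" "g \<in> I \<rightarrow> carrier R"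
  shows "a \<otimes> g i \<in> lin S g I"
proof -
  have "a \<otimes> g i \<oplus> \<zero> \<in> lin S g I" using assms by (intro lin.intros)
  then show ?thesis using assms by (auto simp: Pi_iff subset_iff)
qed

lemma lin_minimal:
  assumes "x \<in> lin S g I" "\<zero> \<in> W" "\<And>u v. u \<in> W \<Longrightarrow> v \<in> W \<Longrightarrow> u \<oplus> v \<in> W"
    "\<And>a i. a \<in> S \<Longrightarrow> i \<in> I \<Longrightarrow> a \<otimes> g i \<in> W"
  shows "x \<in> W"
  using assms by (induction rule: lin.induct) auto

lemma lin_smult:
  assumes "x \<in> lin S g I" "c \<in> S" "subring S R" "g \<in> I \<rightarrow> carrier R"
  shows "c \<otimes> x \<in> lin S g I"
  using assms
proof (induction rule: lin.induct)
  case zero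
  then have "c \<in> carrier R" using subringE(1)[of S R] by auto
  then show ?case by (simp add: lin.zero)
next
  case (step a i x)
  have c: "S \<subseteq> carrier R" using step subringE(1) by blast
  have "c \<otimes> (a \<otimes> g i \<oplus> x) = (c \<otimes> a) \<otimes> g i \<oplus> c \<otimes> x"
    using step c lin_closed[OF step(3) c] by (auto simp: r_distr m_assoc Pi_iff subset_iff)
  then show ?case using step subringE(6)[of S R] by (auto intro: lin.step)
qed

lemma lin_minus:
  assumes "x \<in> lin S g I" "subring S R" "g \<in> I \<rightarrow> carrier R"
  shows "\<ominus> x \<in> lin S g I"
proof -
  have "x \<in> carrier R" by (rule lin_closed[OF assms(1) subringE(1)[OF assms(2)] assms(3)])
  then have "\<ominus> x = (\<ominus> \<one>) \<otimes> x" by (simp add: l_minus)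
  then show ?thesis using lin_smult[OF assms(1) _ assms(2,3)] subringE(3,5)[OF assms(2)] by simp
qed

lemma lin_sum:
  assumes "finite J" "\<And>j. j \<in> J \<Longrightarrow> f j \<in> lin S g I" "S \<subseteq> carrier R" "g \<in> I \<rightarrow> carrier R"
  shows "(\<Oplus>j\<in>J. f j) \<in> lin S g I"
  using assms
proof (induction J)
  case empty
  then show ?case by (simp add: lin.zero)
next
  case (insert j J)
  have "f i \<in> carrier R" if "i \<in> insert j J" for i
    by (rule lin_closed[OF insert(4)[OF that] insert(5,6)])
  then have "f \<in> J \<rightarrow> carrier R" "f j \<in> carrier R" by auto
  then show ?case using insert by (auto intro: lin_add)
qed

lemma lin_trans:
  assumes "x \<in> lin S g I" "subring S R" "h \<in> J \<rightarrow> carrier R" "\<And>i. i \<in> I \<Longrightarrow> g i \<in> lin S h J"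
  shows "x \<in> lin S h J"
  using assms(1)
proof (rule lin_minimal)
  show "\<zero> \<in> lin S h J" by (rule lin.zero)
  show "u \<oplus> v \<in> lin S h J" if "u \<in> lin S h J" "v \<in> lin S h J" for u v
    by (rule lin_add[OF that subringE(1)[OF assms(2)] assms(3)])
  show "a \<otimes> g i \<in> lin S h J" if "a \<in> S" "i \<in> I" for a i
    by (rule lin_smult[OF assms(4)[OF that(2)] that(1) assms(2,3)])
qed

lemma lin_mult_right:
  assumes "x \<in> lin S g I" "c \<in> carrier R" "S \<subseteq> carrier R" "g \<in> I \<rightarrow> carrier R"
  shows "c \<otimes> x \<in> lin S (\<lambda>i. c \<otimes> g i) I"
  using assms
proof (induction rule: lin.induct)
  case zero
  then show ?case by (simp add: lin.zero)
next
  case (step a i x)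
  then have "c \<otimes> (a \<otimes> g i \<oplus> x) = a \<otimes> (c \<otimes> g i) \<oplus> c \<otimes> x"
    using lin_closed[of x S g I] by (auto simp: r_distr m_lcomm Pi_iff subset_iff)
  then show ?case using step by (auto intro: lin.step)
qed

lemma finsum_upd:
  assumes "finite I" "i \<in> I" "a \<in> carrier R" "c \<in> I \<rightarrow> carrier R" "g \<in> I \<rightarrow> carrier R"
  shows "(\<Oplus>j\<in>I. (c(i := a \<oplus> c i)) j \<otimes> g j) = a \<otimes> g i \<oplus> (\<Oplus>j\<in>I. c j \<otimes> g j)"
proof -
  have I: "I = insert i (I - {i})" "finite (I - {i})" "i \<notin> I - {i}" using assms by auto
  have 1: "(\<Oplus>j\<in>I. (c(i := a \<oplus> c i)) j \<otimes> g j)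
      = (a \<oplus> c i) \<otimes> g i \<oplus> (\<Oplus>j\<in>I - {i}. (c(i := a \<oplus> c i)) j \<otimes> g j)"
    apply (subst I(1), subst finsum_insert) using assms I by (auto simp: Pi_iff)
  have 2: "(\<Oplus>j\<in>I - {i}. (c(i := a \<oplus> c i)) j \<otimes> g j) = (\<Oplus>j\<in>I - {i}. c j \<otimes> g j)"
    using assms by (intro finsum_cong') (auto simp: Pi_iff)
  have 3: "(\<Oplus>j\<in>I. c j \<otimes> g j) = c i \<otimes> g i \<oplus> (\<Oplus>j\<in>I - {i}. c j \<otimes> g j)"
    apply (subst I(1), subst finsum_insert) using assms I by (auto simp: Pi_iff)
  have 4: "(\<Oplus>j\<in>I - {i}. c j \<otimes> g j) \<in> carrier R" using assms by (intro finsum_closed) auto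
  show ?thesis unfolding 1 2 3 using assms 4 by (auto simp: l_distr a_assoc Pi_iff)
qed

lemma lin_finite_coeffs:
  assumes "x \<in> lin S g I" "finite I" "subring S R" "g \<in> I \<rightarrow> carrier R"
  obtains c where "c \<in> I \<rightarrow> S" "x = (\<Oplus>i\<in>I. c i \<otimes> g i)"
proof -
  have S: "S \<subseteq> carrier R" using assms subringE(1) by blast
  have "\<exists>c. c \<in> I \<rightarrow> S \<and> x = (\<Oplus>i\<in>I. c i \<otimes> g i)"
    using assms(1)
  proof (induction rule: lin.induct)
    case zero
    have "(\<Oplus>i\<in>I. \<zero> \<otimes> g i) = (\<Oplus>i\<in>I. \<zero>)" using assms(4) by (intro finsum_cong') (auto simp: Pi_iff)
    then show ?case using subringE(2)[OF assms(3)]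
      by (intro exI[of _ "\<lambda>_. \<zero>"]) auto
  next
    case (step a i x)
    then obtain c where c: "c \<in> I \<rightarrow> S" "x = (\<Oplus>i\<in>I. c i \<otimes> g i)" by blast
    have "a \<in> carrier R" "c \<in> I \<rightarrow> carrier R" using c S step(1) by auto
    then have "a \<otimes> g i \<oplus> x = (\<Oplus>j\<in>I. (c(i := a \<oplus> c i)) j \<otimes> g j)"
      unfolding c(2) using finsum_upd[OF assms(2) step(2) _ _ assms(4)] by simp
    moreover have "c(i := a \<oplus> c i) \<in> I \<rightarrow> S"
      using c step(1,2) subringE(7)[OF assms(3)] by (auto simp: Pi_iff)
    ultimately show ?case by blast
  qed
  then show ?thesis using that by blast
qed

lemma lin_finite_subset:
  assumes "x \<in> lin S g I"
  obtains J where "finite J" "J \<subseteq> I" "x \<in> lin S g J"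
proof -
  have "\<exists>J. finite J \<and> J \<subseteq> I \<and> x \<in> lin S g J" using assms
  proof (induction rule: lin.induct)
    case zero
    then show ?case by (intro exI[of _ "{}"]) (auto intro: lin.zero)
  next
    case (step a i x)
    then obtain J where J: "finite J" "J \<subseteq> I" "x \<in> lin S g J" by blast
    have "x \<in> lin S g (insert i J)" using J(3) lin_mono[of J "insert i J" S S g] by auto
    with J step show ?case
      by (intro exI[of _ "insert i J"]) (auto intro: lin.step)
  qed
  then show ?thesis using that by blast
qed

lemma lin_explicit:
  assumes "x \<in> lin S g I" "subring S R" "g \<in> I \<rightarrow> carrier R"
  obtains J c where "finite J" "J \<subseteq> I" "c \<in> J \<rightarrow> S" "x = (\<Oplus>i\<in>J. c i \<otimes> g i)"
proof -
  obtain J where J: "finite J" "J \<subseteq> I" "x \<in> lin S g J" using lin_finite_subset[OF assms(1)] .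
  obtain c where "c \<in> J \<rightarrow> S" "x = (\<Oplus>i\<in>J. c i \<otimes> g i)"
    using lin_finite_coeffs[OF J(3,1) assms(2)] assms(3) J(2) by blast
  with J that show thesis by blast
qed

lemma lin_of_sum:
  assumes "finite J" "J \<subseteq> I" "c \<in> J \<rightarrow> S" "S \<subseteq> carrier R" "g \<in> I \<rightarrow> carrier R"
  shows "(\<Oplus>i\<in>J. c i \<otimes> g i) \<in> lin S g I"
  using assms by (intro lin_sum lin_base) auto

text \<open>The two coefficient families glue to one on the union of their supports. This isolates
  the terms of top degree in \<open>indep_transc\<close>.\<close>

lemma indep_disjoint:
  assumes "indep S g I {\<zero>}" "I1 \<subseteq> I" "I2 \<subseteq> I" "I1 \<inter> I2 = {}" "subring S R" "g \<in> I \<rightarrow> carrier R"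
    "u \<in> lin S g I1" "v \<in> lin S g I2" "u \<oplus> v = \<zero>"
  shows "u = \<zero>"
proof -
  have S: "S \<subseteq> carrier R" using assms subringE(1) by blast
  have g1: "g \<in> I1 \<rightarrow> carrier R" and g2: "g \<in> I2 \<rightarrow> carrier R" using assms by auto
  obtain J c where J: "finite J" "J \<subseteq> I1" "c \<in> J \<rightarrow> S" "u = (\<Oplus>i\<in>J. c i \<otimes> g i)"
    using lin_explicit[OF assms(7,5) g1] by blast
  obtain J' c' where J': "finite J'" "J' \<subseteq> I2" "c' \<in> J' \<rightarrow> S" "v = (\<Oplus>i\<in>J'. c' i \<otimes> g i)"
    using lin_explicit[OF assms(8,5) g2] by blast
  define d where "d = (\<lambda>i. if i \<in> J then c i else c' i)"
  have dis: "J \<inter> J' = {}" using J J' assms by blast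
  have "(\<Oplus>i\<in>J \<union> J'. d i \<otimes> g i) = (\<Oplus>i\<in>J. d i \<otimes> g i) \<oplus> (\<Oplus>i\<in>J'. d i \<otimes> g i)"
    using J J' dis S g1 g2 by (intro finsum_Un_disjoint) (auto simp: d_def Pi_iff subset_iff)
  also have "(\<Oplus>i\<in>J. d i \<otimes> g i) = u" unfolding J(4)
    using J S g1 by (intro finsum_cong') (auto simp: d_def Pi_iff subset_iff)
  also have "(\<Oplus>i\<in>J'. d i \<otimes> g i) = v" unfolding J'(4)
    using J' dis S g2 by (intro finsum_cong') (auto simp: d_def Pi_iff subset_iff)
  finally have *: "(\<Oplus>i\<in>J \<union> J'. d i \<otimes> g i) \<in> {\<zero>}" using assms by simp
  have dS: "d \<in> J \<union> J' \<rightarrow> S" using J J' by (auto simp: d_def)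
  have "c i = \<zero>" if "i \<in> J" for i
    using indepD[OF assms(1) _ _ dS *, of i] J(1,2) J'(1,2) assms(2,3) that by (auto simp: d_def)
  then have "u = (\<Oplus>i\<in>J. \<zero>)" unfolding J(4) using J(2) g1 by (intro finsum_cong') (auto simp: Pi_iff subset_iff)
  then show ?thesis by simp
qed

text \<open>More vectors than generators: eliminate one generator at a time.\<close>

lemma dependent_of_card:
  assumes "finite J" "finite I" "card J < card I" "subfield K R" "g \<in> J \<rightarrow> carrier R"
    "\<And>i. i \<in> I \<Longrightarrow> w i \<in> lin K g J"
  shows "\<exists>c. c \<in> I \<rightarrow> K \<and> (\<exists>i\<in>I. c i \<noteq> \<zero>) \<and> (\<Oplus>i\<in>I. c i \<otimes> w i) = \<zero>"
  using assms(1,2,3,5,6)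
proof (induction J arbitrary: I w rule: finite_induct)
  case empty
  have K: "subring K R" using assms(4) subfieldE by blast
  have w0: "w i = \<zero>" if "i \<in> I" for i using empty(4)[OF that] by (auto elim: lin.cases)
  have "(\<Oplus>i\<in>I. \<one> \<otimes> w i) = (\<Oplus>i\<in>I. \<zero>)" using w0 by (intro finsum_cong') auto
  moreover have "I \<noteq> {}" using empty by auto
  ultimately show ?case using subringE(3)[OF K] subfieldE(6)[OF assms(4)]
    by (intro exI[of _ "\<lambda>_. \<one>"]) auto
next
  case (insert j J)
  have K: "subring K R" using assms(4) subfieldE by blast
  have KR: "K \<subseteq> carrier R" using subringE(1)[OF K] .
  have gj: "g j \<in> carrier R" and gJ: "g \<in> J \<rightarrow> carrier R" using insert by auto
  have "\<exists>a v. a \<in> K \<and> v \<in> lin K g J \<and> w i = a \<otimes> g j \<oplus> v" if i: "i \<in> I" for i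
  proof -
    obtain c where c: "c \<in> insert j J \<rightarrow> K" "w i = (\<Oplus>i\<in>insert j J. c i \<otimes> g i)"
      using lin_finite_coeffs[OF insert(7)[OF i] _ K insert(6)] insert(1) by auto
    have "w i = c j \<otimes> g j \<oplus> (\<Oplus>i\<in>J. c i \<otimes> g i)"
      unfolding c(2) using insert c KR gj gJ by (subst finsum_insert) (auto simp: Pi_iff subset_iff)
    moreover have "(\<Oplus>i\<in>J. c i \<otimes> g i) \<in> lin K g J"
      using c insert(1) KR gJ by (intro lin_of_sum) auto
    ultimately show ?thesis using c by blast
  qed
  then obtain a v where av: "\<And>i. i \<in> I \<Longrightarrow> a i \<in> K" "\<And>i. i \<in> I \<Longrightarrow> v i \<in> lin K g J"
    "\<And>i. i \<in> I \<Longrightarrow> w i = a i \<otimes> g j \<oplus> v i" by metis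
  show ?case
  proof (cases "\<forall>i\<in>I. a i = \<zero>")
    case True
    then have "w i \<in> lin K g J" if "i \<in> I" for i
      using av(2,3)[OF that] lin_closed[OF av(2)[OF that] KR gJ] that gj by simp
    then show ?thesis using insert.IH[of I w] insert gJ by auto
  next
    case False
    then obtain p where p: "p \<in> I" "a p \<noteq> \<zero>" by blast
    have ap: "inv (a p) \<in> K" "a p \<otimes> inv (a p) = \<one>" "inv (a p) \<in> carrier R" "a p \<in> carrier R"
      using subfield_m_inv[OF assms(4), of "a p"] p av(1) KR by auto
    have wc: "w i \<in> carrier R" if "i \<in> I" for i
      using lin_closed[OF insert(7)[OF that] KR insert(6)] .
    define b where "b = (\<lambda>i. a i \<otimes> inv (a p))"
    have bK: "b i \<in> K" if "i \<in> I" for i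
      using av(1) ap that subringE(6)[OF K] unfolding b_def by blast
    define w' where "w' = (\<lambda>i. w i \<oplus> (\<ominus> (b i)) \<otimes> w p)"
    have w': "w' i \<in> lin K g J" if i: "i \<in> I - {p}" for i
    proof -
      have vc: "v i \<in> carrier R" "v p \<in> carrier R"
        using lin_closed[OF av(2) KR gJ] i p by auto
      have ac: "a i \<in> carrier R" "b i \<in> carrier R" using av(1) bK KR i by auto
      have ba: "b i \<otimes> a p = a i" unfolding b_def using ac ap by (simp add: m_assoc m_comm[of "inv (a p)"])
      have "w' i = (a i \<otimes> g j \<oplus> v i) \<oplus> (\<ominus> (b i)) \<otimes> (a p \<otimes> g j \<oplus> v p)"
        unfolding w'_def using av(3) i p by simp
      also have "\<dots> = (a i \<otimes> g j \<oplus> \<ominus> ((b i \<otimes> a p) \<otimes> g j)) \<oplus> (v i \<oplus> (\<ominus> (b i)) \<otimes> v p)"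
        using ac ap vc gj by algebra
      also have "\<dots> = v i \<oplus> (\<ominus> (b i)) \<otimes> v p"
        unfolding ba using ac vc gj by (simp add: r_neg)
      also have "\<dots> \<in> lin K g J"
        using av(2) i p bK subringE(5)[OF K] K gJ KR by (intro lin_add lin_smult) auto
      finally show ?thesis .
    qed
    have "card J < card (I - {p})" using insert p by simp
    then obtain c where c: "c \<in> I - {p} \<rightarrow> K" "\<exists>i\<in>I - {p}. c i \<noteq> \<zero>"
      "(\<Oplus>i\<in>I - {p}. c i \<otimes> w' i) = \<zero>"
      using insert.IH[of "I - {p}" w'] w' insert(4) gJ by auto
    have cc: "c i \<in> carrier R" "b i \<in> carrier R" "w i \<in> carrier R" "w p \<in> carrier R"
      if "i \<in> I - {p}" for i using c bK KR wc p that by auto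
    \<comment> \<open>The coefficient of the pivot undoes the substitution
      \<open>w' i = w i - b i w p\<close>; the others stay as in \<open>c\<close>, so one of them
      remains nonzero.\<close>
    define d where "d = c(p := (\<Oplus>i\<in>I - {p}. c i \<otimes> (\<ominus> (b i))))"
    have dp: "d p \<in> K"
    proof -
      have "finite T \<Longrightarrow> T \<subseteq> I - {p} \<Longrightarrow> (\<Oplus>i\<in>T. c i \<otimes> (\<ominus> (b i))) \<in> K" for T
      proof (induction T rule: finite_induct)
        case empty
        then show ?case using subringE(2)[OF K] by simp
      next
        case (insert x T)
        have "c x \<otimes> \<ominus> b x \<in> K" using insert(4) subringE(6)[OF K Pi_mem[OF c(1)] subringE(5)[OF K bK]] by auto
        then show ?case using insert cc subringE(7)[OF K]
          by (subst finsum_insert) (auto simp: Pi_iff subset_iff)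
      qed
      then show ?thesis using insert(4) unfolding d_def by simp
    qed
    have I: "I = insert p (I - {p})" using p by auto
    have "(\<Oplus>i\<in>I. d i \<otimes> w i) = d p \<otimes> w p \<oplus> (\<Oplus>i\<in>I - {p}. d i \<otimes> w i)"
      apply (subst I, subst finsum_insert) using insert(4) cc dp KR wc p by (auto simp: d_def)
    also have "(\<Oplus>i\<in>I - {p}. d i \<otimes> w i) = (\<Oplus>i\<in>I - {p}. c i \<otimes> w i)"
      using cc by (intro finsum_cong') (auto simp: d_def)
    also have "d p \<otimes> w p = (\<Oplus>i\<in>I - {p}. (c i \<otimes> (\<ominus> (b i))) \<otimes> w p)"
      unfolding d_def using insert(4) cc wc p by (simp add: finsum_ldistr Pi_iff)
    also have "\<dots> \<oplus> (\<Oplus>i\<in>I - {p}. c i \<otimes> w i) = (\<Oplus>i\<in>I - {p}. (c i \<otimes> (\<ominus> (b i))) \<otimes> w p \<oplus> c i \<otimes> w i)"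
      using cc insert(4) by (subst finsum_addf) auto
    also have "\<dots> = (\<Oplus>i\<in>I - {p}. c i \<otimes> w' i)"
    proof (intro finsum_cong')
      fix i assume i: "i \<in> I - {p}"
      show "(c i \<otimes> (\<ominus> (b i))) \<otimes> w p \<oplus> c i \<otimes> w i = c i \<otimes> w' i"
        unfolding w'_def using cc[OF i] by algebra
    qed (use cc in \<open>auto simp: w'_def\<close>)
    finally have "(\<Oplus>i\<in>I. d i \<otimes> w i) = \<zero>" using c by simp
    moreover have "d \<in> I \<rightarrow> K" using c(1) dp by (auto simp: d_def Pi_iff)
    moreover have "\<exists>i\<in>I. d i \<noteq> \<zero>" using c(2) unfolding d_def by auto
    ultimately show ?thesis by blast
  qed
qed

end

section \<open>Polynomials in one element\<close>

text \<open>In \<open>lead S t c n x\<close> the coefficient \<open>c\<close> may be zero, and \<open>x\<close> determines it only if \<open>t\<close> is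
  transcendental over \<open>S\<close>.\<close>

definition (in ring) low :: "'a set \<Rightarrow> 'a \<Rightarrow> nat \<Rightarrow> 'a set" where
  "low S t n = lin S (\<lambda>j. t [^] j) {..<n}"

definition (in ring) lead :: "'a set \<Rightarrow> 'a \<Rightarrow> 'a \<Rightarrow> nat \<Rightarrow> 'a \<Rightarrow> bool" where
  "lead S t c n x \<longleftrightarrow> (\<exists>l \<in> low S t n. x = c \<otimes> t [^] n \<oplus> l)"

text \<open>Vanishing of the top coefficient is enough: it can be stripped off and the argument
  repeated in lower degree. This is the form in which degrees are compared.\<close>

definition (in ring) transc :: "'a set \<Rightarrow> 'a \<Rightarrow> bool" where
  "transc S t \<longleftrightarrow> (\<forall>n. \<forall>c \<in> S. lead S t c n \<zero> \<longrightarrow> c = \<zero>)"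

definition (in ring) adjoin :: "'a set \<Rightarrow> 'a \<Rightarrow> 'a set" where
  "adjoin S t = (\<Union>n. low S t n)"

context cring
begin

lemma low_0: "low S t 0 = {\<zero>}"
  unfolding low_def by (auto elim: lin.cases intro: lin.zero)

lemma low_mono: "m \<le> n \<Longrightarrow> low S t m \<subseteq> low S t n"
  unfolding low_def by (intro lin_mono) auto

lemma zero_low: "\<zero> \<in> low S t n"
  unfolding low_def by (rule lin.zero)

context
  fixes S t assumes S: "subring S R" and t: "t \<in> carrier R"
begin

lemma SR: "S \<subseteq> carrier R" using subringE(1)[OF S] .

lemma low_closed: "x \<in> low S t n \<Longrightarrow> x \<in> carrier R"
  unfolding low_def using lin_closed[OF _ SR] t by blast

lemma low_add: "x \<in> low S t n \<Longrightarrow> y \<in> low S t n \<Longrightarrow> x \<oplus> y \<in> low S t n"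
  unfolding low_def using lin_add[OF _ _ SR] t by blast

lemma low_smult: "x \<in> low S t n \<Longrightarrow> c \<in> S \<Longrightarrow> c \<otimes> x \<in> low S t n"
  unfolding low_def using lin_smult[OF _ _ S] t by blast

lemma low_minus: "x \<in> low S t n \<Longrightarrow> \<ominus> x \<in> low S t n"
  unfolding low_def using lin_minus[OF _ S] t by blast

lemma low_base: "c \<in> S \<Longrightarrow> j < n \<Longrightarrow> c \<otimes> t [^] j \<in> low S t n"
  unfolding low_def using lin_base[OF _ _ SR, of c j "{..<n}" "\<lambda>j. t [^] j"] t by auto

lemma low_minimal:
  assumes "x \<in> low S t n" "\<zero> \<in> W" "\<And>u v. u \<in> W \<Longrightarrow> v \<in> W \<Longrightarrow> u \<oplus> v \<in> W"
    "\<And>a j. a \<in> S \<Longrightarrow> j < n \<Longrightarrow> a \<otimes> t [^] j \<in> W"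
  shows "x \<in> W"
  using lin_minimal[OF assms(1)[unfolded low_def] assms(2,3)] assms(4) by auto

lemma lead_low: "lead S t c n x \<Longrightarrow> c \<in> S \<Longrightarrow> x \<in> low S t (Suc n)"
  unfolding lead_def using low_add low_base[of c n "Suc n"] low_mono[of n "Suc n" S t] by fastforce

lemma lead_closed: "lead S t c n x \<Longrightarrow> c \<in> S \<Longrightarrow> x \<in> carrier R"
  using lead_low low_closed by blast

lemma low_Suc_iff: "x \<in> low S t (Suc n) \<longleftrightarrow> (\<exists>c \<in> S. lead S t c n x)"
proof
  assume "x \<in> low S t (Suc n)"
  then have "x \<in> {x. \<exists>c \<in> S. lead S t c n x}"
  proof (rule low_minimal)
    have "\<zero> = \<zero> \<otimes> t [^] n \<oplus> \<zero>" using t by simp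
    then show "\<zero> \<in> {x. \<exists>c \<in> S. lead S t c n x}"
      unfolding lead_def using subringE(2)[OF S] zero_low by blast
  next
    fix u v assume "u \<in> {x. \<exists>c \<in> S. lead S t c n x}" "v \<in> {x. \<exists>c \<in> S. lead S t c n x}"
    then obtain c l c' l' where H: "c \<in> S" "l \<in> low S t n" "u = c \<otimes> t [^] n \<oplus> l"
      "c' \<in> S" "l' \<in> low S t n" "v = c' \<otimes> t [^] n \<oplus> l'" unfolding lead_def by blast
    then have "c \<in> carrier R" "c' \<in> carrier R" "l \<in> carrier R" "l' \<in> carrier R" "t [^] n \<in> carrier R"
      using SR low_closed t by auto
    then have "u \<oplus> v = (c \<oplus> c') \<otimes> t [^] n \<oplus> (l \<oplus> l')" unfolding H by algebra
    then show "u \<oplus> v \<in> {x. \<exists>c \<in> S. lead S t c n x}"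
      unfolding lead_def using H low_add[of l n l'] subringE(7)[OF S] by blast
  next
    fix a j assume a: "a \<in> S" "j < Suc n"
    show "a \<otimes> t [^] j \<in> {x. \<exists>c \<in> S. lead S t c n x}"
    proof (cases "j = n")
      case True
      then have "a \<otimes> t [^] j = a \<otimes> t [^] n \<oplus> \<zero>" using a SR t by auto
      then show ?thesis unfolding lead_def using a zero_low by blast
    next
      case False
      then have "a \<otimes> t [^] j \<in> low S t n" using a by (intro low_base) auto
      moreover have "a \<otimes> t [^] j = \<zero> \<otimes> t [^] n \<oplus> a \<otimes> t [^] j" using a SR t by auto
      ultimately show ?thesis unfolding lead_def using subringE(2)[OF S] by blast
    qed
  qed
  then show "\<exists>c \<in> S. lead S t c n x" by simp
qed (use lead_low in blast)

lemma low_shift: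
  assumes "x \<in> low S t n" shows "t [^] k \<otimes> x \<in> low S t (k + n)"
proof -
  have "x \<in> {x \<in> carrier R. t [^] k \<otimes> x \<in> low S t (k + n)}"
    using assms
  proof (rule low_minimal)
    fix u v assume "u \<in> {x \<in> carrier R. t [^] k \<otimes> x \<in> low S t (k + n)}"
      "v \<in> {x \<in> carrier R. t [^] k \<otimes> x \<in> low S t (k + n)}"
    then show "u \<oplus> v \<in> {x \<in> carrier R. t [^] k \<otimes> x \<in> low S t (k + n)}"
      using low_add t by (auto simp: r_distr)
  next
    fix a j assume a: "a \<in> S" "j < n"
    then have "a \<in> carrier R" using SR by blast
    then have "t [^] k \<otimes> (a \<otimes> t [^] j) = a \<otimes> t [^] (k + j)"
      using t by (simp add: m_lcomm nat_pow_mult)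
    then show "a \<otimes> t [^] j \<in> {x \<in> carrier R. t [^] k \<otimes> x \<in> low S t (k + n)}"
      using a low_base[of a "k + j" "k + n"] \<open>a \<in> carrier R\<close> t by simp
  qed (use t zero_low in auto)
  then show ?thesis by simp
qed

lemma low_mult:
  assumes "x \<in> low S t m" "y \<in> low S t n" shows "x \<otimes> y \<in> low S t (m + n)"
proof -
  have y: "y \<in> carrier R" using assms low_closed by blast
  have "x \<in> {x \<in> carrier R. x \<otimes> y \<in> low S t (m + n)}"
    using assms(1)
  proof (rule low_minimal)
    fix u v assume "u \<in> {x \<in> carrier R. x \<otimes> y \<in> low S t (m + n)}"
      "v \<in> {x \<in> carrier R. x \<otimes> y \<in> low S t (m + n)}"
    then show "u \<oplus> v \<in> {x \<in> carrier R. x \<otimes> y \<in> low S t (m + n)}"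
      using low_add y by (auto simp: l_distr)
  next
    fix a j assume a: "a \<in> S" "j < m"
    then have ac: "a \<in> carrier R" using SR by blast
    have "a \<otimes> (t [^] j \<otimes> y) \<in> low S t (j + n)" using a low_shift[OF assms(2)] low_smult by blast
    then have "a \<otimes> t [^] j \<otimes> y \<in> low S t (m + n)"
      using low_mono[of "j + n" "m + n"] a ac t y by (auto simp: m_assoc)
    then show "a \<otimes> t [^] j \<in> {x \<in> carrier R. x \<otimes> y \<in> low S t (m + n)}" using ac t by simp
  qed (use y zero_low in auto)
  then show ?thesis by simp
qed

lemma lead_mult:
  assumes "lead S t c m x" "lead S t d n y" "c \<in> S" "d \<in> S"
  shows "lead S t (c \<otimes> d) (m + n) (x \<otimes> y)"
proof -
  obtain l l' where l: "l \<in> low S t m" "x = c \<otimes> t [^] m \<oplus> l"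
    and l': "l' \<in> low S t n" "y = d \<otimes> t [^] n \<oplus> l'" using assms unfolding lead_def by blast
  have cl: "c \<in> carrier R" "d \<in> carrier R" "l \<in> carrier R" "l' \<in> carrier R"
    "t [^] m \<in> carrier R" "t [^] n \<in> carrier R"
    using assms(3,4) SR l l' low_closed t by auto
  have "x \<otimes> y = (c \<otimes> d) \<otimes> (t [^] m \<otimes> t [^] n)
      \<oplus> (c \<otimes> (t [^] m \<otimes> l') \<oplus> (d \<otimes> (t [^] n \<otimes> l) \<oplus> l \<otimes> l'))"
    unfolding l l' using cl by algebra
  moreover have "c \<otimes> (t [^] m \<otimes> l') \<oplus> (d \<otimes> (t [^] n \<otimes> l) \<oplus> l \<otimes> l') \<in> low S t (m + n)"
    using low_add low_smult low_shift low_mult[OF l(1) l'(1)] low_shift[OF l'(1), of m]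
      low_shift[OF l(1), of n] assms(3,4) by (metis add.commute)
  ultimately show ?thesis unfolding lead_def using t by (auto simp: nat_pow_mult)
qed

lemma lead_t: "lead S t \<one> (Suc 0) t"
proof -
  have "t = \<one> \<otimes> t [^] Suc 0 \<oplus> \<zero>" using t by simp
  then show ?thesis unfolding lead_def using zero_low by blast
qed

lemma lead_pow_t: "lead S t \<one> n (t [^] n)"
proof -
  have "t [^] n = \<one> \<otimes> t [^] n \<oplus> \<zero>" using t by simp
  then show ?thesis unfolding lead_def using zero_low by blast
qed

lemma lead_const: "c \<in> S \<Longrightarrow> lead S t c 0 c"
proof -
  assume "c \<in> S"
  then have "c = c \<otimes> t [^] (0::nat) \<oplus> \<zero>" using SR t by auto
  then show ?thesis unfolding lead_def using zero_low by blast
qed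

lemma lead_smult:
  assumes "lead S t c n x" "a \<in> S" "c \<in> S" shows "lead S t (a \<otimes> c) n (a \<otimes> x)"
  using lead_mult[OF lead_const[OF assms(2)] assms(1) assms(2,3)] by simp

lemma lead_pow:
  assumes "lead S t c n x" "c \<in> S"
  shows "lead S t (c [^] (k::nat)) (n * k) (x [^] k)" "c [^] k \<in> S"
proof -
  have "lead S t (c [^] k) (n * k) (x [^] k) \<and> c [^] k \<in> S"
  proof (induction k)
    case 0
    then show ?case using lead_const[of \<one>] subringE(3)[OF S] by simp
  next
    case (Suc k)
    then show ?case
      using lead_mult[of "c [^] k" "n * k" "x [^] k" c n x] assms subringE(6)[OF S]
      by (simp add: add.commute)
  qed
  then show "lead S t (c [^] k) (n * k) (x [^] k)" "c [^] k \<in> S" by auto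
qed

lemma lead_add_low:
  assumes "lead S t c n x" "l \<in> low S t n" "c \<in> S" shows "lead S t c n (x \<oplus> l)"
proof -
  obtain l' where l': "l' \<in> low S t n" "x = c \<otimes> t [^] n \<oplus> l'" using assms unfolding lead_def by blast
  have "c \<in> carrier R" "l \<in> carrier R" "l' \<in> carrier R" "t [^] n \<in> carrier R"
    using assms SR l' low_closed t by auto
  then have "x \<oplus> l = c \<otimes> t [^] n \<oplus> (l' \<oplus> l)" unfolding l' by (simp add: a_assoc)
  then show ?thesis unfolding lead_def using low_add[OF l'(1) assms(2)] by blast
qed

lemma lead_diff:
  assumes "lead S t c n x" "lead S t d n y" "c \<in> S" "d \<in> S"
  shows "lead S t (c \<ominus> d) n (x \<ominus> y)"
proof -
  obtain l l' where l: "l \<in> low S t n" "x = c \<otimes> t [^] n \<oplus> l"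
    and l': "l' \<in> low S t n" "y = d \<otimes> t [^] n \<oplus> l'" using assms unfolding lead_def by blast
  have cl: "c \<in> carrier R" "d \<in> carrier R" "l \<in> carrier R" "l' \<in> carrier R"
    "t [^] n \<in> carrier R" using assms(3,4) SR l l' low_closed t by auto
  have "x \<ominus> y = (c \<ominus> d) \<otimes> t [^] n \<oplus> (l \<oplus> \<ominus> l')"
    unfolding l l' using cl by algebra
  then show ?thesis unfolding lead_def using low_add[OF l(1) low_minus[OF l'(1)]] by blast
qed

lemma lead_cancel:
  assumes "lead S t c n x" "lead S t c n y" "c \<in> S"
  shows "x \<ominus> y \<in> low S t n"
proof -
  obtain l l' where l: "l \<in> low S t n" "x = c \<otimes> t [^] n \<oplus> l"
    and l': "l' \<in> low S t n" "y = c \<otimes> t [^] n \<oplus> l'" using assms unfolding lead_def by blast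
  have cl: "c \<in> carrier R" "l \<in> carrier R" "l' \<in> carrier R"
    "t [^] n \<in> carrier R" using assms(3) SR l l' low_closed t by auto
  have "x \<ominus> y = l \<oplus> \<ominus> l'"
    unfolding l l' using cl by algebra
  then show ?thesis using low_add[OF l(1) low_minus[OF l'(1)]] by simp
qed

lemma lead_exists:
  assumes "x \<in> low S t n" "x \<noteq> \<zero>"
  obtains c k where "k < n" "c \<in> S" "c \<noteq> \<zero>" "lead S t c k x"
proof -
  have "\<exists>c k. k < n \<and> c \<in> S \<and> c \<noteq> \<zero> \<and> lead S t c k x" using assms
  proof (induction n)
    case 0
    then show ?case by (simp add: low_0)
  next
    case (Suc n)
    obtain c where c: "c \<in> S" "lead S t c n x" using Suc.prems low_Suc_iff by blast
    show ?case
    proof (cases "c = \<zero>")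
      case True
      then have "x \<in> low S t n" using c(2) low_closed t unfolding lead_def by auto
      then show ?thesis using Suc less_Suc_eq by blast
    qed (use c in blast)
  qed
  then show ?thesis using that by blast
qed

text \<open>The degree comparison: two incompatible descriptions of \<open>x\<close> subtract to a
  relation of \<open>t\<close>.\<close>

lemma transc_lead_low:
  assumes "transc S t" "lead S t c n x" "x \<in> low S t n" "c \<in> S" shows "c = \<zero>"
proof -
  have x: "x \<in> carrier R" using assms low_closed by blast
  have "lead S t c n (x \<oplus> \<ominus> x)" using lead_add_low[OF assms(2) low_minus[OF assms(3)] assms(4)] .
  then have "lead S t c n \<zero>" using x by (simp add: r_neg)
  then show ?thesis using assms unfolding transc_def by blast
qed

lemma transc_lead_unique:
  assumes "transc S t" "lead S t c n x" "lead S t d n x" "c \<in> S" "d \<in> S" shows "c = d"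
proof -
  have x: "x \<in> carrier R" using assms lead_closed by blast
  have cd: "c \<in> carrier R" "d \<in> carrier R" using assms SR by auto
  have "lead S t (c \<ominus> d) n (x \<ominus> x)" using lead_diff assms by blast
  then have "lead S t (c \<ominus> d) n \<zero>" using x by (simp add: a_minus_def r_neg)
  moreover have "c \<ominus> d \<in> S" using assms subringE(5,7)[OF S] by (simp add: a_minus_def)
  ultimately have "c \<ominus> d = \<zero>" using assms unfolding transc_def by blast
  then show ?thesis using cd by (simp add: r_right_minus_eq)
qed

lemma subring_subset_adjoin: "S \<subseteq> adjoin S t"
  unfolding adjoin_def using lead_low[OF lead_const] by blast

lemma mem_adjoin: "t \<in> adjoin S t"
  unfolding adjoin_def using lead_low[OF lead_t] subringE(3)[OF S] by blast

lemma adjoin_subring: "subring (adjoin S t) R"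
proof (rule subringI)
  show "adjoin S t \<subseteq> carrier R" unfolding adjoin_def using low_closed by blast
  show "\<one> \<in> adjoin S t" using subring_subset_adjoin subringE(3)[OF S] by blast
  show "\<ominus> h \<in> adjoin S t" if "h \<in> adjoin S t" for h
    using that low_minus unfolding adjoin_def by blast
  fix x y assume "x \<in> adjoin S t" "y \<in> adjoin S t"
  then obtain m n where mn: "x \<in> low S t m" "y \<in> low S t n" unfolding adjoin_def by blast
  then show "x \<otimes> y \<in> adjoin S t" using low_mult unfolding adjoin_def by blast
  have "x \<in> low S t (max m n)" "y \<in> low S t (max m n)"
    using mn low_mono[of m "max m n" S t] low_mono[of n "max m n" S t] by auto
  then show "x \<oplus> y \<in> adjoin S t" using low_add unfolding adjoin_def by blast
qed

lemma adjoin_minimal: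
  assumes "subring T R" "S \<subseteq> T" "t \<in> T" shows "adjoin S t \<subseteq> T"
proof
  fix x assume "x \<in> adjoin S t"
  then obtain n where "x \<in> low S t n" unfolding adjoin_def by blast
  then show "x \<in> T"
  proof (rule low_minimal)
    fix a and j :: nat assume a: "a \<in> S"
    have "t [^] j \<in> T" by (induction j) (use assms subringE(3,6)[OF assms(1)] in auto)
    then show "a \<otimes> t [^] j \<in> T" using a assms subringE(6)[OF assms(1)] by blast
  qed (use subringE(2,7)[OF assms(1)] in auto)
qed

end

lemma low_subset: "S \<subseteq> S' \<Longrightarrow> low S t n \<subseteq> low S' t n"
  unfolding low_def by (intro lin_mono) auto

end

text \<open>A monic polynomial is a nonzerodivisor modulo the constant \<open>s\<close>.\<close>

lemma (in domain) monic_cancel: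
  assumes S: "subring S R" and t: "t \<in> carrier R" and tr: "transc S t"
    and p: "lead S t \<one> q p" and s: "s \<in> S" "s \<noteq> \<zero>"
    and x: "x \<in> low S t k" and y: "y \<in> adjoin S t" and eq: "p \<otimes> x = s \<otimes> y"
  shows "\<exists>z \<in> adjoin S t. x = s \<otimes> z"
  using x y eq
proof (induction k arbitrary: x y)
  case 0
  then have "x = s \<otimes> \<zero>" using s subringE(1)[OF S] by (auto simp: low_0)
  then show ?case using subringE(2)[OF adjoin_subring[OF S t]] by blast
next
  case (Suc k)
  note SR = subringE(1)[OF S] and St = S t
  have oneS: "\<one> \<in> S" using subringE(3)[OF S] .
  have sc: "s \<in> carrier R" using s SR by blast
  have pc: "p \<in> carrier R" using lead_closed[OF St p oneS] .
  obtain a where a: "a \<in> S" "lead S t a k x" using Suc.prems low_Suc_iff[OF St] by blast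
  have ac: "a \<in> carrier R" using a SR by blast
  have xc: "x \<in> carrier R" using lead_closed[OF St a(2,1)] .
  have px: "lead S t a (q + k) (p \<otimes> x)" using lead_mult[OF St p a(2) oneS a(1)] ac by simp
  \<comment> \<open>As \<open>s\<close> is a nonzero constant in a domain, \<open>s y\<close> has
    the degree of \<open>y\<close>, which therefore cannot exceed that of
    \<open>p x\<close>.\<close>
  have yl: "y \<in> low S t (Suc (q + k))"
  proof (rule ccontr)
    assume n: "y \<notin> low S t (Suc (q + k))"
    obtain n where "y \<in> low S t n" using Suc.prems unfolding adjoin_def by blast
    moreover have "y \<noteq> \<zero>" using n zero_low by metis
    ultimately obtain c j where c: "c \<in> S" "c \<noteq> \<zero>" "lead S t c j y" using lead_exists[OF St] by blast
    have "j > q + k"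
      using n lead_low[OF St c(3,1)] low_mono[of "Suc j" "Suc (q + k)" S t] by (meson not_less subsetD Suc_le_mono)
    then have "p \<otimes> x \<in> low S t j"
      using lead_low[OF St px a(1)] low_mono[of "Suc (q + k)" j S t] by auto
    moreover have "lead S t (s \<otimes> c) j (p \<otimes> x)" unfolding Suc.prems(3) using lead_smult[OF St c(3) s(1) c(1)] .
    ultimately have "s \<otimes> c = \<zero>" using transc_lead_low[OF St tr] subringE(6)[OF S s(1) c(1)] by blast
    then show False using s c integral sc SR by blast
  qed
  then obtain b where b: "b \<in> S" "lead S t b (q + k) y" using low_Suc_iff[OF St] by blast
  have bc: "b \<in> carrier R" using b SR by blast
  have "lead S t (s \<otimes> b) (q + k) (p \<otimes> x)" unfolding Suc.prems(3) using lead_smult[OF St b(2) s(1) b(1)] .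
  then have ab: "a = s \<otimes> b" using transc_lead_unique[OF St tr px] a s b subringE(6)[OF S] by blast
  \<comment> \<open>The leading term of the quotient \<open>x / s\<close>. Subtracting
    \<open>s u\<close> from \<open>x\<close> and \<open>p u\<close> from \<open>y\<close> preserves
    the equation and lowers the degree of \<open>x\<close>.\<close>
  define u where "u = b \<otimes> t [^] k"
  have uA: "u \<in> adjoin S t" unfolding u_def adjoin_def using low_base[OF St b(1), of k "Suc k"] by blast
  have uc: "u \<in> carrier R" unfolding u_def using bc t by simp
  have yc: "y \<in> carrier R" using low_closed[OF St yl] .
  have "lead S t a k (s \<otimes> u)"
    using lead_smult[OF St lead_pow_t[OF St] a(1) oneS] ab sc bc t ac unfolding u_def by (simp add: m_assoc)
  then have x': "x \<ominus> s \<otimes> u \<in> low S t k" using lead_cancel[OF St a(2) _ a(1)] by blast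
  have "p \<in> adjoin S t" using lead_low[OF St p oneS] unfolding adjoin_def by blast
  then have y': "y \<ominus> p \<otimes> u \<in> adjoin S t"
    using Suc.prems(2) uA adjoin_subring[OF St] by (simp add: a_minus_def subringE)
  have "p \<otimes> (x \<ominus> s \<otimes> u) = p \<otimes> x \<ominus> s \<otimes> (p \<otimes> u)" using pc xc sc uc by algebra
  also have "\<dots> = s \<otimes> (y \<ominus> p \<otimes> u)" unfolding Suc.prems(3) using pc yc sc uc by algebra
  finally obtain z where z: "z \<in> adjoin S t" "x \<ominus> s \<otimes> u = s \<otimes> z" using Suc.IH[OF x' y'] by blast
  have zc: "z \<in> carrier R" using z(1) subringE(1)[OF adjoin_subring[OF St]] by blast
  have "x = (x \<ominus> s \<otimes> u) \<oplus> s \<otimes> u" using xc sc uc by algebra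
  also have "\<dots> = s \<otimes> (z \<oplus> u)" unfolding z(2) using zc sc uc by algebra
  finally show ?case using subringE(7)[OF adjoin_subring[OF St] z(1) uA] by blast
qed

section \<open>Monomials and finitely generated subalgebras\<close>

text \<open>Exponent vectors are multisets of indices, so that with \<open>y\<close> the identity
  this is the monomial occurring in \<open>poly_value\<close>.\<close>

definition (in ring) mon :: "('i \<Rightarrow> 'a) \<Rightarrow> 'i multiset \<Rightarrow> 'a" where
  "mon y m = (\<Otimes>i\<in>set_mset m. y i [^] count m i)"

definition Mons :: "nat \<Rightarrow> nat multiset set" where
  "Mons n = {m. set_mset m \<subseteq> {..<n}}"

definition (in ring) Alg :: "'a set \<Rightarrow> (nat \<Rightarrow> 'a) \<Rightarrow> nat \<Rightarrow> 'a set" where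
  "Alg K y n = lin K (mon y) (Mons n)"

lemma Mons_union: "m \<in> Mons n \<Longrightarrow> m' \<in> Mons n \<Longrightarrow> m + m' \<in> Mons n"
  unfolding Mons_def by auto

lemma Mons_mono: "n \<le> n' \<Longrightarrow> Mons n \<subseteq> Mons n'"
  unfolding Mons_def by auto

lemma Mons_0: "Mons 0 = {{#}}"
  unfolding Mons_def by auto

context cring
begin

lemma mon_empty [simp]: "mon y {#} = \<one>"
  unfolding mon_def by simp

lemma mon_superset:
  assumes "finite A" "set_mset m \<subseteq> A" "y \<in> A \<rightarrow> carrier R"
  shows "mon y m = (\<Otimes>i\<in>A. y i [^] count m i)"
  unfolding mon_def
  by (rule finprod_mono_neutral_cong_left) (use assms in \<open>auto simp: not_in_iff Pi_iff\<close>)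

lemma mon_closed:
  assumes "y \<in> set_mset m \<rightarrow> carrier R" shows "mon y m \<in> carrier R"
  unfolding mon_def using assms by (intro finprod_closed) auto

lemma mon_union:
  assumes "y \<in> set_mset (m + m') \<rightarrow> carrier R"
  shows "mon y (m + m') = mon y m \<otimes> mon y m'"
proof -
  let ?A = "set_mset (m + m')"
  have "mon y (m + m') = (\<Otimes>i\<in>?A. y i [^] count m i \<otimes> y i [^] count m' i)"
    unfolding mon_def using assms by (intro finprod_cong') (auto simp: nat_pow_mult Pi_iff)
  also have "\<dots> = (\<Otimes>i\<in>?A. y i [^] count m i) \<otimes> (\<Otimes>i\<in>?A. y i [^] count m' i)"
    using assms by (intro finprod_multf) auto
  finally show ?thesis using mon_superset[of ?A m y] mon_superset[of ?A m' y] assms by simp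
qed

lemma mon_replicate:
  assumes "y i \<in> carrier R" shows "mon y (replicate_mset k i) = y i [^] k"
proof -
  have "mon y (replicate_mset k i) = (\<Otimes>j\<in>{i}. y j [^] count (replicate_mset k i) j)"
    using assms by (intro mon_superset) auto
  then show ?thesis using assms by simp
qed

lemma mon_single: "y i \<in> carrier R \<Longrightarrow> mon y {#i#} = y i"
  using mon_replicate[of y i 1] by simp

lemma mon_add_mset:
  assumes "y \<in> set_mset (add_mset i m) \<rightarrow> carrier R"
  shows "mon y (add_mset i m) = y i \<otimes> mon y m"
  using mon_union[of y "{#i#}" m] assms by (simp add: mon_single)

lemma mon_cong: "(\<And>i. i \<in># m \<Longrightarrow> y i = z i) \<Longrightarrow> z \<in> set_mset m \<rightarrow> carrier R \<Longrightarrow> mon y m = mon z m"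
  unfolding mon_def by (intro finprod_cong') auto

lemma mon_mem_subring:
  assumes "subring T R" "y \<in> set_mset m \<rightarrow> T" shows "mon y m \<in> T"
  using assms(2)
proof (induction m)
  case empty
  then show ?case using subringE(3)[OF assms(1)] by simp
next
  case (add i m)
  then have "y \<in> set_mset (add_mset i m) \<rightarrow> carrier R" using subringE(1)[OF assms(1)] by auto
  then show ?case using add subringE(6)[OF assms(1)] by (auto simp: mon_add_mset)
qed

context
  fixes K assumes K: "subfield K R"
begin

lemma K_subring: "subring K R" using subfieldE(1)[OF K] .

lemma K_carrier: "K \<subseteq> carrier R" using subringE(1)[OF K_subring] .

lemma one_nonzero: "\<one> \<noteq> \<zero>" using subfieldE(6)[OF K] .

context
  fixes y :: "nat \<Rightarrow> 'a" and n assumes y: "y \<in> {..<n} \<rightarrow> carrier R"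
begin

lemma mon_Mons: "mon y \<in> Mons n \<rightarrow> carrier R"
  using y unfolding Mons_def by (auto intro!: mon_closed)

lemma Alg_carrier: "Alg K y n \<subseteq> carrier R"
  unfolding Alg_def by (intro subsetI lin_closed[OF _ K_carrier mon_Mons])

lemma K_subset_Alg: "K \<subseteq> Alg K y n"
proof
  fix k assume k: "k \<in> K"
  have "k \<otimes> mon y {#} \<in> Alg K y n"
    unfolding Alg_def by (rule lin_base[OF k _ K_carrier mon_Mons]) (simp add: Mons_def)
  then show "k \<in> Alg K y n" using k K_carrier by auto
qed

lemma mon_mem_Alg: "m \<in> Mons n \<Longrightarrow> mon y m \<in> Alg K y n"
proof -
  assume m: "m \<in> Mons n"
  have "\<one> \<otimes> mon y m \<in> Alg K y n"
    unfolding Alg_def using lin_base[OF _ m K_carrier mon_Mons] subringE(3)[OF K_subring] by blast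
  then show "mon y m \<in> Alg K y n" using m mon_Mons by (auto simp: Pi_iff)
qed

lemma var_mem_Alg: "i < n \<Longrightarrow> y i \<in> Alg K y n"
  using mon_mem_Alg[of "{#i#}"] mon_single[of y i] y by (auto simp: Mons_def Pi_iff)

lemma Alg_mult:
  assumes "u \<in> Alg K y n" "v \<in> Alg K y n" shows "u \<otimes> v \<in> Alg K y n"
proof -
  have vc: "v \<in> carrier R" using assms Alg_carrier by blast
  have add: "u \<oplus> v \<in> Alg K y n" if "u \<in> Alg K y n" "v \<in> Alg K y n" for u v
    using that lin_add[OF _ _ K_carrier mon_Mons] unfolding Alg_def by blast
  have smult: "k \<otimes> v \<in> Alg K y n" if "k \<in> K" "v \<in> Alg K y n" for k v
    using that lin_smult[OF _ _ K_subring mon_Mons] unfolding Alg_def by blast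
  have mm: "mon y m \<otimes> v \<in> Alg K y n" if m: "m \<in> Mons n" for m
  proof -
    have mc: "mon y m \<in> carrier R" using m mon_Mons by blast
    have "mon y m \<otimes> v \<in> lin K (\<lambda>m'. mon y m \<otimes> mon y m') (Mons n)"
      using lin_mult_right[OF assms(2)[unfolded Alg_def] mc K_carrier mon_Mons] .
    then show ?thesis unfolding Alg_def
    proof (rule lin_trans[OF _ K_subring mon_Mons])
      fix m' assume m': "m' \<in> Mons n"
      have "mon y (m + m') = mon y m \<otimes> mon y m'"
        using m m' y by (intro mon_union) (auto simp: Mons_def)
      then show "mon y m \<otimes> mon y m' \<in> lin K (mon y) (Mons n)"
        using mon_mem_Alg[OF Mons_union[OF m m']] unfolding Alg_def by simp
    qed
  qed
  have "u \<in> {u \<in> carrier R. u \<otimes> v \<in> Alg K y n}"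
  proof (rule lin_minimal[OF assms(1)[unfolded Alg_def]])
    show "\<zero> \<in> {u \<in> carrier R. u \<otimes> v \<in> Alg K y n}"
      using vc lin.zero unfolding Alg_def by simp
    show "a \<otimes> mon y m \<in> {u \<in> carrier R. u \<otimes> v \<in> Alg K y n}" if "a \<in> K" "m \<in> Mons n" for a m
    proof -
      have "a \<in> carrier R" "mon y m \<in> carrier R" using that K_carrier mon_Mons by auto
      then show ?thesis using smult[OF that(1) mm[OF that(2)]] vc by (simp add: m_assoc)
    qed
  qed (use add vc in \<open>auto simp: l_distr\<close>)
  then show ?thesis by simp
qed

lemma Alg_subring: "subring (Alg K y n) R"
proof (rule subringI)
  show "\<one> \<in> Alg K y n" using mon_mem_Alg[of "{#}"] by (simp add: Mons_def)
  show "\<ominus> h \<in> Alg K y n" if "h \<in> Alg K y n" for h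
    using that lin_minus[OF _ K_subring mon_Mons] unfolding Alg_def by blast
  show "u \<oplus> v \<in> Alg K y n" if "u \<in> Alg K y n" "v \<in> Alg K y n" for u v
    using that lin_add[OF _ _ K_carrier mon_Mons] unfolding Alg_def by blast
qed (use Alg_carrier Alg_mult in auto)

lemma Alg_minimal:
  assumes "subring T R" "K \<subseteq> T" "\<And>i. i < n \<Longrightarrow> y i \<in> T" shows "Alg K y n \<subseteq> T"
proof
  fix x assume "x \<in> Alg K y n"
  then show "x \<in> T" unfolding Alg_def
  proof (rule lin_minimal)
    show "a \<otimes> mon y m \<in> T" if "a \<in> K" "m \<in> Mons n" for a m
      using that assms mon_mem_subring[OF assms(1), of y m] subringE(6)[OF assms(1)]
      by (auto simp: Mons_def Pi_iff subset_iff)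
  qed (use subringE(2,7)[OF assms(1)] in auto)
qed

end

lemma Alg_0: "Alg K y 0 = K"
  using K_subset_Alg[of y 0] Alg_minimal[of y 0 K] K_subring by auto

text \<open>Links several variables to one: the last variable is adjoined to the algebra of the
  others. Hilbert's basis theorem and the ring \<open>C[x]\<close> are both set up this way.\<close>

lemma Alg_Suc:
  assumes "y \<in> {..<Suc n} \<rightarrow> carrier R" shows "Alg K y (Suc n) = adjoin (Alg K y n) (y n)"
proof
  have y': "y \<in> {..<n} \<rightarrow> carrier R" and yn: "y n \<in> carrier R" using assms by auto
  note S = Alg_subring[OF y']
  show "Alg K y (Suc n) \<subseteq> adjoin (Alg K y n) (y n)"
  proof (rule Alg_minimal[OF assms adjoin_subring[OF S yn]])
    show "K \<subseteq> adjoin (Alg K y n) (y n)"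
      using K_subset_Alg[OF y'] subring_subset_adjoin[OF S yn] by blast
    show "y i \<in> adjoin (Alg K y n) (y n)" if "i < Suc n" for i
      using that mem_adjoin[OF S yn] subring_subset_adjoin[OF S yn] var_mem_Alg[OF y', of i]
      by (cases "i = n") auto
  qed
  show "adjoin (Alg K y n) (y n) \<subseteq> Alg K y (Suc n)"
  proof (rule adjoin_minimal[OF S yn Alg_subring[OF assms]])
    show "Alg K y n \<subseteq> Alg K y (Suc n)" unfolding Alg_def by (intro lin_mono Mons_mono) auto
    show "y n \<in> Alg K y (Suc n)" using var_mem_Alg[OF assms] by blast
  qed
qed

text \<open>Monomials are graded by the exponent of the last variable. In a relation of
  \<open>y n\<close> over the other variables, the leading term lies in the span of exponent
  \<open>N\<close>, the rest in the span of smaller exponents, and these involve disjoint sets of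
  monomials.\<close>

lemma indep_transc:
  assumes y: "y \<in> {..<Suc n} \<rightarrow> carrier R" and ind: "indep K (mon y) (Mons (Suc n)) {\<zero>}"
  shows "transc (Alg K y n) (y n)"
proof -
  have y': "y \<in> {..<n} \<rightarrow> carrier R" and yn: "y n \<in> carrier R" using y by auto
  note S = Alg_subring[OF y'] and mo = mon_Mons[OF y]
  define J where "J j = {m \<in> Mons (Suc n). count m n = j}" for j
  define L where "L j = {m \<in> Mons (Suc n). count m n < j}" for j
  have mJ: "mon y \<in> J j \<rightarrow> carrier R" and mL: "mon y \<in> L j \<rightarrow> carrier R" for j
    using mo unfolding J_def L_def by auto
  have *: "a \<otimes> y n [^] j \<in> lin K (mon y) (J j)" if a: "a \<in> Alg K y n" for a j
  proof -
    have ac: "a \<in> carrier R" using a Alg_carrier[OF y'] by blast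
    have "y n [^] j \<otimes> a \<in> lin K (\<lambda>m. y n [^] j \<otimes> mon y m) (Mons n)"
      using lin_mult_right[OF a[unfolded Alg_def] _ K_carrier mon_Mons[OF y']] yn by simp
    then have "y n [^] j \<otimes> a \<in> lin K (mon y) (J j)"
    proof (rule lin_trans[OF _ K_subring mJ])
      fix m assume m: "m \<in> Mons n"
      have mem: "m + replicate_mset j n \<in> J j"
        using m unfolding J_def Mons_def by (auto simp: count_eq_zero_iff)
      have "mon y (m + replicate_mset j n) = mon y m \<otimes> y n [^] j"
        using mon_union[of y m "replicate_mset j n"] mon_replicate[where y = y and i = n, OF yn] y mem
        unfolding J_def Mons_def by (auto simp: Pi_iff subset_iff)
      then have "y n [^] j \<otimes> mon y m = \<one> \<otimes> mon y (m + replicate_mset j n)"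
        using m mon_Mons[OF y'] yn by (auto simp: m_comm Pi_iff)
      then show "y n [^] j \<otimes> mon y m \<in> lin K (mon y) (J j)"
        using lin_base[OF subringE(3)[OF K_subring] mem K_carrier mJ] by simp
    qed
    then show ?thesis using ac yn by (simp add: m_comm)
  qed
  show ?thesis unfolding transc_def
  proof (intro allI ballI impI)
    fix N c assume c: "c \<in> Alg K y n" "lead (Alg K y n) (y n) c N \<zero>"
    then obtain l where l: "l \<in> low (Alg K y n) (y n) N" "\<zero> = c \<otimes> y n [^] N \<oplus> l"
      unfolding lead_def by blast
    have cc: "c \<in> carrier R" using c Alg_carrier[OF y'] by blast
    have "l \<in> lin K (mon y) (L N)"
    proof (rule low_minimal[OF S yn l(1)])
      show "\<zero> \<in> lin K (mon y) (L N)" by (rule lin.zero)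
      show "u \<oplus> v \<in> lin K (mon y) (L N)" if "u \<in> lin K (mon y) (L N)" "v \<in> lin K (mon y) (L N)" for u v
        by (rule lin_add[OF that K_carrier mL])
      show "a \<otimes> y n [^] j \<in> lin K (mon y) (L N)" if "a \<in> Alg K y n" "j < N" for a j
        using *[OF that(1), of j] lin_mono[of "J j" "L N" K K "mon y"] that(2) unfolding J_def L_def by auto
    qed
    then have "c \<otimes> y n [^] N = \<zero>"
      using indep_disjoint[OF ind, of "J N" "L N" "c \<otimes> y n [^] N" l] K_subring mo *[OF c(1)] l(2)
      unfolding J_def L_def by auto
    \<comment> \<open>In a commutative ring \<open>y n\<close> might be a zero divisor, so it is not
      cancelled. Instead the monomials of \<open>c\<close> are shifted by \<open>N\<close> copies of
      \<open>n\<close>, and independence is applied once more.\<close>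
    show "c = \<zero>"
    proof -
      obtain F a where F: "finite F" "F \<subseteq> Mons n" "a \<in> F \<rightarrow> K" "c = (\<Oplus>m\<in>F. a m \<otimes> mon y m)"
        using lin_explicit[OF c(1)[unfolded Alg_def] K_subring mon_Mons[OF y']] by blast
      define h where "h m = m + replicate_mset N n" for m
      have inj: "inj_on h F" unfolding h_def inj_on_def by simp
      have hF: "h ` F \<subseteq> Mons (Suc n)" using F(2) unfolding h_def Mons_def by (fastforce split: if_splits)
      have aF: "a m \<in> carrier R" "mon y m \<in> carrier R" if "m \<in> F" for m
        using that F K_carrier mon_Mons[OF y'] by auto
      have mh: "mon y (h m) = mon y m \<otimes> y n [^] N" if "m \<in> F" for m
        unfolding h_def
        using mon_union[of y m "replicate_mset N n"] mon_replicate[where y = y and i = n, OF yn] y hF that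
        unfolding h_def Mons_def by (auto simp: Pi_iff subset_iff)
      have "(\<Oplus>m\<in>h ` F. a (m - replicate_mset N n) \<otimes> mon y m) = (\<Oplus>m\<in>F. a m \<otimes> mon y (h m))"
        using inj hF mo aF by (subst finsum_reindex) (auto simp: h_def Pi_iff subset_iff)
      also have "\<dots> = (\<Oplus>m\<in>F. (a m \<otimes> mon y m) \<otimes> y n [^] N)"
        using mh aF yn by (intro finsum_cong') (auto simp: m_assoc)
      also have "\<dots> = c \<otimes> y n [^] N"
        unfolding F(4) using F(1) aF yn by (subst finsum_ldistr) auto
      also have "\<dots> = \<zero>" by fact
      finally have z: "(\<Oplus>m\<in>h ` F. a (m - replicate_mset N n) \<otimes> mon y m) \<in> {\<zero>}" by simp
      have "a m = \<zero>" if "m \<in> F" for m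
        using indepD[OF ind _ hF _ z, of "h m"] F(1,3) that by (auto simp: h_def Pi_iff)
      then have "c = (\<Oplus>m\<in>F. \<zero>)" unfolding F(4) using aF by (intro finsum_cong') auto
      then show ?thesis by simp
    qed
  qed
qed

end

section \<open>Hilbert's basis theorem\<close>

text \<open>The ascending chain condition for the ideals of a subring \<open>S\<close>, in the form
  in which it is used: a sequence of elements yields a linear relation with one coefficient equal to
  one.\<close>

definition noeth :: "'a set \<Rightarrow> bool" where
  "noeth S \<longleftrightarrow> (\<forall>a :: nat \<Rightarrow> 'a. range a \<subseteq> S \<longrightarrow> (\<exists>n. a n \<in> lin S a {..<n}))"

lemma noeth_subfield:
  assumes "subfield K R" shows "noeth K"
  unfolding noeth_def
proof (intro allI impI)
  fix a :: "nat \<Rightarrow> 'a" assume a: "range a \<subseteq> K"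
  note K = subfieldE(1)[OF assms]
  show "\<exists>n. a n \<in> lin K a {..<n}"
  proof (cases "a 0 = \<zero>")
    case True
    then show ?thesis using lin.zero by metis
  next
    case False
    have i: "inv (a 0) \<in> K" "a 0 \<otimes> inv (a 0) = \<one>"
      using subfield_m_inv[OF assms, of "a 0"] a False by auto
    have c: "a 1 \<in> carrier R" "a 0 \<in> carrier R" "inv (a 0) \<in> carrier R"
      using a i subringE(1)[OF K] by auto
    have "a 1 = (a 1 \<otimes> inv (a 0)) \<otimes> a 0" using c i(2) by (simp add: m_assoc m_comm[of "inv (a 0)"])
    moreover have "(a 1 \<otimes> inv (a 0)) \<otimes> a 0 \<in> lin K a {..<1}"
      using a i subringE(1,6)[OF K] by (intro lin_base) auto
    ultimately show ?thesis by metis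
  qed
qed

text \<open>Hilbert's argument with a sequence of elements of least degree: a relation over
  \<open>S\<close> between their leading coefficients, lifted with suitable powers of
  \<open>t\<close>, produces an element of smaller degree that is still outside the span of the
  earlier ones.\<close>

lemma noeth_adjoin:
  assumes "noeth S" and S: "subring S R" and t: "t \<in> carrier R"
  shows "noeth (adjoin S t)"
  unfolding noeth_def
proof (intro allI impI, rule ccontr)
  let ?D = "adjoin S t"
  note D = adjoin_subring[OF S t]
  note DR = subringE(1)[OF D]
  fix f :: "nat \<Rightarrow> 'a" assume f: "range f \<subseteq> ?D" and "\<nexists>n. f n \<in> lin ?D f {..<n}"
  then have bad: "f n \<notin> lin ?D f {..<n}" for n by blast
  have fc: "f \<in> A \<rightarrow> carrier R" for A using f DR by auto
  define I where "I = lin ?D f UNIV"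
  have IR: "I \<subseteq> carrier R" unfolding I_def by (intro subsetI lin_closed[OF _ DR fc])
  have ID: "I \<subseteq> ?D"
  proof
    fix x assume "x \<in> I"
    then show "x \<in> ?D" unfolding I_def
      by (rule lin_minimal) (use f subringE(2,6,7)[OF D] in auto)
  qed
  \<comment> \<open>\<open>I\<close> is not spanned by finitely many of its elements: these involve
    only the first \<open>N\<close> terms of \<open>f\<close>, and \<open>f N\<close> is not a
    combination of those.\<close>
  have ex: "\<exists>x. x \<in> I - lin ?D g {..<n}" if g: "\<And>i. i < n \<Longrightarrow> g i \<in> I" for g and n :: nat
  proof -
    have "\<exists>N. \<forall>i<n. g i \<in> lin ?D f {..<N}" using g
    proof (induction n)
      case (Suc n)
      then obtain N where N: "\<forall>i<n. g i \<in> lin ?D f {..<N}" by auto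
      have "g n \<in> lin ?D f UNIV" using Suc.prems[of n] unfolding I_def by simp
      then obtain J where J: "finite J" "g n \<in> lin ?D f J" by (rule lin_finite_subset)
      obtain M where "J \<subseteq> {..<M}" using J(1) finite_nat_bounded by blast
      then have M: "J \<subseteq> {..<max N M}" by auto
      have "g i \<in> lin ?D f {..<max N M}" if "i < Suc n" for i
        using that N J(2) M lin_mono[of "{..<N}" "{..<max N M}" ?D ?D f]
          lin_mono[of J "{..<max N M}" ?D ?D f]
        by (cases "i = n") auto
      then show ?case by blast
    qed auto
    then obtain N where N: "\<forall>i<n. g i \<in> lin ?D f {..<N}" by blast
    have "f N \<notin> lin ?D g {..<n}"
    proof
      assume "f N \<in> lin ?D g {..<n}"
      then have "f N \<in> lin ?D f {..<N}" by (rule lin_trans[OF _ D fc]) (use N in auto)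
      then show False using bad by blast
    qed
    moreover have "f N \<in> I"
    proof -
      have "\<one> \<otimes> f N \<in> I" unfolding I_def by (rule lin_base[OF subringE(3)[OF D] _ DR fc]) simp
      then show ?thesis using fc[of UNIV] by (simp add: Pi_iff)
    qed
    ultimately show ?thesis by blast
  qed
  \<comment> \<open>The least bound over all ways of writing \<open>x\<close>, because
    \<open>t\<close> may be algebraic over \<open>S\<close>. The bound is strict, hence
    \<open>Suc (d n)\<close> below.\<close>
  define deg where "deg x = (LEAST k. x \<in> low S t k)" for x
  define P where "P g n x \<longleftrightarrow> x \<in> I - lin ?D g {..<n} \<and> (\<forall>x' \<in> I - lin ?D g {..<n}. deg x \<le> deg x')"
    for g and n :: nat and x
  have "\<exists>g. \<forall>n. P g n (g n)"
  proof (rule dependent_wellorder_choice)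
    fix r and g h :: "nat \<Rightarrow> 'a" and n :: nat assume "\<And>i. i < n \<Longrightarrow> g i = h i"
    then have "lin ?D g {..<n} = lin ?D h {..<n}" by (intro lin_cong) auto
    then show "P g n r = P h n r" unfolding P_def by simp
  next
    fix n :: nat and g assume "\<And>i. i < n \<Longrightarrow> P g i (g i)"
    then have "\<exists>x. x \<in> I - lin ?D g {..<n}" unfolding P_def using ex by blast
    then obtain x where "x \<in> I - lin ?D g {..<n}"
      "\<forall>x'. x' \<in> I - lin ?D g {..<n} \<longrightarrow> deg x \<le> deg x'"
      using ex_has_least_nat[of "\<lambda>x. x \<in> I - lin ?D g {..<n}" _ deg] by blast
    then show "\<exists>x. P g n x" unfolding P_def by blast
  qed
  then obtain g where g: "\<And>n. P g n (g n)" by blast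
  have gI: "g n \<in> I" for n using g[of n] unfolding P_def by blast
  have gR: "g \<in> A \<rightarrow> carrier R" for A using gI IR by auto
  have low_deg: "x \<in> low S t (deg x)" if "x \<in> ?D" for x
    using that LeastI[of "\<lambda>k. x \<in> low S t k"] unfolding deg_def adjoin_def by blast
  have deg_mono: "deg (g i) \<le> deg (g n)" if "i \<le> n" for i n
  proof -
    have "g n \<in> I - lin ?D g {..<i}"
      using g[of n] lin_mono[of "{..<i}" "{..<n}" ?D ?D g] that unfolding P_def by auto
    then show ?thesis using g[of i] unfolding P_def by blast
  qed
  have g0: "g n \<noteq> \<zero>" for n using g[of n] lin.zero[of ?D g "{..<n}"] unfolding P_def by auto
  have "\<exists>c d. c \<in> S \<and> deg (g n) = Suc d \<and> lead S t c d (g n)" for n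
  proof -
    have l: "g n \<in> low S t (deg (g n))" using low_deg gI ID by blast
    then have "deg (g n) \<noteq> 0" using g0 low_0 by (metis singletonD)
    then obtain d where "deg (g n) = Suc d" by (cases "deg (g n)") auto
    then show ?thesis using l low_Suc_iff[OF S t] by metis
  qed
  then obtain c d where c: "\<And>n. c n \<in> S" and d: "\<And>n. deg (g n) = Suc (d n)"
    and cd: "\<And>n. lead S t (c n) (d n) (g n)" by metis
  obtain n where n: "c n \<in> lin S c {..<n}" using assms(1) c unfolding noeth_def by blast
  \<comment> \<open>A combination of the earlier leading coefficients is again a leading
    coefficient, in degree \<open>d n\<close>, of a combination of the earlier \<open>g i\<close>.
    Degrees increase weakly, so each \<open>g i\<close> can be raised to degree \<open>d n\<close>
    by a power of \<open>t\<close>.\<close>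
  have "\<exists>h \<in> lin ?D g {..<n}. u \<in> S \<and> lead S t u (d n) h" if "u \<in> lin S c {..<n}" for u
    using that
  proof (induction rule: lin.induct)
    case zero
    have "lead S t \<zero> (d n) \<zero>"
    proof -
      have "\<zero> = \<zero> \<otimes> t [^] d n \<oplus> \<zero>" using t by simp
      then show ?thesis unfolding lead_def using zero_low by blast
    qed
    then show ?case using lin.zero subringE(2)[OF S] by blast
  next
    case (step a i u)
    then obtain h where h: "h \<in> lin ?D g {..<n}" "u \<in> S" "lead S t u (d n) h" by blast
    have di: "d i \<le> d n" using deg_mono[of i n] d step by simp
    have lt: "lead S t (\<one> \<otimes> c i) (d n - d i + d i) (t [^] (d n - d i) \<otimes> g i)"
      by (rule lead_mult[OF S t lead_pow_t[OF S t] cd subringE(3)[OF S] c])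
    have ci: "c i \<in> carrier R" "a \<in> carrier R" "g i \<in> carrier R" "h \<in> carrier R" "u \<in> carrier R"
      using c step subringE(1)[OF S] gR[of UNIV] h lin_closed[OF h(1) DR gR] by auto
    have l1: "lead S t (a \<otimes> c i) (d n) (a \<otimes> (t [^] (d n - d i) \<otimes> g i))"
      using lead_smult[OF S t, of "c i" "d n" "t [^] (d n - d i) \<otimes> g i" a] lt di ci step c by simp
    have "lead S t (a \<otimes> c i \<ominus> \<ominus> u) (d n) (a \<otimes> (t [^] (d n - d i) \<otimes> g i) \<ominus> \<ominus> h)"
    proof (rule lead_diff[OF S t l1])
      show "lead S t (\<ominus> u) (d n) (\<ominus> h)"
      proof -
        have "lead S t (\<ominus> \<one> \<otimes> u) (d n) (\<ominus> \<one> \<otimes> h)"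
          using lead_smult[OF S t h(3) _ h(2)] subringE(3,5)[OF S] by blast
        then show ?thesis using ci by (simp add: l_minus)
      qed
    qed (use step c h subringE(5,6)[OF S] in auto)
    then have "lead S t (a \<otimes> c i \<oplus> u) (d n) (a \<otimes> (t [^] (d n - d i) \<otimes> g i) \<oplus> h)"
      using ci t by (simp add: a_minus_def)
    moreover have "a \<otimes> (t [^] (d n - d i) \<otimes> g i) \<oplus> h \<in> lin ?D g {..<n}"
    proof -
      have "a \<otimes> t [^] (d n - d i) \<in> ?D"
        using low_base[OF S t step(1), of "d n - d i" "Suc (d n - d i)"] unfolding adjoin_def by blast
      then have "(a \<otimes> t [^] (d n - d i)) \<otimes> g i \<oplus> h \<in> lin ?D g {..<n}"
        using step h by (intro lin.step) auto
      then show ?thesis using ci t by (simp add: m_assoc)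
    qed
    moreover have "a \<otimes> c i \<oplus> u \<in> S" using step c h subringE(6,7)[OF S] by auto
    ultimately show ?case by blast
  qed
  then obtain h where h: "h \<in> lin ?D g {..<n}" "lead S t (c n) (d n) h" using n by blast
  have hc: "h \<in> carrier R" "g n \<in> carrier R" using lin_closed[OF h(1) DR gR] gR[of UNIV] by auto
  have x: "g n \<ominus> h \<in> low S t (d n)" using lead_cancel[OF S t cd h(2) c] .
  have hI: "h \<in> I" using lin_trans[OF h(1) D fc, of UNIV] gI unfolding I_def by blast
  have "g n \<ominus> h \<in> I" unfolding a_minus_def I_def
    using gI hI unfolding I_def by (intro lin_add[OF _ _ DR fc] lin_minus[OF _ D fc])
  moreover have "g n \<ominus> h \<notin> lin ?D g {..<n}"
  proof
    assume "g n \<ominus> h \<in> lin ?D g {..<n}"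
    then have "(g n \<ominus> h) \<oplus> h \<in> lin ?D g {..<n}" by (rule lin_add[OF _ h(1) DR gR])
    moreover have "(g n \<ominus> h) \<oplus> h = g n" using hc by algebra
    ultimately show False using g[of n] unfolding P_def by auto
  qed
  ultimately have "deg (g n) \<le> deg (g n \<ominus> h)" using g[of n] unfolding P_def by blast
  moreover have "deg (g n \<ominus> h) \<le> d n" using x unfolding deg_def by (rule Least_le)
  ultimately show False using d[of n] by simp
qed

lemma noeth_Alg:
  assumes "subfield K R" "y \<in> {..<n} \<rightarrow> carrier R" shows "noeth (Alg K y n)"
  using assms(2)
proof (induction n)
  case 0
  then show ?case using noeth_subfield[OF assms(1)] Alg_0[OF assms(1)] by simp
next
  case (Suc n)
  then have "y \<in> {..<n} \<rightarrow> carrier R" "y n \<in> carrier R" by auto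
  then show ?case
    using Suc noeth_adjoin[OF Suc.IH Alg_subring[OF assms(1)]] Alg_Suc[OF assms(1) Suc.prems] by simp
qed

end

section \<open>Noether normalisation\<close>

text \<open>The digit of largest index is the remainder modulo \<open>B\<close>, the others come
  from the quotient. This makes the weights in \<open>Nagata\<close> injective on the monomials of a
  relation.\<close>

lemma digits_unique:
  fixes B :: nat
  assumes "(\<Sum>i<n. c i * B ^ (n - Suc i)) = (\<Sum>i<n. d i * B ^ (n - Suc i))"
    "\<And>i. i < n \<Longrightarrow> c i < B" "\<And>i. i < n \<Longrightarrow> d i < B" "i < n"
  shows "c i = d i"
  using assms
proof (induction n arbitrary: i)
  case (Suc n)
  have *: "(\<Sum>i<Suc n. f i * B ^ (Suc n - Suc i)) = B * (\<Sum>i<n. f i * B ^ (n - Suc i)) + f n" for f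
  proof -
    have "(\<Sum>i<n. f i * B ^ (Suc n - Suc i)) = (\<Sum>i<n. B * (f i * B ^ (n - Suc i)))"
    proof (rule sum.cong)
      fix i assume "i \<in> {..<n}"
      then have "Suc n - Suc i = Suc (n - Suc i)" by auto
      then show "f i * B ^ (Suc n - Suc i) = B * (f i * B ^ (n - Suc i))" by simp
    qed simp
    then show ?thesis by (simp add: sum_distrib_left)
  qed
  have eq: "B * (\<Sum>i<n. c i * B ^ (n - Suc i)) + c n = B * (\<Sum>i<n. d i * B ^ (n - Suc i)) + d n"
    using Suc.prems(1) unfolding * .
  have B: "c n < B" "d n < B" using Suc.prems by auto
  have "c n = d n" using arg_cong[OF eq, of "\<lambda>x. x mod B"] B by simp
  moreover have "(\<Sum>i<n. c i * B ^ (n - Suc i)) = (\<Sum>i<n. d i * B ^ (n - Suc i))"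
    using arg_cong[OF eq, of "\<lambda>x. x div B"] B by simp
  ultimately show ?case
    using Suc.IH[OF _ Suc.prems(2,3), of i] Suc.prems(4) by (cases "i = n") auto
qed simp

context cring
begin

text \<open>The hypothesis rewrites \<open>t^W\<close> in lower powers, so multiplication by
  \<open>t\<close> never leaves the polynomials of degree below \<open>W\<close>.\<close>

lemma adjoin_integral:
  assumes S: "subring S R" and t: "t \<in> carrier R" and W: "t [^] W \<in> low S t W"
  shows "adjoin S t = low S t W"
proof -
  have pow: "t [^] j \<in> low S t W" for j :: nat
  proof (induction j)
    case 0
    show ?case
    proof (cases "W = 0")
      case False
      have "\<one> \<otimes> t [^] (0::nat) \<in> low S t W"
        using low_base[OF S t subringE(3)[OF S], of 0 W] False by simp
      then show ?thesis by simp
    qed (use W in simp)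
  next
    case (Suc j)
    have "t [^] (1::nat) \<otimes> t [^] j \<in> low S t (1 + W)" by (rule low_shift[OF S t Suc.IH])
    then have "t [^] Suc j \<in> low S t (Suc W)" using t by (simp add: m_comm)
    then obtain c where c: "c \<in> S" "lead S t c W (t [^] Suc j)" using low_Suc_iff[OF S t] by blast
    then obtain l where "l \<in> low S t W" "t [^] Suc j = c \<otimes> t [^] W \<oplus> l" unfolding lead_def by blast
    then show ?case using low_add[OF S t low_smult[OF S t W c(1)]] by simp
  qed
  have "low S t N \<subseteq> low S t W" for N
  proof
    fix x assume "x \<in> low S t N"
    then show "x \<in> low S t W"
      by (rule low_minimal[OF S t]) (use zero_low low_add[OF S t] low_smult[OF S t pow] in auto)
  qed
  then show ?thesis unfolding adjoin_def by blast
qed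

text \<open>Nagata's change of variables: subtract powers of the last generator \<open>t\<close> with exponents so
  spread out that the monomials of a given relation become polynomials in \<open>t\<close> of distinct degrees.\<close>

lemma Nagata:
  assumes K: "subfield K R" and e: "e \<in> {..<Suc n} \<rightarrow> carrier R"
    and dep: "\<not> indep K (mon e) (Mons (Suc n)) {\<zero>}"
  obtains e' W where "e' \<in> {..<n} \<rightarrow> carrier R" "e n [^] W \<in> low (Alg K e' n) (e n) W"
    "Alg K e (Suc n) = adjoin (Alg K e' n) (e n)"
proof -
  note Ks = K_subring[OF K] and Kc = K_carrier[OF K] and mo = mon_Mons[OF K e]
  obtain J0 a where J0: "finite J0" "J0 \<subseteq> Mons (Suc n)" "a \<in> J0 \<rightarrow> K"
    "(\<Oplus>m\<in>J0. a m \<otimes> mon e m) = \<zero>" "\<exists>m\<in>J0. a m \<noteq> \<zero>"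
    using dep unfolding indep_def by blast
  define J where "J = {m \<in> J0. a m \<noteq> \<zero>}"
  have J: "finite J" "J \<subseteq> Mons (Suc n)" "a \<in> J \<rightarrow> K" "J \<noteq> {}" using J0 unfolding J_def by auto
  have ac: "a m \<in> carrier R" "mon e m \<in> carrier R" if "m \<in> J0" for m
    using that J0 Kc mo by auto
  have "(\<Oplus>m\<in>J. a m \<otimes> mon e m) = (\<Oplus>m\<in>J0. a m \<otimes> mon e m)"
    using J0(1) ac by (intro add.finprod_mono_neutral_cong_left) (auto simp: J_def)
  then have sum0: "(\<Oplus>m\<in>J. a m \<otimes> mon e m) = \<zero>" using J0 by simp
  \<comment> \<open>Larger than every exponent in the relation, so that exponents become digits in
    base \<open>B\<close>.\<close>
  define B where "B = Suc (\<Sum>m\<in>J. size m)"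
  have cB: "count m i < B" if "m \<in> J" for m i
  proof -
    have "count m i \<le> size m" by (rule count_le_size)
    also have "\<dots> \<le> (\<Sum>m\<in>J. size m)" using J(1) that by (intro member_le_sum) auto
    finally show ?thesis unfolding B_def by simp
  qed
  have B1: "B \<ge> 1" unfolding B_def by simp
  \<comment> \<open>The last variable gets weight \<open>B^0 = 1\<close>, its own degree in
    \<open>t\<close>. Once each other \<open>e i\<close> is written as
    \<open>t^(r i) + e' i\<close>, the weight \<open>w m\<close> is the degree in \<open>t\<close>
    of the monomial \<open>m\<close>.\<close>
  define r where "r i = B ^ (n - i)" for i
  define w where "w m = (\<Sum>i<Suc n. count m i * r i)" for m
  have r1: "r i \<ge> 1" "r n = 1" for i unfolding r_def using B1 by auto
  have w_inj: "m = m'" if "m \<in> J" "m' \<in> J" "w m = w m'" for m m'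
  proof (rule multiset_eqI)
    fix i
    show "count m i = count m' i"
    proof (cases "i < Suc n")
      case True
      show ?thesis
        by (rule digits_unique[where n = "Suc n" and B = B])
          (use that(3) True cB[OF that(1)] cB[OF that(2)] in \<open>auto simp: w_def r_def\<close>)
    next
      case False
      then have "i \<notin># m" "i \<notin># m'" using that J(2) unfolding Mons_def by auto
      then show ?thesis by (simp add: not_in_iff)
    qed
  qed
  define t where "t = e n"
  have t: "t \<in> carrier R" using e unfolding t_def by auto
  have ec: "e i \<in> carrier R" if "i < Suc n" for i using e that by auto
  define e' where "e' i = e i \<ominus> t [^] r i" for i
  have e': "e' \<in> {..<n} \<rightarrow> carrier R" using ec t unfolding e'_def by auto
  define S where "S = Alg K e' n"
  have S: "subring S R" unfolding S_def by (rule Alg_subring[OF K e'])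
  have KS: "K \<subseteq> S" unfolding S_def by (rule K_subset_Alg[OF K e'])
  have oneS: "\<one> \<in> S" using subringE(3)[OF S] .
  have lead_e: "lead S t \<one> (r i) (e i)" if i: "i < Suc n" for i
  proof (cases "i = n")
    case True
    then show ?thesis using lead_t[OF S t] r1 unfolding t_def by simp
  next
    case False
    then have "e' i \<in> S" unfolding S_def using var_mem_Alg[OF K e'] i by simp
    then have "e' i \<in> low S t (r i)"
      using lead_low[OF S t lead_const[OF S t]] low_mono[of "Suc 0" "r i" S t] r1(1)[of i] by auto
    then have "lead S t \<one> (r i) (t [^] r i \<oplus> e' i)"
      using lead_add_low[OF S t lead_pow_t[OF S t] _ oneS] by blast
    moreover have "t [^] r i \<oplus> (e i \<ominus> t [^] r i) = e i"
      using ec[OF i] nat_pow_closed[OF t, of "r i"] by algebra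
    ultimately show ?thesis unfolding e'_def by simp
  qed
  have lead_mon: "lead S t \<one> (w m) (mon e m)" if "m \<in> Mons (Suc n)" for m
    using that
  proof (induction m)
    case empty
    then show ?case using lead_const[OF S t oneS] unfolding w_def by simp
  next
    case (add i m)
    then have im: "i < Suc n" "m \<in> Mons (Suc n)" unfolding Mons_def by auto
    have "w (add_mset i m) = (\<Sum>j<Suc n. (if j = i then r j else 0) + count m j * r j)"
      unfolding w_def by (intro sum.cong) auto
    also have "\<dots> = r i + w m"
      unfolding w_def sum.distrib using im(1) by (simp add: sum.delta)
    finally have "w (add_mset i m) = r i + w m" .
    moreover have "mon e (add_mset i m) = e i \<otimes> mon e m"
      using add.prems ec by (intro mon_add_mset) (auto simp: Mons_def)
    ultimately show ?case
      using lead_mult[OF S t lead_e[OF im(1)] add.IH[OF im(2)] oneS oneS] by simp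
  qed
  \<comment> \<open>By \<open>w_inj\<close> only one monomial attains the largest weight, so its
    leading term cannot cancel. Its coefficient is invertible in \<open>K\<close>, which makes the
    relation monic in \<open>t\<close>.\<close>
  obtain m0 where m0: "m0 \<in> J" "\<And>m. m \<in> J \<Longrightarrow> w m \<le> w m0"
  proof -
    have "Max (w ` J) \<in> w ` J" using J by (intro Max_in) auto
    then obtain m0 where "m0 \<in> J" "Max (w ` J) = w m0" by auto
    then show ?thesis using that J(1) by (metis Max_ge finite_imageI imageI)
  qed
  define W where "W = w m0"
  have a0: "a m0 \<in> K" "a m0 \<noteq> \<zero>" "m0 \<in> Mons (Suc n)" using m0 J unfolding J_def by auto
  have ainv: "inv (a m0) \<in> K" "inv (a m0) \<otimes> a m0 = \<one>"
    using subfield_m_inv[OF K, of "a m0"] a0 by auto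
  have rest: "(\<Oplus>m\<in>J - {m0}. a m \<otimes> mon e m) \<in> low S t W"
    unfolding low_def
  proof (rule lin_sum)
    fix m assume m: "m \<in> J - {m0}"
    then have "w m < W" using m0 w_inj[of m m0] unfolding W_def by (metis DiffD1 DiffD2 insertI1 le_neq_implies_less)
    have "lead S t (a m \<otimes> \<one>) (w m) (a m \<otimes> mon e m)"
      using lead_smult[OF S t lead_mon _ oneS, of m "a m"] m J(2,3) KS by (auto simp: Pi_iff subset_iff)
    moreover have "a m \<otimes> \<one> \<in> S"
      using m J(3) KS subringE(6)[OF S _ oneS] by (auto simp: Pi_iff subset_iff)
    ultimately have "a m \<otimes> mon e m \<in> low S t (Suc (w m))"
      by (rule lead_low[OF S t])
    then show "a m \<otimes> mon e m \<in> lin S (\<lambda>j. t [^] j) {..<W}"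
      using low_mono[of "Suc (w m)" W S t] \<open>w m < W\<close> unfolding low_def by auto
  qed (use J subringE(1)[OF S] t in auto)
  have "J = insert m0 (J - {m0})" using m0 by auto
  then have "\<zero> = (\<Oplus>m\<in>insert m0 (J - {m0}). a m \<otimes> mon e m)" using sum0 by simp
  also have "\<dots> = a m0 \<otimes> mon e m0 \<oplus> (\<Oplus>m\<in>J - {m0}. a m \<otimes> mon e m)"
    using J m0 ac unfolding J_def by (subst finsum_insert) auto
  finally have z: "a m0 \<otimes> mon e m0 \<oplus> (\<Oplus>m\<in>J - {m0}. a m \<otimes> mon e m) = \<zero>" by simp
  obtain l where l: "l \<in> low S t W" "mon e m0 = \<one> \<otimes> t [^] W \<oplus> l"
    using lead_mon[OF a0(3)] unfolding lead_def W_def by blast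
  define s where "s = (\<Oplus>m\<in>J - {m0}. a m \<otimes> mon e m)"
  have sc: "s \<in> low S t W" "s \<in> carrier R" "l \<in> carrier R" "t [^] W \<in> carrier R"
    "a m0 \<in> carrier R" "inv (a m0) \<in> carrier R"
    using rest l low_closed[OF S t] t a0 ainv Kc unfolding s_def by auto
  have "a m0 \<otimes> (\<one> \<otimes> t [^] W \<oplus> l) \<oplus> s = \<zero>" using z unfolding s_def l(2) .
  then have "inv (a m0) \<otimes> (a m0 \<otimes> (\<one> \<otimes> t [^] W \<oplus> l) \<oplus> s) = \<zero>" using sc by simp
  moreover have "inv (a m0) \<otimes> (a m0 \<otimes> (\<one> \<otimes> t [^] W \<oplus> l) \<oplus> s)
      = (inv (a m0) \<otimes> a m0) \<otimes> (t [^] W \<oplus> l) \<oplus> inv (a m0) \<otimes> s"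
    using sc by algebra
  ultimately have "t [^] W \<oplus> (l \<oplus> inv (a m0) \<otimes> s) = \<zero>"
    unfolding ainv(2) using sc by (simp add: a_assoc)
  then have "t [^] W = \<ominus> (l \<oplus> inv (a m0) \<otimes> s)" using sc by (simp add: sum_zero_eq_neg)
  moreover have "\<ominus> (l \<oplus> inv (a m0) \<otimes> s) \<in> low S t W"
    using low_minus[OF S t low_add[OF S t l(1) low_smult[OF S t sc(1)]]] ainv KS by blast
  ultimately have integral: "t [^] W \<in> low S t W" by simp
  have "Alg K e (Suc n) = adjoin S t"
  proof
    show "Alg K e (Suc n) \<subseteq> adjoin S t"
    proof (rule Alg_minimal[OF K e adjoin_subring[OF S t]])
      show "K \<subseteq> adjoin S t" using KS subring_subset_adjoin[OF S t] by blast
      show "e i \<in> adjoin S t" if "i < Suc n" for i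
        using lead_low[OF S t lead_e[OF that] oneS] unfolding adjoin_def by blast
    qed
    note A = Alg_subring[OF K e]
    have tA: "t \<in> Alg K e (Suc n)" unfolding t_def using var_mem_Alg[OF K e] by simp
    have tp: "t [^] (j::nat) \<in> Alg K e (Suc n)" for j
      by (induction j) (use tA subringE(3,6)[OF A] in auto)
    show "adjoin S t \<subseteq> Alg K e (Suc n)"
    proof (rule adjoin_minimal[OF S t A _ tA])
      show "S \<subseteq> Alg K e (Suc n)" unfolding S_def
      proof (rule Alg_minimal[OF K e' A K_subset_Alg[OF K e]])
        show "e' i \<in> Alg K e (Suc n)" if "i < n" for i
          using var_mem_Alg[OF K e, of i] tp[of "r i"] that subringE(5,7)[OF A]
          unfolding e'_def a_minus_def by auto
      qed
    qed
  qed
  then show thesis using that[OF e', of W] integral unfolding S_def t_def by blast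
qed

lemma lin_unit:
  assumes S: "subring S R" shows "S = lin S (\<lambda>v. v) {\<one>}"
proof
  note Sc = subringE(1)[OF S]
  show "S \<subseteq> lin S (\<lambda>v. v) {\<one>}"
  proof
    fix x assume x: "x \<in> S"
    have "x \<otimes> \<one> \<in> lin S (\<lambda>v. v) {\<one>}" by (rule lin_base) (use x Sc in auto)
    then show "x \<in> lin S (\<lambda>v. v) {\<one>}" using x Sc by auto
  qed
  show "lin S (\<lambda>v. v) {\<one>} \<subseteq> S"
  proof
    fix x assume "x \<in> lin S (\<lambda>v. v) {\<one>}"
    then show "x \<in> S"
      by (rule lin_minimal) (use subringE(2,3,6,7)[OF S] in auto)
  qed
qed

text \<open>Induction on the number of generators. Independent generators need no change; otherwise
  \<open>Nagata\<close> passes to an algebra on one generator fewer over which the last generator is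
  integral.\<close>

theorem Noether_normalisation:
  assumes K: "subfield K R" and "e \<in> {..<n} \<rightarrow> carrier R"
  shows "\<exists>k y V. y \<in> {..<k} \<rightarrow> carrier R \<and> indep K (mon y) (Mons k) {\<zero>} \<and> finite V \<and>
    V \<subseteq> Alg K e n \<and> Alg K y k \<subseteq> Alg K e n \<and> Alg K e n = lin (Alg K y k) (\<lambda>v. v) V"
  using assms(2)
proof (induction n arbitrary: e)
  case 0
  have ind: "indep K (mon e) (Mons 0) {\<zero>}" unfolding indep_def Mons_0
  proof (intro allI impI)
    fix J :: "nat multiset set" and a
    assume J: "finite J" "J \<subseteq> {{#}}" "a \<in> J \<rightarrow> K" "(\<Oplus>i\<in>J. a i \<otimes> mon e i) \<in> {\<zero>}"
    show "\<forall>i\<in>J. a i = \<zero>"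
    proof
      fix i assume "i \<in> J"
      then have "J = {{#}}" "i = {#}" "a {#} \<in> K" using J(2,3) by auto
      moreover from this have "(\<Oplus>i\<in>{{#}}. a i \<otimes> mon e i) = a {#}"
        using K_carrier[OF K] by (subst finsum_insert) auto
      ultimately show "a i = \<zero>" using J(4) by simp
    qed
  qed
  have "Alg K e 0 = lin (Alg K e 0) (\<lambda>v. v) {\<one>}" by (rule lin_unit[OF Alg_subring[OF K 0]])
  then show ?case using ind 0 subringE(3)[OF Alg_subring[OF K 0]]
    by (intro exI[of _ 0] exI[of _ e] exI[of _ "{\<one>}"]) auto
next
  case (Suc n)
  show ?case
  proof (cases "indep K (mon e) (Mons (Suc n)) {\<zero>}")
    case True
    have S: "subring (Alg K e (Suc n)) R" using Alg_subring[OF K Suc.prems] .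
    have "Alg K e (Suc n) = lin (Alg K e (Suc n)) (\<lambda>v. v) {\<one>}" by (rule lin_unit[OF S])
    then show ?thesis using True Suc.prems subringE(3)[OF S]
      by (intro exI[of _ "Suc n"] exI[of _ e] exI[of _ "{\<one>}"]) auto
  next
    case False
    obtain e' W where e': "e' \<in> {..<n} \<rightarrow> carrier R" "e n [^] W \<in> low (Alg K e' n) (e n) W"
      "Alg K e (Suc n) = adjoin (Alg K e' n) (e n)"
      using Nagata[OF K Suc.prems False] .
    define S t where "S = Alg K e' n" and "t = e n"
    have S: "subring S R" unfolding S_def by (rule Alg_subring[OF K e'(1)])
    have t: "t \<in> carrier R" using Suc.prems unfolding t_def by auto
    obtain k y V where y: "y \<in> {..<k} \<rightarrow> carrier R" "indep K (mon y) (Mons k) {\<zero>}" "finite V"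
      "V \<subseteq> S" "Alg K y k \<subseteq> S" "S = lin (Alg K y k) (\<lambda>v. v) V"
      using Suc.IH[OF e'(1)] unfolding S_def by blast
    let ?B = "Alg K y k"
    have B: "subring ?B R" by (rule Alg_subring[OF K y(1)])
    note Bc = subringE(1)[OF B] and Sc = subringE(1)[OF S]
    \<comment> \<open>Module generators of the smaller algebra times the powers of \<open>t\<close>
      below the degree \<open>W\<close> of the integral equation.\<close>
    define V' where "V' = (\<lambda>(v, j). v \<otimes> t [^] j) ` (V \<times> {..<W})"
    have V'c: "(\<lambda>v. v) \<in> V' \<rightarrow> carrier R" unfolding V'_def using y(4) Sc t by auto
    have A: "Alg K e (Suc n) = low S t W"
      using e'(3) adjoin_integral[OF S t] e'(2) unfolding S_def t_def by simp
    have Asub: "subring (Alg K e (Suc n)) R" by (rule Alg_subring[OF K Suc.prems])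
    have SA: "S \<subseteq> Alg K e (Suc n)" using e'(3) subring_subset_adjoin[OF S t] unfolding S_def t_def by simp
    have V'A: "V' \<subseteq> Alg K e (Suc n)"
      using y(4) low_base[OF S t] unfolding V'_def A by auto
    have "Alg K e (Suc n) = lin ?B (\<lambda>v. v) V'"
    proof
      show "Alg K e (Suc n) \<subseteq> lin ?B (\<lambda>v. v) V'"
      proof
        fix x assume "x \<in> Alg K e (Suc n)"
        then have "x \<in> low S t W" using A by simp
        then show "x \<in> lin ?B (\<lambda>v. v) V'"
        proof (rule low_minimal[OF S t])
          fix a j assume a: "a \<in> S" "j < W"
          have ac: "a \<in> carrier R" using a Sc by blast
          have "t [^] j \<otimes> a \<in> lin ?B (\<lambda>v. t [^] j \<otimes> v) V"
            using lin_mult_right[of a ?B "\<lambda>v. v" V "t [^] j"] a y(4,6) t Bc Sc by auto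
          then have "t [^] j \<otimes> a \<in> lin ?B (\<lambda>v. v) V'"
          proof (rule lin_trans[OF _ B V'c])
            fix v assume v: "v \<in> V"
            then have "v \<otimes> t [^] j \<in> V'" unfolding V'_def using a by auto
            then have "\<one> \<otimes> (v \<otimes> t [^] j) \<in> lin ?B (\<lambda>v. v) V'"
              using lin_base[OF subringE(3)[OF B] _ Bc V'c] by blast
            then show "t [^] j \<otimes> v \<in> lin ?B (\<lambda>v. v) V'" using v y(4) Sc t by (auto simp: m_comm subset_iff)
          qed
          then show "a \<otimes> t [^] j \<in> lin ?B (\<lambda>v. v) V'" using ac t by (simp add: m_comm)
        qed (use lin.zero lin_add[OF _ _ Bc V'c] in auto)
      qed
      show "lin ?B (\<lambda>v. v) V' \<subseteq> Alg K e (Suc n)"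
      proof
        fix x assume "x \<in> lin ?B (\<lambda>v. v) V'"
        then show "x \<in> Alg K e (Suc n)"
          by (rule lin_minimal) (use subringE(2,6,7)[OF Asub] V'A y(5) SA in \<open>auto simp: subset_iff\<close>)
      qed
    qed
    moreover have "finite V'" unfolding V'_def using y(3) by simp
    moreover have "?B \<subseteq> Alg K e (Suc n)" using y(5) SA by (rule subset_trans)
    ultimately show ?thesis using y(1,2) V'A
      by (intro exI[of _ k] exI[of _ y] exI[of _ V'] conjI)
  qed
qed

end

section \<open>Prime ideals\<close>

lemma (in primeideal) power_mem:
  assumes "x \<in> carrier R" "x [^] (n::nat) \<in> I" shows "x \<in> I"
  using assms(2)
proof (induction n)
  case 0
  then show ?case using one_imp_carrier I_notcarr by simp
next
  case (Suc n)
  then show ?case using I_prime[of "x [^] n" x] assms(1) by auto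
qed

text \<open>The Zorn step shared by \<open>exists_primeideal_disjoint\<close>, where
  \<open>T\<close> is multiplicative, and \<open>exists_maximalideal_above\<close>, where
  \<open>T\<close> consists of the unit alone.\<close>

lemma (in ring) exists_ideal_maximal_disjoint:
  assumes I: "ideal I R" "I \<inter> T = {}"
  shows "\<exists>Q. ideal Q R \<and> I \<subseteq> Q \<and> Q \<inter> T = {} \<and>
    (\<forall>J. ideal J R \<longrightarrow> Q \<subseteq> J \<longrightarrow> J \<inter> T = {} \<longrightarrow> J = Q)"
proof -
  define A where "A = {J. ideal J R \<and> I \<subseteq> J \<and> J \<inter> T = {}}"
  have "\<exists>M\<in>A. \<forall>J\<in>A. M \<subseteq> J \<longrightarrow> J = M"
  proof (rule subset_Zorn_nonempty)
    show "A \<noteq> {}" unfolding A_def using I by blast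
    fix C assume C: "C \<noteq> {}" "subset.chain A C"
    then have "subset.chain {J. ideal J R} C" unfolding pred_on.chain_def A_def by blast
    from chain_Union_is_ideal[OF this] have "ideal (\<Union>C) R" using C(1) by simp
    then show "\<Union>C \<in> A" using C unfolding A_def pred_on.chain_def by blast
  qed
  then obtain Q where Q: "Q \<in> A" "\<And>J. J \<in> A \<Longrightarrow> Q \<subseteq> J \<Longrightarrow> J = Q" by blast
  have "J = Q" if "ideal J R" "Q \<subseteq> J" "J \<inter> T = {}" for J
    using Q that unfolding A_def by blast
  then show ?thesis using Q(1) unfolding A_def by blast
qed

text \<open>Krull's argument: if \<open>a\<close> and \<open>b\<close> lie outside a maximal such
  \<open>Q\<close>, then \<open>Q + (a)\<close> and \<open>Q + (b)\<close> both meet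
  \<open>T\<close>. The product of two elements found there lies in \<open>T\<close>, and also in
  \<open>Q\<close> if \<open>a b\<close> does.\<close>

lemma (in cring) exists_primeideal_disjoint:
  assumes I: "ideal I R" and T: "T \<subseteq> carrier R" "\<one> \<in> T"
    "\<And>a b. a \<in> T \<Longrightarrow> b \<in> T \<Longrightarrow> a \<otimes> b \<in> T" and IT: "I \<inter> T = {}"
  obtains Q where "primeideal Q R" "I \<subseteq> Q" "Q \<inter> T = {}"
proof -
  obtain Q where Q: "ideal Q R" "I \<subseteq> Q" "Q \<inter> T = {}"
    and max: "\<And>J. ideal J R \<Longrightarrow> Q \<subseteq> J \<Longrightarrow> J \<inter> T = {} \<Longrightarrow> J = Q"
    using exists_ideal_maximal_disjoint[OF I IT] by metis
  interpret Q: ideal Q R by fact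
  have meet: "\<exists>q\<in>Q. \<exists>r\<in>carrier R. q \<oplus> r \<otimes> a \<in> T" if a: "a \<in> carrier R" "a \<notin> Q" for a
  proof -
    have J: "ideal (Q <+> PIdl a) R" using add_ideals[OF Q(1) cgenideal_ideal[OF a(1)]] .
    have "Q \<subseteq> Q <+> PIdl a"
    proof
      fix q assume q: "q \<in> Q"
      have "\<zero> \<in> PIdl a" using additive_subgroup.zero_closed ideal.axioms(1) cgenideal_ideal a by blast
      then have "q \<oplus> \<zero> \<in> Q <+> PIdl a" using q unfolding set_add_def' by blast
      then show "q \<in> Q <+> PIdl a" using q Q.Icarr by simp
    qed
    moreover have "a \<in> Q <+> PIdl a"
    proof -
      have "\<zero> \<oplus> a \<in> Q <+> PIdl a" using Q.zero_closed cgenideal_self[OF a(1)] unfolding set_add_def' by blast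
      then show ?thesis using a by simp
    qed
    ultimately have "(Q <+> PIdl a) \<inter> T \<noteq> {}" using max[OF J] a(2) by blast
    then show ?thesis unfolding set_add_def' cgenideal_def by blast
  qed
  have "primeideal Q R"
  proof (rule primeidealI[OF Q(1) is_cring])
    show "carrier R \<noteq> Q" using Q(3) T(1,2) by blast
    fix a b assume ab: "a \<in> carrier R" "b \<in> carrier R" "a \<otimes> b \<in> Q"
    show "a \<in> Q \<or> b \<in> Q"
    proof (rule ccontr)
      assume "\<not> (a \<in> Q \<or> b \<in> Q)"
      then obtain q r q' r' where H: "q \<in> Q" "r \<in> carrier R" "q \<oplus> r \<otimes> a \<in> T"
        "q' \<in> Q" "r' \<in> carrier R" "q' \<oplus> r' \<otimes> b \<in> T" using meet ab(1,2) by metis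
      have c: "q \<in> carrier R" "q' \<in> carrier R" using H Q.Icarr by auto
      have "(q \<oplus> r \<otimes> a) \<otimes> (q' \<oplus> r' \<otimes> b)
          = (q' \<oplus> r' \<otimes> b) \<otimes> q \<oplus> ((r \<otimes> a) \<otimes> q' \<oplus> (r \<otimes> r') \<otimes> (a \<otimes> b))"
        using c H ab by algebra
      also have "\<dots> \<in> Q" using H ab c by (intro Q.a_closed Q.I_l_closed[of q] Q.I_l_closed[of q'] Q.I_l_closed[of "a \<otimes> b"]) auto
      finally show False using T(3)[OF H(3,6)] Q(3) by blast
    qed
  qed
  then show thesis using that Q by blast
qed

lemma (in cring) exists_maximalideal_above:
  assumes I: "ideal I R" "\<one> \<notin> I"
  obtains M where "maximalideal M R" "I \<subseteq> M"
proof -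
  have "I \<inter> {\<one>} = {}" using I(2) by blast
  from exists_ideal_maximal_disjoint[OF I(1) this]
  obtain M where M: "ideal M R" "I \<subseteq> M" "M \<inter> {\<one>} = {}"
    and max: "\<And>J. ideal J R \<Longrightarrow> M \<subseteq> J \<Longrightarrow> J \<inter> {\<one>} = {} \<Longrightarrow> J = M"
    by metis
  have "maximalideal M R"
  proof (rule maximalidealI[OF M(1)])
    show "carrier R \<noteq> M" using M(3) by blast
    show "J = M \<or> J = carrier R" if "ideal J R" "M \<subseteq> J" "J \<subseteq> carrier R" for J
      using max[OF that(1,2)] ideal.one_imp_carrier[OF that(1)] by blast
  qed
  then show thesis using that M by blast
qed

section \<open>Finite modules over a polynomial ring\<close>

context domain
begin

text \<open>Each generator outside a maximal independent subset of \<open>V\<close> has a nonzero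
  multiple in the span of that subset, and \<open>e\<close> is the product of these multipliers. So
  the module is free up to multiplication by one nonzero element.\<close>

lemma free_part:
  assumes B: "subring B R" and V: "finite V" "V \<subseteq> carrier R"
  obtains V0 e where "V0 \<subseteq> V" "indep B (\<lambda>v. v) V0 {\<zero>}" "e \<in> B" "e \<noteq> \<zero>"
    "\<And>x. x \<in> lin B (\<lambda>v. v) V \<Longrightarrow> e \<otimes> x \<in> lin B (\<lambda>v. v) V0"
proof -
  note Bc = subringE(1)[OF B]
  have "indep B (\<lambda>v. v) {} {\<zero>}" unfolding indep_def by auto
  then have "{V0. V0 \<subseteq> V \<and> indep B (\<lambda>v. v) V0 {\<zero>}} \<noteq> {}" by blast
  moreover have fin: "finite {V0. V0 \<subseteq> V \<and> indep B (\<lambda>v. v) V0 {\<zero>}}" using V(1) by simp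
  ultimately obtain V0 where "V0 \<in> {V0. V0 \<subseteq> V \<and> indep B (\<lambda>v. v) V0 {\<zero>}}"
    "\<forall>V1\<in>{V0. V0 \<subseteq> V \<and> indep B (\<lambda>v. v) V0 {\<zero>}}. V0 \<le> V1 \<longrightarrow> V0 = V1"
    using finite_has_maximal[OF fin] by meson
  then have V0: "V0 \<subseteq> V" "indep B (\<lambda>v. v) V0 {\<zero>}"
    and max: "\<And>V1. V1 \<subseteq> V \<Longrightarrow> indep B (\<lambda>v. v) V1 {\<zero>} \<Longrightarrow> V0 \<subseteq> V1 \<Longrightarrow> V0 = V1"
    by auto
  have V0c: "(\<lambda>v. v) \<in> V0 \<rightarrow> carrier R" and Vc: "(\<lambda>v. v) \<in> V \<rightarrow> carrier R" using V0 V by auto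
  have scale: "\<exists>b\<in>B. b \<noteq> \<zero> \<and> b \<otimes> v \<in> lin B (\<lambda>v. v) V0" if v: "v \<in> V" for v
  proof (cases "v \<in> V0")
    case True
    then show ?thesis using lin_base[OF subringE(3)[OF B] True Bc V0c] subringE(3)[OF B]
      by (intro bexI[of _ \<one>]) auto
  next
    case False
    then have "\<not> indep B (\<lambda>v. v) (insert v V0) {\<zero>}" using max[of "insert v V0"] V0(1) v by blast
    then obtain J a where J: "finite J" "J \<subseteq> insert v V0" "a \<in> J \<rightarrow> B"
      "(\<Oplus>i\<in>J. a i \<otimes> i) = \<zero>" "\<exists>i\<in>J. a i \<noteq> \<zero>" unfolding indep_def by blast
    have vJ: "v \<in> J"
    proof (rule ccontr)
      assume "v \<notin> J"
      then have "J \<subseteq> V0" using J(2) by blast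
      then show False using indepD[OF V0(2) J(1) _ J(3)] J(4,5) by auto
    qed
    define s where "s = (\<Oplus>i\<in>J - {v}. a i \<otimes> i)"
    have aJ: "a \<in> J - {v} \<rightarrow> B" "J - {v} \<subseteq> V0" using J by auto
    have av: "a v \<in> B" "a v \<in> carrier R" "v \<in> carrier R" using J(3) vJ Bc v V(2) by auto
    have s: "s \<in> lin B (\<lambda>v. v) V0" unfolding s_def
      using lin_of_sum[OF _ aJ(2,1) Bc V0c] J(1) by simp
    have sc: "s \<in> carrier R" using lin_closed[OF s Bc V0c] .
    have "J = insert v (J - {v})" using vJ by auto
    then have "\<zero> = (\<Oplus>i\<in>insert v (J - {v}). a i \<otimes> i)" using J(4) by simp
    also have "\<dots> = a v \<otimes> v \<oplus> s" unfolding s_def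
      using J(1) av aJ Bc V0c by (subst finsum_insert) (auto simp: Pi_iff subset_iff)
    finally have eq: "a v \<otimes> v \<oplus> s = \<zero>" by simp
    \<comment> \<open>Otherwise the relation would live in \<open>V0\<close> alone and be
      trivial.\<close>
    have "a v \<noteq> \<zero>"
    proof
      assume z: "a v = \<zero>"
      then have "s \<in> {\<zero>}" using eq sc av by simp
      then have "\<forall>i\<in>J - {v}. a i = \<zero>"
        using indepD[OF V0(2) _ aJ(2,1)] J(1) unfolding s_def by blast
      then show False using J(5) z by auto
    qed
    moreover have "a v \<otimes> v = \<ominus> s" using eq sc av by (simp add: sum_zero_eq_neg)
    then have "a v \<otimes> v \<in> lin B (\<lambda>v. v) V0" using lin_minus[OF s B V0c] by simp
    ultimately show ?thesis using av by blast
  qed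
  have "\<exists>e\<in>B. e \<noteq> \<zero> \<and> (\<forall>v\<in>V1. e \<otimes> v \<in> lin B (\<lambda>v. v) V0)" if "V1 \<subseteq> V" for V1
    using finite_subset[OF that V(1)] that
  proof (induction V1 rule: finite_induct)
    case empty
    then show ?case using subringE(3)[OF B] by (intro bexI[of _ \<one>]) auto
  next
    case (insert v V1)
    then obtain e where e: "e \<in> B" "e \<noteq> \<zero>" "\<forall>v\<in>V1. e \<otimes> v \<in> lin B (\<lambda>v. v) V0" by auto
    obtain b where b: "b \<in> B" "b \<noteq> \<zero>" "b \<otimes> v \<in> lin B (\<lambda>v. v) V0" using scale insert by blast
    have c: "b \<in> carrier R" "e \<in> carrier R" "v \<in> carrier R" using b e Bc insert V by auto
    have "(b \<otimes> e) \<otimes> u \<in> lin B (\<lambda>v. v) V0" if u: "u \<in> insert v V1" for u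
    proof (cases "u = v")
      case True
      have "e \<otimes> (b \<otimes> v) \<in> lin B (\<lambda>v. v) V0" by (rule lin_smult[OF b(3) e(1) B V0c])
      then show ?thesis using True c by (simp add: m_ac)
    next
      case False
      then have "u \<in> V1" "u \<in> carrier R" using u insert V by auto
      moreover from this have "b \<otimes> (e \<otimes> u) \<in> lin B (\<lambda>v. v) V0"
        using lin_smult[OF _ b(1) B V0c] e(3) by blast
      ultimately show ?thesis using c by (simp add: m_assoc)
    qed
    moreover have "b \<otimes> e \<in> B" "b \<otimes> e \<noteq> \<zero>" using b e c integral subringE(6)[OF B] by auto
    ultimately show ?case by blast
  qed
  then obtain e where e: "e \<in> B" "e \<noteq> \<zero>" "\<forall>v\<in>V. e \<otimes> v \<in> lin B (\<lambda>v. v) V0" by blast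
  have "e \<otimes> x \<in> lin B (\<lambda>v. v) V0" if x: "x \<in> lin B (\<lambda>v. v) V" for x
  proof -
    have "e \<otimes> x \<in> lin B (\<lambda>v. e \<otimes> v) V" using lin_mult_right[OF x _ Bc Vc] e(1) Bc by blast
    then show ?thesis by (rule lin_trans[OF _ B V0c]) (use e in blast)
  qed
  then show thesis using that V0 e by blast
qed

lemma indep_unique:
  assumes "indep B g V {\<zero>}" "finite V" "subring B R" "g \<in> V \<rightarrow> carrier R"
    "c \<in> V \<rightarrow> B" "d \<in> V \<rightarrow> B" "(\<Oplus>v\<in>V. c v \<otimes> g v) = (\<Oplus>v\<in>V. d v \<otimes> g v)" "v \<in> V"
  shows "c v = d v"
proof -
  have cd: "c v \<in> carrier R" "d v \<in> carrier R" "g v \<in> carrier R" if "v \<in> V" for v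
    using that assms subringE(1)[OF assms(3)] by auto
  have "(\<Oplus>v\<in>V. (c v \<ominus> d v) \<otimes> g v) = (\<Oplus>v\<in>V. c v \<otimes> g v \<oplus> (\<ominus> \<one>) \<otimes> (d v \<otimes> g v))"
  proof (intro finsum_cong')
    fix v assume "v \<in> V"
    then show "(c v \<ominus> d v) \<otimes> g v = c v \<otimes> g v \<oplus> (\<ominus> \<one>) \<otimes> (d v \<otimes> g v)" using cd[of v] by algebra
  qed (use cd in auto)
  also have "\<dots> = (\<Oplus>v\<in>V. c v \<otimes> g v) \<oplus> (\<Oplus>v\<in>V. (\<ominus> \<one>) \<otimes> (d v \<otimes> g v))"
    using cd by (intro finsum_addf) auto
  also have "(\<Oplus>v\<in>V. (\<ominus> \<one>) \<otimes> (d v \<otimes> g v)) = (\<ominus> \<one>) \<otimes> (\<Oplus>v\<in>V. d v \<otimes> g v)"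
    using cd assms(2) by (intro finsum_rdistr[symmetric]) auto
  also have "(\<Oplus>v\<in>V. c v \<otimes> g v) \<oplus> (\<ominus> \<one>) \<otimes> (\<Oplus>v\<in>V. d v \<otimes> g v) = \<zero>"
  proof -
    have "(\<Oplus>v\<in>V. d v \<otimes> g v) \<in> carrier R" using cd by (intro finsum_closed) auto
    then show ?thesis unfolding assms(7) by (simp add: l_minus r_neg)
  qed
  finally have "(\<Oplus>v\<in>V. (c v \<ominus> d v) \<otimes> g v) \<in> {\<zero>}" by simp
  moreover have "(\<lambda>v. c v \<ominus> d v) \<in> V \<rightarrow> B"
    using assms(5,6) subringE(5,7)[OF assms(3)] by (auto simp: a_minus_def Pi_iff)
  ultimately have "c v \<ominus> d v = \<zero>" using indepD[OF assms(1,2) subset_refl] assms(8) by blast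
  then show ?thesis using cd assms(8) by (simp add: r_right_minus_eq)
qed

section \<open>Domains finite over a polynomial ring \<open>C[x]\<close>\<close>

context
  fixes C x V
  assumes C: "subring C R" and x: "x \<in> carrier R" and tr: "transc C x"
    and V: "finite V" "V \<subseteq> carrier R" and gen: "carrier R = lin (adjoin C x) (\<lambda>v. v) V"
begin

text \<open>The substitute for a basis over \<open>C[x]\<close>: \<open>e\<close> acts as a common
  denominator, and independence makes the coordinates of \<open>e u\<close> unique.\<close>

lemma coordinates:
  obtains V0 e where "finite V0" "V0 \<subseteq> carrier R" "indep (adjoin C x) (\<lambda>v. v) V0 {\<zero>}"
    "e \<in> carrier R" "e \<noteq> \<zero>"
    "\<And>u. u \<in> carrier R \<Longrightarrow> \<exists>c. c \<in> V0 \<rightarrow> adjoin C x \<and> e \<otimes> u = (\<Oplus>v\<in>V0. c v \<otimes> v)"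
proof -
  note B = adjoin_subring[OF C x]
  obtain V0 e where V0: "V0 \<subseteq> V" "indep (adjoin C x) (\<lambda>v. v) V0 {\<zero>}" "e \<in> adjoin C x" "e \<noteq> \<zero>"
    "\<And>u. u \<in> lin (adjoin C x) (\<lambda>v. v) V \<Longrightarrow> e \<otimes> u \<in> lin (adjoin C x) (\<lambda>v. v) V0"
    using free_part[OF B V] by blast
  have fin: "finite V0" "V0 \<subseteq> carrier R" using V0(1) V finite_subset by auto
  then have V0c: "(\<lambda>v. v) \<in> V0 \<rightarrow> carrier R" by auto
  have "\<exists>c. c \<in> V0 \<rightarrow> adjoin C x \<and> e \<otimes> u = (\<Oplus>v\<in>V0. c v \<otimes> v)" if "u \<in> carrier R" for u
  proof -
    have "e \<otimes> u \<in> lin (adjoin C x) (\<lambda>v. v) V0" using V0(5) that gen by blast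
    then obtain c where "c \<in> V0 \<rightarrow> adjoin C x" "e \<otimes> u = (\<Oplus>v\<in>V0. c v \<otimes> v)"
      by (rule lin_finite_coeffs[OF _ fin(1) B V0c])
    then show ?thesis by blast
  qed
  then show thesis using that fin V0(2,3,4) subringE(1)[OF B] by blast
qed

lemma scaled_sum:
  assumes "finite V0" "V0 \<subseteq> carrier R" "c \<in> V0 \<rightarrow> carrier R" "a \<in> carrier R"
  shows "a \<otimes> (\<Oplus>v\<in>V0. c v \<otimes> v) = (\<Oplus>v\<in>V0. (a \<otimes> c v) \<otimes> v)"
proof -
  have "a \<otimes> (\<Oplus>v\<in>V0. c v \<otimes> v) = (\<Oplus>v\<in>V0. a \<otimes> (c v \<otimes> v))"
    using assms by (intro finsum_rdistr) auto
  also have "\<dots> = (\<Oplus>v\<in>V0. (a \<otimes> c v) \<otimes> v)"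
    using assms by (intro finsum_cong') (auto simp: m_assoc Pi_iff subset_iff)
  finally show ?thesis .
qed

text \<open>A nonzero coordinate of \<open>e\<close> is divisible by all powers of a unit \<open>b\<close> of the module-finite
  extension, which bounds the degree of these powers.\<close>

lemma unit_lead_degree:
  assumes b: "lead C x c j b" "c \<in> C" "c \<noteq> \<zero>" and b': "b' \<in> carrier R" "b \<otimes> b' = \<one>"
  shows "j = 0"
proof (rule ccontr)
  assume "j \<noteq> 0"
  let ?B = "adjoin C x"
  note B = adjoin_subring[OF C x] and Cc = subringE(1)[OF C]
  note Bc = subringE(1)[OF B]
  obtain V0 e where V0: "finite V0" "V0 \<subseteq> carrier R" "indep ?B (\<lambda>v. v) V0 {\<zero>}" "e \<in> carrier R"
    "e \<noteq> \<zero>" "\<And>u. u \<in> carrier R \<Longrightarrow> \<exists>c. c \<in> V0 \<rightarrow> ?B \<and> e \<otimes> u = (\<Oplus>v\<in>V0. c v \<otimes> v)"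
    using coordinates by blast
  have V0c: "(\<lambda>v. v) \<in> V0 \<rightarrow> carrier R" using V0 by auto
  obtain \<epsilon> where \<epsilon>: "\<epsilon> \<in> V0 \<rightarrow> ?B" "e \<otimes> \<one> = (\<Oplus>v\<in>V0. \<epsilon> v \<otimes> v)" using V0(6)[OF one_closed] by blast
  have "\<exists>v\<in>V0. \<epsilon> v \<noteq> \<zero>"
  proof (rule ccontr)
    assume "\<not> ?thesis"
    then have "(\<Oplus>v\<in>V0. \<epsilon> v \<otimes> v) = (\<Oplus>v\<in>V0. \<zero>)" using V0(2) by (intro finsum_cong') auto
    then show False using \<epsilon>(2) V0(4,5) by simp
  qed
  then obtain v where v: "v \<in> V0" "\<epsilon> v \<noteq> \<zero>" by blast
  \<comment> \<open>\<open>N\<close> strictly bounds the degree of this coordinate, while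
    \<open>b^N\<close> has degree \<open>j * N\<close>, which is at least \<open>N\<close> once
    \<open>j\<close> is positive.\<close>
  obtain N where N: "\<epsilon> v \<in> low C x N" using \<epsilon>(1) v(1) unfolding adjoin_def by blast
  have bc: "b \<in> carrier R" using lead_closed[OF C x b(1,2)] .
  have "b [^] N \<otimes> b' [^] N = (b \<otimes> b') [^] N" using bc b'(1) by (simp add: nat_pow_distrib)
  then have bb: "b [^] N \<otimes> b' [^] N = \<one>" using b'(2) by simp
  obtain \<gamma> where \<gamma>: "\<gamma> \<in> V0 \<rightarrow> ?B" "e \<otimes> b' [^] N = (\<Oplus>v\<in>V0. \<gamma> v \<otimes> v)"
    using V0(6) nat_pow_closed[OF b'(1)] by blast
  have bN: "b [^] N \<in> ?B"
    using lead_low[OF C x lead_pow[OF C x b(1,2)]] unfolding adjoin_def by blast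
  have "b [^] N \<otimes> (e \<otimes> b' [^] N) = e \<otimes> \<one>"
    unfolding bb[symmetric] using V0(4) bc b'(1) by (simp add: m_lcomm)
  then have "(\<Oplus>v\<in>V0. \<epsilon> v \<otimes> v) = b [^] N \<otimes> (e \<otimes> b' [^] N)"
    using \<epsilon>(2) by (simp del: r_one)
  also have "\<dots> = (\<Oplus>v\<in>V0. (b [^] N \<otimes> \<gamma> v) \<otimes> v)"
    unfolding \<gamma>(2) using \<gamma>(1) Bc V0 bc by (intro scaled_sum) auto
  finally have "\<epsilon> v = b [^] N \<otimes> \<gamma> v"
    using indep_unique[OF V0(3,1) B V0c \<epsilon>(1), of "\<lambda>v. b [^] N \<otimes> \<gamma> v"] \<gamma>(1) bN
      subringE(6)[OF B] v(1) by (auto simp: Pi_iff)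
  moreover obtain M where "\<gamma> v \<in> low C x M" using \<gamma>(1) v(1) unfolding adjoin_def by blast
  moreover have "\<gamma> v \<noteq> \<zero>" using calculation(1) v(2) bc by auto
  ultimately obtain d i where d: "d \<in> C" "d \<noteq> \<zero>" "lead C x d i (\<gamma> v)"
    using lead_exists[OF C x] by metis
  have "lead C x (c [^] N \<otimes> d) (j * N + i) (\<epsilon> v)"
    unfolding \<open>\<epsilon> v = b [^] N \<otimes> \<gamma> v\<close>
    by (rule lead_mult[OF C x lead_pow(1)[OF C x b(1,2)] d(3) lead_pow(2)[OF C x b(1,2)] d(1)])
  moreover have "\<epsilon> v \<in> low C x (j * N + i)"
    using N low_mono[of N "j * N + i" C x] \<open>j \<noteq> 0\<close> by (auto simp: trans_le_add1)
  ultimately have "c [^] N \<otimes> d = \<zero>"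
    using transc_lead_low[OF C x tr] subringE(6)[OF C lead_pow(2)[OF C x b(1,2)] d(1)] by blast
  moreover have "c [^] N \<noteq> \<zero>" using b(2,3) Cc by (induction N) (auto dest: integral)
  ultimately show False using integral d b(2) Cc by blast
qed

text \<open>The heart of the proof. Writing \<open>e u\<^sup>k\<close> and \<open>e a\<^sup>k\<close> in coordinates, \<open>s u = p a\<close> shows that
  \<open>e u\<^sup>k\<close> is divisible by \<open>p\<^sup>k\<close> for all \<open>k\<close>; so \<open>u / p\<close> is almost integral, hence integral
  over the noetherian ring, and \<open>u\<close> lies in the radical of \<open>(p)\<close>.\<close>

lemma monic_multiple:
  assumes noe: "noeth (carrier R)" and m: "primeideal m R" and p: "lead C x \<one> q p" "p \<in> m"
    and s: "s \<in> C" "s \<noteq> \<zero>" and u: "u \<in> carrier R" and a: "a \<in> carrier R"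
    and eq: "s \<otimes> u = p \<otimes> a"
  shows "u \<in> m"
proof -
  interpret m: primeideal m R by fact
  let ?B = "adjoin C x"
  note B = adjoin_subring[OF C x] and Cc = subringE(1)[OF C]
  note Bc = subringE(1)[OF B]
  obtain V0 e where V0: "finite V0" "V0 \<subseteq> carrier R" "indep ?B (\<lambda>v. v) V0 {\<zero>}" "e \<in> carrier R"
    "e \<noteq> \<zero>" "\<And>u. u \<in> carrier R \<Longrightarrow> \<exists>c. c \<in> V0 \<rightarrow> ?B \<and> e \<otimes> u = (\<Oplus>v\<in>V0. c v \<otimes> v)"
    using coordinates by blast
  have V0c: "(\<lambda>v. v) \<in> V0 \<rightarrow> carrier R" using V0 by auto
  have pc: "p \<in> carrier R" using m.Icarr p(2) .
  have sc: "s \<in> carrier R" using s Cc by blast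
  have "\<exists>w\<in>carrier R. e \<otimes> u [^] k = p [^] k \<otimes> w" for k :: nat
  proof -
    obtain \<beta> where \<beta>: "\<beta> \<in> V0 \<rightarrow> ?B" "e \<otimes> u [^] k = (\<Oplus>v\<in>V0. \<beta> v \<otimes> v)" using V0(6) u by blast
    obtain \<alpha> where \<alpha>: "\<alpha> \<in> V0 \<rightarrow> ?B" "e \<otimes> a [^] k = (\<Oplus>v\<in>V0. \<alpha> v \<otimes> v)" using V0(6) a by blast
    have lp: "lead C x \<one> (q * k) (p [^] k)" using lead_pow(1)[OF C x p(1) subringE(3)[OF C], of k] by simp
    have pB: "p [^] k \<in> ?B" using lead_low[OF C x lp subringE(3)[OF C]] unfolding adjoin_def by blast
    have sC: "s [^] k \<in> C" "s [^] k \<noteq> \<zero>"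
    proof -
      show "s [^] k \<in> C" by (induction k) (use s subringE(3,6)[OF C] in auto)
      show "s [^] k \<noteq> \<zero>" using s(2) sc by (induction k) (auto dest: integral)
    qed
    have sB: "s [^] k \<in> ?B" using sC subring_subset_adjoin[OF C x] by blast
    have "s [^] k \<otimes> u [^] k = p [^] k \<otimes> a [^] k"
      using arg_cong[OF eq, of "\<lambda>z. z [^] k"] sc u pc a by (simp add: nat_pow_distrib)
    then have "s [^] k \<otimes> (e \<otimes> u [^] k) = p [^] k \<otimes> (e \<otimes> a [^] k)"
      using sc u pc a V0(4) by (simp add: m_lcomm)
    then have "(\<Oplus>v\<in>V0. (s [^] k \<otimes> \<beta> v) \<otimes> v) = (\<Oplus>v\<in>V0. (p [^] k \<otimes> \<alpha> v) \<otimes> v)"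
      unfolding \<alpha>(2) \<beta>(2) using \<alpha>(1) \<beta>(1) Bc V0 sc pc by (simp add: scaled_sum Pi_iff subset_iff)
    then have ab: "s [^] k \<otimes> \<beta> v = p [^] k \<otimes> \<alpha> v" if "v \<in> V0" for v
      using indep_unique[OF V0(3,1) B V0c, of "\<lambda>v. s [^] k \<otimes> \<beta> v" "\<lambda>v. p [^] k \<otimes> \<alpha> v" v] \<alpha>(1) \<beta>(1) pB sB
        subringE(6)[OF B] that by (auto simp: Pi_iff)
    \<comment> \<open>Since \<open>p^k\<close> is monic, \<open>monic_cancel\<close> extracts the
      constant \<open>s^k\<close> from \<open>\<alpha> v\<close>. Cancelling it leaves
      \<open>p^k\<close> as a factor of \<open>\<beta> v\<close>.\<close>
    have "\<exists>z\<in>?B. \<beta> v = p [^] k \<otimes> z" if v: "v \<in> V0" for v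
    proof -
      have cc: "\<alpha> v \<in> ?B" "\<beta> v \<in> ?B" "\<beta> v \<in> carrier R" using \<alpha>(1) \<beta>(1) v Bc by auto
      obtain N where N: "\<alpha> v \<in> low C x N" using cc(1) unfolding adjoin_def by blast
      obtain z where z: "z \<in> ?B" "\<alpha> v = s [^] k \<otimes> z"
        using monic_cancel[OF C x tr lp sC N cc(2) ab[OF v, symmetric]] by blast
      have zc: "z \<in> carrier R" using z Bc by blast
      have "s [^] k \<otimes> \<beta> v = s [^] k \<otimes> (p [^] k \<otimes> z)"
        using ab[OF v] zc sc pc unfolding z(2) by (simp add: m_lcomm)
      then show ?thesis using m_lcancel[OF sC(2)] zc sc pc cc z(1) by auto
    qed
    then obtain z where z: "\<And>v. v \<in> V0 \<Longrightarrow> z v \<in> ?B \<and> \<beta> v = p [^] k \<otimes> z v" by metis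
    have zc: "z \<in> V0 \<rightarrow> carrier R" using z Bc by blast
    have "e \<otimes> u [^] k = (\<Oplus>v\<in>V0. (p [^] k \<otimes> z v) \<otimes> v)"
      unfolding \<beta>(2) using z zc pc V0(2) by (intro finsum_cong') (auto simp: Pi_iff)
    also have "\<dots> = p [^] k \<otimes> (\<Oplus>v\<in>V0. z v \<otimes> v)" using V0(1,2) zc pc by (simp add: scaled_sum)
    finally show ?thesis using zc V0(2) by (intro bexI[of _ "\<Oplus>v\<in>V0. z v \<otimes> v"] finsum_closed) auto
  qed
  then have "\<forall>k::nat. \<exists>w. w \<in> carrier R \<and> e \<otimes> u [^] k = p [^] k \<otimes> w" by blast
  from choice[OF this] obtain w where w: "\<And>k::nat. w k \<in> carrier R"
    "\<And>k. e \<otimes> u [^] k = p [^] k \<otimes> w k" by blast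
  \<comment> \<open>\<open>w k\<close> stands for \<open>e (u/p)^k\<close>. Expressing
    \<open>w n\<close> by earlier terms gives an integral equation of \<open>u/p\<close>, multiplied
    by \<open>e\<close>.\<close>
  obtain n where n: "w n \<in> lin (carrier R) w {..<n}" using noe w(1) unfolding noeth_def by blast
  have "\<exists>r\<in>m. p [^] n \<otimes> z = e \<otimes> r" if "z \<in> lin (carrier R) w {..<n}" for z
    using that
  proof (induction rule: lin.induct)
    case zero
    then show ?case using m.zero_closed V0(4) pc by (intro bexI[of _ \<zero>]) auto
  next
    case (step b i z)
    then obtain r where r: "r \<in> m" "p [^] n \<otimes> z = e \<otimes> r" by blast
    have i: "i < n" using step by simp
    have zc: "z \<in> carrier R" using lin_closed[OF step(3)] w(1) by blast
    have rc: "r \<in> carrier R" using r m.Icarr by blast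
    \<comment> \<open>Only terms with \<open>i < n\<close> occur, so \<open>p^n\<close> exceeds
      \<open>p^i\<close> by at least one factor \<open>p\<close>; this factor puts the result into
      \<open>m\<close>.\<close>
    obtain i' where i': "n - i = Suc i'" using i by (cases "n - i") auto
    have pni: "p [^] n = p [^] i' \<otimes> p \<otimes> p [^] i"
    proof -
      have "n = Suc i' + i" using i i' by simp
      then show ?thesis using pc by (simp only: nat_pow_mult[OF pc, symmetric] nat_pow_Suc)
    qed
    define f where "f = b \<otimes> (p [^] i' \<otimes> u [^] i)"
    have fc: "f \<in> carrier R" unfolding f_def using step pc u by auto
    have "p [^] n \<otimes> (b \<otimes> w i) = (b \<otimes> (p [^] i' \<otimes> p)) \<otimes> (p [^] i \<otimes> w i)"
      unfolding pni using step pc w(1) by (simp add: m_ac)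
    also have "\<dots> = e \<otimes> (f \<otimes> p)"
      unfolding w(2)[symmetric] f_def using step pc u V0(4) by (simp add: m_ac)
    finally have "p [^] n \<otimes> (b \<otimes> w i \<oplus> z) = e \<otimes> (f \<otimes> p \<oplus> r)"
      using r step pc w(1) zc rc V0(4) fc by (simp add: r_distr)
    moreover have "f \<otimes> p \<oplus> r \<in> m" using m.I_l_closed[OF p(2) fc] r m.a_closed by blast
    ultimately show ?case by blast
  qed
  then obtain r where r: "r \<in> m" "e \<otimes> u [^] n = e \<otimes> r" using n w(2) by metis
  then have "u [^] n = r" using m_lcancel[OF V0(5,4)] u m.Icarr by blast
  then show ?thesis using m.power_mem[OF u] r(1) by blast
qed

lemma exists_prime_below:
  assumes noe: "noeth (carrier R)" and m: "primeideal m R" and p: "lead C x \<one> q p" "p \<in> m"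
  obtains Q where "primeideal Q R" "p \<in> Q" "Q \<subseteq> m" "Q \<inter> C \<subseteq> {\<zero>}"
proof -
  interpret m: primeideal m R by fact
  note Cc = subringE(1)[OF C]
  have pc: "p \<in> carrier R" using m.Icarr p(2) .
  \<comment> \<open>Avoiding these products meets both demands on \<open>Q\<close> at once: nonzero
    elements of \<open>C\<close> and elements outside \<open>m\<close> all belong to
    \<open>T\<close>.\<close>
  define T where "T = {s \<otimes> u | s u. s \<in> C - {\<zero>} \<and> u \<in> carrier R - m}"
  have one: "\<one> \<in> C - {\<zero>}" "\<one> \<in> carrier R - m"
    using subringE(3)[OF C] m.one_imp_carrier m.I_notcarr by auto
  have CT: "s \<in> T" if "s \<in> C - {\<zero>}" for s
  proof -
    have "s \<otimes> \<one> \<in> T" unfolding T_def using that one by blast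
    then show ?thesis using that Cc by auto
  qed
  have mT: "u \<in> T" if "u \<in> carrier R - m" for u
  proof -
    have "\<one> \<otimes> u \<in> T" unfolding T_def using that one by blast
    then show ?thesis using that by auto
  qed
  have "T \<subseteq> carrier R" unfolding T_def using Cc by auto
  moreover have "\<one> \<in> T" using CT one by blast
  moreover have "a \<otimes> b \<in> T" if "a \<in> T" "b \<in> T" for a b
  proof -
    from that obtain s u s' u' where H: "s \<in> C - {\<zero>}" "u \<in> carrier R - m" "a = s \<otimes> u"
      "s' \<in> C - {\<zero>}" "u' \<in> carrier R - m" "b = s' \<otimes> u'" unfolding T_def by blast
    have c: "s \<in> carrier R" "s' \<in> carrier R" "u \<in> carrier R" "u' \<in> carrier R" using H Cc by auto
    have "s \<otimes> s' \<in> C - {\<zero>}" using H c integral subringE(6)[OF C] by auto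
    moreover have "u \<otimes> u' \<in> carrier R - m" using H c m.I_prime by auto
    moreover have "a \<otimes> b = (s \<otimes> s') \<otimes> (u \<otimes> u')" unfolding H using c by (simp add: m_ac)
    ultimately show ?thesis unfolding T_def by blast
  qed
  moreover have "PIdl p \<inter> T = {}"
  proof (rule ccontr)
    assume "PIdl p \<inter> T \<noteq> {}"
    then obtain a s u where H: "a \<in> carrier R" "s \<in> C" "s \<noteq> \<zero>" "u \<in> carrier R" "u \<notin> m"
      "a \<otimes> p = s \<otimes> u" unfolding T_def cgenideal_def by blast
    then have "s \<otimes> u = p \<otimes> a" using pc by (simp add: m_comm)
    then show False using monic_multiple[OF noe m p H(2,3,4,1)] H(5) by blast
  qed
  ultimately obtain Q where Q: "primeideal Q R" "PIdl p \<subseteq> Q" "Q \<inter> T = {}"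
    using exists_primeideal_disjoint[OF cgenideal_ideal[OF pc], of T] by metis
  have Qc: "Q \<subseteq> carrier R" using ideal.Icarr[OF primeideal.axioms(1)[OF Q(1)]] by blast
  have "p \<in> Q" using Q(2) cgenideal_self[OF pc] by blast
  moreover have "Q \<subseteq> m" using mT Q(3) Qc by blast
  moreover have "Q \<inter> C \<subseteq> {\<zero>}" using CT Q(3) by blast
  ultimately show thesis using that Q(1) by blast
qed

end

end

section \<open>Bounding the number of independent elements\<close>

text \<open>Exponents are bounded separately instead of in total: for positive \<open>N\<close> such
  a box has exactly \<open>N^n\<close> elements, and the bounds add when monomials are
  multiplied.\<close>

definition Box :: "nat \<Rightarrow> nat \<Rightarrow> nat multiset set" where
  "Box n N = {m \<in> Mons n. \<forall>i. count m i < N}"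

lemma Box_mono: "N \<le> N' \<Longrightarrow> Box n N \<subseteq> Box n N'"
  unfolding Box_def using order_less_le_trans by blast

lemma size_Box: "m \<in> Box n N \<Longrightarrow> size m \<le> n * N"
proof -
  assume m: "m \<in> Box n N"
  have "size m = (\<Sum>i\<in>set_mset m. count m i)" by (simp add: size_multiset_overloaded_eq)
  also have "\<dots> \<le> (\<Sum>i<n. count m i)"
    using m unfolding Box_def Mons_def by (intro sum_mono2) auto
  also have "\<dots> \<le> (\<Sum>i<n. N)"
    using m unfolding Box_def by (intro sum_mono) (auto simp: less_imp_le)
  finally show ?thesis by simp
qed

text \<open>Positivity of \<open>N\<close> matters because the bound in \<open>Box\<close> also
  covers the indices from \<open>n\<close> on, where the count is zero.\<close>

lemma bij_betw_Box:
  assumes "N > 0"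
  shows "bij_betw (\<lambda>m. restrict (count m) {..<n}) (Box n N) ({..<n} \<rightarrow>\<^sub>E {..<N})"
proof (rule bij_betwI')
  fix m m' assume m: "m \<in> Box n N" "m' \<in> Box n N"
  show "restrict (count m) {..<n} = restrict (count m') {..<n} \<longleftrightarrow> m = m'"
  proof
    assume eq: "restrict (count m) {..<n} = restrict (count m') {..<n}"
    show "m = m'"
    proof (rule multiset_eqI)
      fix i
      show "count m i = count m' i"
      proof (cases "i < n")
        case True
        then show ?thesis using fun_cong[OF eq, of i] by simp
      next
        case False
        then have "i \<notin># m" "i \<notin># m'" using m unfolding Box_def Mons_def by auto
        then show ?thesis by (simp add: not_in_iff)
      qed
    qed
  qed simp
next
  fix m assume "m \<in> Box n N"
  then show "restrict (count m) {..<n} \<in> {..<n} \<rightarrow>\<^sub>E {..<N}" unfolding Box_def by auto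
next
  fix g assume g: "g \<in> {..<n} \<rightarrow>\<^sub>E {..<N}"
  define m where "m = (\<Sum>i<n. replicate_mset (g i) i)"
  have c: "count m j = (if j < n then g j else 0)" for j
  proof -
    have "count m j = (\<Sum>i<n. if i = j then g i else 0)"
      unfolding m_def count_sum by (intro sum.cong) auto
    then show ?thesis by (simp add: sum.delta)
  qed
  have "m \<in> Box n N"
    using g assms unfolding Box_def Mons_def
    by (auto simp: c PiE_iff simp flip: count_greater_zero_iff split: if_splits)
  moreover have "g = restrict (count m) {..<n}"
    using g by (auto simp: fun_eq_iff c PiE_iff extensional_def)
  ultimately show "\<exists>m\<in>Box n N. g = restrict (count m) {..<n}" by blast
qed

lemma finite_Box: "N > 0 \<Longrightarrow> finite (Box n N)"
  using bij_betw_finite[OF bij_betw_Box] by (simp add: finite_PiE)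

lemma card_Box: "N > 0 \<Longrightarrow> card (Box n N) = N ^ n"
  using bij_betw_same_card[OF bij_betw_Box] by (simp add: card_PiE)

context cring
begin

text \<open>Growth argument: in the filtration \<open>F\<close> by exponents less than \<open>N\<close>, the dimensions grow like
  \<open>N\<^sup>k\<close>, too slowly for the monomials of more than \<open>k\<close> elements to be independent. The powers of
  \<open>b\<close> make the relation homogeneous, so that it can be divided by a power of \<open>b\<close>.\<close>

lemma homogeneous_relation:
  assumes K: "subfield K R" and y: "y \<in> {..<k} \<rightarrow> carrier R" and V: "finite V" "V \<subseteq> carrier R"
    and gen: "carrier R = lin (Alg K y k) (\<lambda>v. v) V"
    and a: "a \<in> {..<j} \<rightarrow> carrier R" and b: "b \<in> carrier R" and j: "k < j"
  shows "\<exists>N J c. finite J \<and> J \<subseteq> Mons j \<and> (\<forall>m\<in>J. size m \<le> N) \<and> c \<in> J \<rightarrow> K \<and> (\<exists>m\<in>J. c m \<noteq> \<zero>) \<and>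
    (\<Oplus>m\<in>J. c m \<otimes> (mon a m \<otimes> b [^] (N - size m))) = \<zero>"
proof -
  note Ks = K_subring[OF K] and Kc = K_carrier[OF K] and mo = mon_Mons[OF K y]
  define g where "g = (\<lambda>(m, v). mon y m \<otimes> v)"
  define F where "F N = lin K g (Box k N \<times> V)" for N
  have BM: "m \<in> Mons k" if "m \<in> Box k N" for m N using that unfolding Box_def by blast
  have gc: "g \<in> Box k N \<times> V \<rightarrow> carrier R" for N
    using mo V(2) BM unfolding g_def by (auto simp: Pi_iff subset_iff)
  have Fc: "u \<in> carrier R" if "u \<in> F N" for u N
    using that unfolding F_def by (rule lin_closed[OF _ Kc gc])
  have F_mono: "F N \<subseteq> F N'" if "N \<le> N'" for N N'
    unfolding F_def using Box_mono[OF that, of k] by (intro lin_mono) auto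
  have F_zero: "\<zero> \<in> F N" for N unfolding F_def by (rule lin.zero)
  have F_add: "u \<oplus> v \<in> F N" if "u \<in> F N" "v \<in> F N" for u v N
    using that unfolding F_def by (rule lin_add[OF _ _ Kc gc])
  have F_smult: "c \<otimes> u \<in> F N" if "u \<in> F N" "c \<in> K" for u c N
    using that unfolding F_def by (rule lin_smult[OF _ _ Ks gc])
  have F_base: "c \<otimes> (mon y m \<otimes> v) \<in> F N" if "c \<in> K" "m \<in> Box k N" "v \<in> V" for c m v N
    using lin_base[OF that(1) _ Kc gc, of "(m, v)" N] that unfolding F_def g_def by simp
  have F_minimal: "u \<in> W"
    if "u \<in> F N" "\<zero> \<in> W" "\<And>u v. u \<in> W \<Longrightarrow> v \<in> W \<Longrightarrow> u \<oplus> v \<in> W"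
      "\<And>c m v. c \<in> K \<Longrightarrow> m \<in> Box k N \<Longrightarrow> v \<in> V \<Longrightarrow> c \<otimes> (mon y m \<otimes> v) \<in> W" for u W N
    using lin_minimal[OF that(1)[unfolded F_def] that(2,3)] that(4) unfolding g_def by auto
  have U_add: "u \<oplus> v \<in> (\<Union>N. F N)" if uv: "u \<in> (\<Union>N. F N)" "v \<in> (\<Union>N. F N)" for u v
  proof -
    obtain N M where "u \<in> F N" "v \<in> F M" using uv by blast
    then have "u \<in> F (max N M)" "v \<in> F (max N M)"
      using F_mono[of N "max N M"] F_mono[of M "max N M"] by auto
    then show ?thesis using F_add by blast
  qed
  have exhaust: "\<exists>N. u \<in> F N" if u: "u \<in> carrier R" for u
  proof -
    have "u \<in> (\<Union>N. F N)"
    proof (rule lin_minimal[of u "Alg K y k" "\<lambda>v. v" V])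
      show "u \<in> lin (Alg K y k) (\<lambda>v. v) V" using u gen by simp
      show "\<zero> \<in> (\<Union>N. F N)" using F_zero by blast
      fix s v assume s: "s \<in> Alg K y k" and v: "v \<in> V"
      have vc: "v \<in> carrier R" using v V by blast
      have "s \<in> {s \<in> carrier R. s \<otimes> v \<in> (\<Union>N. F N)}"
      proof (rule lin_minimal[OF s[unfolded Alg_def]])
        show "\<zero> \<in> {s \<in> carrier R. s \<otimes> v \<in> (\<Union>N. F N)}" using F_zero vc by auto
        show "s \<oplus> s' \<in> {s \<in> carrier R. s \<otimes> v \<in> (\<Union>N. F N)}"
          if "s \<in> {s \<in> carrier R. s \<otimes> v \<in> (\<Union>N. F N)}" "s' \<in> {s \<in> carrier R. s \<otimes> v \<in> (\<Union>N. F N)}"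
          for s s'
          using that U_add[of "s \<otimes> v" "s' \<otimes> v"] vc by (simp add: l_distr)
        fix c m assume c: "c \<in> K" and m: "m \<in> Mons k"
        have "m \<in> Box k (Suc (size m))"
          using m unfolding Box_def by (auto simp: less_Suc_eq_le count_le_size)
        then have "c \<otimes> (mon y m \<otimes> v) \<in> (\<Union>N. F N)" using F_base[OF c _ v] by blast
        moreover have "c \<in> carrier R" "mon y m \<in> carrier R" using c Kc m mo by auto
        ultimately show "c \<otimes> mon y m \<in> {s \<in> carrier R. s \<otimes> v \<in> (\<Union>N. F N)}"
          using vc by (simp add: m_assoc)
      qed
      then show "s \<otimes> v \<in> (\<Union>N. F N)" by simp
    qed (use U_add in blast)
    then show ?thesis by blast
  qed
  have mon_F: "mon y m \<otimes> u \<in> F (M + N)" if m: "m \<in> Box k M" and u: "u \<in> F N" for m u M N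
  proof -
    have mc: "mon y m \<in> carrier R" using BM[OF m] mo by blast
    have "u \<in> {u \<in> carrier R. mon y m \<otimes> u \<in> F (M + N)}" using u
    proof (rule F_minimal)
      fix c m' v assume c: "c \<in> K" and m': "m' \<in> Box k N" and v: "v \<in> V"
      have cc: "c \<in> carrier R" "v \<in> carrier R" "mon y m' \<in> carrier R"
        using c Kc v V BM[OF m'] mo by auto
      have "m + m' \<in> Box k (M + N)"
        using m m' Mons_union unfolding Box_def by (auto simp: add_strict_mono)
      then have "c \<otimes> (mon y (m + m') \<otimes> v) \<in> F (M + N)" using F_base c v by blast
      moreover have "mon y (m + m') = mon y m \<otimes> mon y m'"
        using BM[OF m] BM[OF m'] y by (intro mon_union) (auto simp: Mons_def)
      ultimately show "c \<otimes> (mon y m' \<otimes> v) \<in> {u \<in> carrier R. mon y m \<otimes> u \<in> F (M + N)}"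
        using cc mc by (simp add: m_ac)
    qed (use F_zero F_add mc in \<open>auto simp: r_distr\<close>)
    then show ?thesis by simp
  qed
  define U where "U = insert \<one> (insert b (a ` {..<j}))"
  have U: "finite U" "U \<subseteq> carrier R" unfolding U_def using a b by auto
  have "\<exists>c. \<forall>w\<in>W. w \<in> F c" if "finite W" "W \<subseteq> carrier R" for W
    using that
  proof (induction W rule: finite_induct)
    case (insert w W)
    then obtain c where c: "\<forall>w\<in>W. w \<in> F c" by auto
    obtain d where d: "w \<in> F d" using exhaust insert by blast
    show ?case using c d F_mono[of c "max c d"] F_mono[of d "max c d"]
      by (intro exI[of _ "max c d"]) auto
  qed auto
  moreover have "finite (insert \<one> ((\<lambda>(u, v). u \<otimes> v) ` (U \<times> V)))"
    "insert \<one> ((\<lambda>(u, v). u \<otimes> v) ` (U \<times> V)) \<subseteq> carrier R" using U V by auto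
  \<comment> \<open>The growth per factor: multiplying by one element of \<open>U\<close> raises the
    filtration index by at most \<open>c\<close>, whatever that index was.\<close>
  ultimately obtain c where c: "\<forall>w\<in>insert \<one> ((\<lambda>(u, v). u \<otimes> v) ` (U \<times> V)). w \<in> F c" by blast
  have U_F: "u \<otimes> z \<in> F (c + N)" if u: "u \<in> U" and z: "z \<in> F N" for u z N
  proof -
    have uc: "u \<in> carrier R" using u U by blast
    have "z \<in> {z \<in> carrier R. u \<otimes> z \<in> F (c + N)}" using z
    proof (rule F_minimal)
      fix s m v assume s: "s \<in> K" and m: "m \<in> Box k N" and v: "v \<in> V"
      have cc: "s \<in> carrier R" "v \<in> carrier R" "mon y m \<in> carrier R"
        using s Kc v V BM[OF m] mo by auto
      have "u \<otimes> v \<in> F c" using c u v by auto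
      then have "s \<otimes> (mon y m \<otimes> (u \<otimes> v)) \<in> F (N + c)" using F_smult mon_F[OF m] s by blast
      then show "s \<otimes> (mon y m \<otimes> v) \<in> {z \<in> carrier R. u \<otimes> z \<in> F (c + N)}"
        using cc uc by (simp add: m_ac add.commute)
    qed (use F_zero F_add uc in \<open>auto simp: r_distr\<close>)
    then show ?thesis by simp
  qed
  have pow_F: "b [^] n \<otimes> z \<in> F (n * c + N)" if z: "z \<in> F N" for n z N
  proof (induction n)
    case 0
    then show ?case using z Fc by simp
  next
    case (Suc n)
    have "b \<in> U" unfolding U_def by blast
    from U_F[OF this Suc] show ?case using b Fc[OF z] by (simp add: m_ac add.assoc)
  qed
  have mona_F: "mon a m \<otimes> z \<in> F (size m * c + N)" if "m \<in> Mons j" "z \<in> F N" for m z N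
    using that(1)
  proof (induction m)
    case empty
    then show ?case using that(2) Fc by simp
  next
    case (add i m)
    then have im: "i < j" "m \<in> Mons j" unfolding Mons_def by auto
    have "a i \<in> U" unfolding U_def using im by blast
    from U_F[OF this add.IH[OF im(2)]] have "a i \<otimes> (mon a m \<otimes> z) \<in> F (size (add_mset i m) * c + N)"
      by (simp add: add.assoc)
    moreover have "mon a (add_mset i m) = a i \<otimes> mon a m"
      using add.prems a by (intro mon_add_mset) (auto simp: Mons_def)
    moreover have "mon a m \<in> carrier R" using mon_Mons[OF K a] im by blast
    ultimately show ?case using a im Fc[OF that(2)] by (simp add: m_assoc Pi_iff)
  qed
  \<comment> \<open>\<open>N\<close> bounds the size of the monomials in \<open>Box j M\<close>, so
    each \<open>w m\<close> has filtration index at most \<open>N * c + c\<close>, and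
    \<open>d\<close> is chosen to make this at most \<open>d * M\<close>. Since \<open>M\<close>
    exceeds \<open>d^k * card V\<close>, the \<open>(d * M)^k * card V\<close> generators are fewer
    than \<open>M^(k+1)\<close>, hence fewer than the \<open>M^j\<close> monomials.\<close>
  define d where "d = c + c * j + 1"
  define M where "M = d ^ k * card V + 1"
  define N where "N = j * M"
  define w where "w m = mon a m \<otimes> b [^] (N - size m)" for m
  have sz: "size m \<le> N" if "m \<in> Box j M" for m using size_Box[OF that] unfolding N_def .
  have wF: "w m \<in> F (d * M)" if m: "m \<in> Box j M" for m
  proof -
    have mM: "m \<in> Mons j" using m unfolding Box_def by blast
    have mc: "mon a m \<in> carrier R" using mM mon_Mons[OF K a] by blast
    have "mon a m \<otimes> (b [^] (N - size m) \<otimes> \<one>) \<in> F (size m * c + ((N - size m) * c + c))"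
      using mona_F[OF mM pow_F] c by blast
    then have "w m \<in> F (size m * c + ((N - size m) * c + c))" unfolding w_def using b by simp
    moreover have "size m * c + ((N - size m) * c + c) = N * c + c"
      using sz[OF m] by (simp add: add_mult_distrib[symmetric] flip: add.assoc)
    moreover have "N * c + c \<le> d * M" unfolding N_def d_def M_def by (simp add: algebra_simps)
    ultimately show ?thesis using F_mono by (metis subsetD)
  qed
  have M0: "M > 0" and d0: "d > 0" unfolding M_def d_def by auto
  have dM: "d * M > 0" using M0 d0 by simp
  have "card (Box k (d * M) \<times> V) = (d * M) ^ k * card V"
    using card_Box[OF dM] by (simp add: card_cartesian_product)
  also have "\<dots> = (d ^ k * card V) * M ^ k" by (simp add: power_mult_distrib)
  also have "\<dots> < M * M ^ k" using M0 unfolding M_def by (intro mult_strict_right_mono) auto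
  also have "\<dots> = M ^ Suc k" by simp
  also have "\<dots> \<le> M ^ j" using j M0 by (intro power_increasing) auto
  also have "\<dots> = card (Box j M)" using card_Box[OF M0] by simp
  finally have card: "card (Box k (d * M) \<times> V) < card (Box j M)" .
  have "\<exists>c. c \<in> Box j M \<rightarrow> K \<and> (\<exists>m\<in>Box j M. c m \<noteq> \<zero>) \<and> (\<Oplus>m\<in>Box j M. c m \<otimes> w m) = \<zero>"
    by (rule dependent_of_card[OF _ finite_Box[OF M0] card K gc])
      (use finite_Box[OF dM] V(1) wF in \<open>auto simp: F_def\<close>)
  then show ?thesis unfolding w_def
    using finite_Box[OF M0] sz by (intro exI[of _ N] exI[of _ "Box j M"]) (auto simp: Box_def)
qed

text \<open>With \<open>b = 1\<close> the homogenising factors disappear, and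
  \<open>homogeneous_relation\<close> contradicts independence.\<close>

lemma independent_bound:
  assumes "subfield K R" "y \<in> {..<k} \<rightarrow> carrier R" "finite V" "V \<subseteq> carrier R"
    "carrier R = lin (Alg K y k) (\<lambda>v. v) V"
    and z: "z \<in> {..<j} \<rightarrow> carrier R" "indep K (mon z) (Mons j) {\<zero>}"
  shows "j \<le> k"
proof (rule ccontr)
  assume "\<not> j \<le> k"
  then have "k < j" by simp
  from homogeneous_relation[OF assms(1-5) z(1) one_closed this]
  obtain N J c where J: "finite J" "J \<subseteq> Mons j" "c \<in> J \<rightarrow> K" "\<exists>m\<in>J. c m \<noteq> \<zero>"
    "(\<Oplus>m\<in>J. c m \<otimes> (mon z m \<otimes> \<one> [^] (N - size m))) = \<zero>"
    by (elim exE conjE) (rule that)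
  have "c m \<in> carrier R" "mon z m \<in> carrier R" if "m \<in> J" for m
    using that J(2,3) mon_Mons[OF assms(1) z(1)] K_carrier[OF assms(1)] by auto
  then have "(\<Oplus>m\<in>J. c m \<otimes> mon z m) = (\<Oplus>m\<in>J. c m \<otimes> (mon z m \<otimes> \<one> [^] (N - size m)))"
    by (intro finsum_cong') auto
  then show False using indepD[OF z(2) J(1,2,3)] J(4,5) by auto
qed

section \<open>Independence modulo nested prime ideals\<close>

lemma finsum_mem_ideal:
  assumes "ideal I R" "finite J" "\<And>j. j \<in> J \<Longrightarrow> f j \<in> I" shows "(\<Oplus>j\<in>J. f j) \<in> I"
  using assms(2,3)
proof (induction J rule: finite_induct)
  case empty
  then show ?case using additive_subgroup.zero_closed[OF ideal.axioms(1)[OF assms(1)]] by simp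
next
  case (insert j J)
  have "f i \<in> carrier R" if "i \<in> insert j J" for i using insert(4)[OF that] ideal.Icarr[OF assms(1)] by blast
  then show ?case using insert additive_subgroup.a_closed[OF ideal.axioms(1)[OF assms(1)]]
    by (subst finsum_insert) auto
qed

text \<open>A relation between \<open>z\<close> and \<open>f\<close> modulo \<open>P\<close> may be divided by \<open>f\<close>; its terms without \<open>f\<close>
  are then a relation between the elements of \<open>z\<close> modulo \<open>P'\<close>.\<close>

lemma independent_extend:
  assumes K: "subfield K R" and P: "primeideal P R" and P': "primeideal P' R" and PP': "P \<subseteq> P'"
    and f: "f \<in> P'" "f \<notin> P" and z: "z \<in> {..<n} \<rightarrow> carrier R" and ind: "indep K (mon z) (Mons n) P'"
  shows "indep K (mon (z(n := f))) (Mons (Suc n)) P"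
  unfolding indep_def
proof (intro allI impI, rule ccontr)
  interpret P: primeideal P R by fact
  interpret P': primeideal P' R by fact
  note Ks = K_subring[OF K] and Kc = K_carrier[OF K]
  define y where "y = z(n := f)"
  have fc: "f \<in> carrier R" using f P'.Icarr by blast
  have y: "y \<in> {..<Suc n} \<rightarrow> carrier R" using z fc unfolding y_def by (auto simp: Pi_iff less_Suc_eq)
  note mo = mon_Mons[OF K y]
  fix J0 a assume J0: "finite J0" "J0 \<subseteq> Mons (Suc n)" "a \<in> J0 \<rightarrow> K"
    "(\<Oplus>m\<in>J0. a m \<otimes> mon (z(n := f)) m) \<in> P" "\<not> (\<forall>m\<in>J0. a m = \<zero>)"
  define J where "J = {m \<in> J0. a m \<noteq> \<zero>}"
  have J: "finite J" "J \<subseteq> Mons (Suc n)" "a \<in> J \<rightarrow> K" "J \<noteq> {}" using J0 unfolding J_def by auto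
  have ac: "a m \<in> carrier R" "mon y m \<in> carrier R" if "m \<in> J0" for m
    using that J0 Kc mo by auto
  have "(\<Oplus>m\<in>J. a m \<otimes> mon y m) = (\<Oplus>m\<in>J0. a m \<otimes> mon y m)"
    using J0(1) ac by (intro add.finprod_mono_neutral_cong_left) (auto simp: J_def)
  then have sumP: "(\<Oplus>m\<in>J. a m \<otimes> mon y m) \<in> P" using J0 unfolding y_def by simp
  \<comment> \<open>The minimum runs over terms with nonzero coefficient. Dividing by
    \<open>f^q\<close> is possible as \<open>f\<close> is not in the prime \<open>P\<close>, and a
    term attaining the minimum survives in \<open>A\<close>, which yields the contradiction.\<close>
  define q where "q = Min ((\<lambda>m. count m n) ` J)"
  have q: "q \<le> count m n" if "m \<in> J" for m unfolding q_def using that J(1) by simp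
  define h where "h m = m - replicate_mset q n" for m :: "nat multiset"
  have hm: "h m + replicate_mset q n = m" if "m \<in> J" for m
    using q[OF that] unfolding h_def by (simp add: count_le_replicate_mset_subset_eq)
  have hM: "h m \<in> Mons (Suc n)" if "m \<in> J" for m
  proof -
    have "set_mset (h m) \<subseteq> set_mset m" unfolding h_def by (meson in_diffD subsetI)
    then show ?thesis using that J(2) unfolding Mons_def by blast
  qed
  have hc: "a m \<in> carrier R" "mon y (h m) \<in> carrier R" if "m \<in> J" for m
    using ac[of m] that hM[OF that] mo unfolding J_def by auto
  have split: "mon y m = f [^] q \<otimes> mon y (h m)" if m: "m \<in> J" for m
  proof -
    have "mon y (h m + replicate_mset q n) = mon y (h m) \<otimes> mon y (replicate_mset q n)"
      using y hm[OF m] J(2) m by (intro mon_union) (auto simp: Mons_def)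
    also have "mon y (replicate_mset q n) = f [^] q"
      using mon_replicate[of y n q] fc unfolding y_def by simp
    finally show ?thesis using hm[OF m] hc[OF m] fc by (simp add: m_comm)
  qed
  have "(\<Oplus>m\<in>J. a m \<otimes> mon y m) = (\<Oplus>m\<in>J. f [^] q \<otimes> (a m \<otimes> mon y (h m)))"
    using split hc fc by (intro finsum_cong') (auto simp: m_lcomm)
  also have "\<dots> = f [^] q \<otimes> (\<Oplus>m\<in>J. a m \<otimes> mon y (h m))"
    using hc fc J(1) by (intro finsum_rdistr[symmetric]) auto
  finally have "f [^] q \<otimes> (\<Oplus>m\<in>J. a m \<otimes> mon y (h m)) \<in> P" using sumP by simp
  moreover have "(\<Oplus>m\<in>J. a m \<otimes> mon y (h m)) \<in> carrier R" using hc by (intro finsum_closed) auto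
  ultimately have "(\<Oplus>m\<in>J. a m \<otimes> mon y (h m)) \<in> P"
    using P.I_prime[of "f [^] q"] P.power_mem[OF fc] f(2) fc by blast
  then have sumP': "(\<Oplus>m\<in>J. a m \<otimes> mon y (h m)) \<in> P'" using PP' by blast
  define A B where "A = {m \<in> J. count m n = q}" and "B = {m \<in> J. count m n > q}"
  have AB: "J = A \<union> B" "A \<inter> B = {}" "finite A" "finite B"
    using q J(1) unfolding A_def B_def by (auto simp: le_less)
  have AJ: "m \<in> J" if "m \<in> A" for m using that unfolding A_def by blast
  have "a m \<otimes> mon y (h m) \<in> P'" if m: "m \<in> B" for m
  proof -
    have mJ: "m \<in> J" using m unfolding B_def by blast
    have "n \<in># h m" using m unfolding h_def B_def by (simp flip: count_greater_zero_iff)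
    then obtain m' where m': "h m = add_mset n m'" by (meson multi_member_split)
    have "y \<in> set_mset (add_mset n m') \<rightarrow> carrier R"
      using y hM[OF mJ] unfolding m' Mons_def by (auto simp: Pi_iff)
    then have "mon y (h m) = f \<otimes> mon y m'"
      using mon_add_mset[of y n m'] unfolding m' by (simp add: y_def)
    moreover have "mon y m' \<in> carrier R"
      using mo hM[OF mJ] unfolding m' Mons_def by auto
    ultimately show ?thesis using P'.I_l_closed[OF P'.I_r_closed[OF f(1)]] hc[OF mJ] by simp
  qed
  then have sB: "(\<Oplus>m\<in>B. a m \<otimes> mon y (h m)) \<in> P'" by (rule finsum_mem_ideal[OF P'.is_ideal AB(4)])
  define sA where "sA = (\<Oplus>m\<in>A. a m \<otimes> mon y (h m))"
  have sAc: "sA \<in> carrier R" unfolding sA_def using hc AJ by (intro finsum_closed) auto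
  have "(\<Oplus>m\<in>J. a m \<otimes> mon y (h m)) = sA \<oplus> (\<Oplus>m\<in>B. a m \<otimes> mon y (h m))"
    unfolding AB(1) sA_def using AB(2-4) hc by (intro finsum_Un_disjoint) (auto simp: AB(1))
  then have "sA = (\<Oplus>m\<in>J. a m \<otimes> mon y (h m)) \<oplus> \<ominus> (\<Oplus>m\<in>B. a m \<otimes> mon y (h m))"
    using sAc P'.Icarr[OF sB] by (simp add: a_assoc r_neg)
  then have sA: "sA \<in> P'" using P'.a_closed[OF sumP' P'.a_inv_closed[OF sB]] by simp
  have hA: "h m \<in> Mons n" if m: "m \<in> A" for m
  proof -
    have "count (h m) n = 0" using m unfolding A_def h_def by simp
    then have "n \<notin># h m" by (simp add: not_in_iff)
    then show ?thesis using hM[OF AJ[OF m]] unfolding Mons_def by (auto simp: less_Suc_eq)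
  qed
  have inj: "inj_on h A" using hm AJ by (metis inj_onI)
  have mz: "mon y (h m) = mon z (h m)" if m: "m \<in> A" for m
    using hA[OF m] z unfolding y_def Mons_def by (intro mon_cong) auto
  have zc: "mon z (h m) \<in> carrier R" if "m \<in> A" for m using mz[OF that] hc(2)[OF AJ[OF that]] by simp
  have "(\<Oplus>m\<in>h ` A. a (m + replicate_mset q n) \<otimes> mon z m) =
      (\<Oplus>m\<in>A. a (h m + replicate_mset q n) \<otimes> mon z (h m))"
    using inj hm AJ hc(1) zc by (intro finsum_reindex) (auto simp: Pi_iff)
  also have "\<dots> = sA" unfolding sA_def using hm AJ hc mz zc by (intro finsum_cong') auto
  finally have "(\<Oplus>m\<in>h ` A. a (m + replicate_mset q n) \<otimes> mon z m) \<in> P'" using sA by simp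
  moreover have "h ` A \<subseteq> Mons n" using hA by blast
  moreover have "(\<lambda>m. a (m + replicate_mset q n)) \<in> h ` A \<rightarrow> K"
    using hm AJ J(3) by (auto simp: Pi_iff)
  ultimately have z0: "a (m + replicate_mset q n) = \<zero>" if "m \<in> h ` A" for m
    using indepD[OF ind finite_imageI[OF AB(3)], of h "\<lambda>m. a (m + replicate_mset q n)" m] that by blast
  have "q \<in> (\<lambda>m. count m n) ` J" unfolding q_def using J by (intro Min_in) auto
  then obtain m where "m \<in> A" unfolding A_def by auto
  then have "a m = \<zero>" using z0[OF imageI] hm[OF AJ] by metis
  then show False using \<open>m \<in> A\<close> unfolding A_def J_def by blast
qed

end

section \<open>Normalised domains\<close>

text \<open>Packages a Noether normalisation with noetherianity, so that both can be interpreted in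
  every quotient by a prime ideal.\<close>

locale normalised_domain = domain R for R (structure) +
  fixes K and y :: "nat \<Rightarrow> 'a" and k and V
  assumes K: "subfield K R" and y: "y \<in> {..<k} \<rightarrow> carrier R"
    and y_indep: "indep K (mon y) (Mons k) {\<zero>}"
    and V: "finite V" "V \<subseteq> carrier R" and gen: "carrier R = lin (Alg K y k) (\<lambda>v. v) V"
    and noe: "noeth (carrier R)"
begin

text \<open>Used with all \<open>k\<close> variables in \<open>divides_polynomial\<close> and with
  all but the last in \<open>prime_of_coheight_one\<close>.\<close>

lemma indep_prime_disjoint:
  assumes Q: "Q \<inter> Alg K y n \<subseteq> {\<zero>}" and n: "n \<le> k"
  shows "indep K (mon y) (Mons n) Q"
  unfolding indep_def
proof (intro allI impI)
  have y': "y \<in> {..<n} \<rightarrow> carrier R" using y n by auto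
  fix J a assume J: "finite J" "J \<subseteq> Mons n" "a \<in> J \<rightarrow> K" "(\<Oplus>m\<in>J. a m \<otimes> mon y m) \<in> Q"
  have "(\<Oplus>m\<in>J. a m \<otimes> mon y m) \<in> Alg K y n"
    unfolding Alg_def by (rule lin_of_sum[OF J(1,2,3) K_carrier[OF K] mon_Mons[OF K y']])
  then have "(\<Oplus>m\<in>J. a m \<otimes> mon y m) \<in> {\<zero>}" using Q J(4) by blast
  moreover have "J \<subseteq> Mons k" using J(2) Mons_mono[OF n] by blast
  ultimately show "\<forall>m\<in>J. a m = \<zero>" using indepD[OF y_indep J(1) _ J(3)] by blast
qed

text \<open>Otherwise some prime containing \<open>a\<close> would meet the polynomial ring trivially, and \<open>a\<close> could
  be added to the \<open>k\<close> independent elements.\<close>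

lemma divides_polynomial:
  assumes a: "a \<in> carrier R" "a \<noteq> \<zero>"
  obtains g where "g \<in> carrier R" "a \<otimes> g \<in> Alg K y k" "a \<otimes> g \<noteq> \<zero>"
proof (rule ccontr)
  assume no: "\<not> thesis"
  let ?T = "Alg K y k - {\<zero>}"
  note B = Alg_subring[OF K y]
  note Bc = subringE(1)[OF B]
  have "PIdl a \<inter> ?T = {}"
  proof (rule ccontr)
    assume "PIdl a \<inter> ?T \<noteq> {}"
    then obtain g where "g \<in> carrier R" "g \<otimes> a \<in> Alg K y k" "g \<otimes> a \<noteq> \<zero>" unfolding cgenideal_def by blast
    then show False using no that[of g] a(1) by (simp add: m_comm)
  qed
  moreover have "?T \<subseteq> carrier R" "\<one> \<in> ?T" using Bc subringE(3)[OF B] by auto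
  moreover have "u \<otimes> v \<in> ?T" if "u \<in> ?T" "v \<in> ?T" for u v
    using that Bc integral subringE(6)[OF B] by blast
  ultimately obtain Q where Q: "primeideal Q R" "PIdl a \<subseteq> Q" "Q \<inter> ?T = {}"
    using exists_primeideal_disjoint[OF cgenideal_ideal[OF a(1)], of ?T] by metis
  have "indep K (mon y) (Mons k) Q" using indep_prime_disjoint[of Q k] Q(3) by blast
  moreover have "a \<in> Q" using Q(2) cgenideal_self[OF a(1)] by blast
  moreover have "{\<zero>} \<subseteq> Q"
    using additive_subgroup.zero_closed[OF ideal.axioms(1)[OF primeideal.axioms(1)[OF Q(1)]]] by blast
  ultimately have "indep K (mon (y(k := a))) (Mons (Suc k)) {\<zero>}"
    using independent_extend[OF K zeroprimeideal Q(1)] a(2) y by blast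
  moreover have "y(k := a) \<in> {..<Suc k} \<rightarrow> carrier R" using y a by (auto simp: Pi_iff less_Suc_eq)
  ultimately have "Suc k \<le> k" using independent_bound[OF K y V gen] by blast
  then show False by simp
qed

section \<open>Units, Zariski's lemma and the Jacobson property\<close>

lemma unit_if_algebraic:
  assumes "k = 0" and a: "a \<in> carrier R" "a \<noteq> \<zero>"
  obtains b where "b \<in> carrier R" "a \<otimes> b = \<one>"
proof -
  obtain g where g: "g \<in> carrier R" "a \<otimes> g \<in> K" "a \<otimes> g \<noteq> \<zero>"
    using divides_polynomial[OF a] Alg_0[OF K] assms(1) by auto
  have i: "inv (a \<otimes> g) \<in> carrier R" "(a \<otimes> g) \<otimes> inv (a \<otimes> g) = \<one>"
    using subfield_m_inv[OF K, of "a \<otimes> g"] g K_carrier[OF K] by auto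
  then show thesis using that[of "g \<otimes> inv (a \<otimes> g)"] a g by (simp add: m_assoc)
qed

lemma last_transc:
  assumes "k = Suc n"
  shows "transc (Alg K y n) (y n)" "subring (Alg K y n) R" "y n \<in> carrier R"
    "adjoin (Alg K y n) (y n) = Alg K y k"
proof -
  have y': "y \<in> {..<Suc n} \<rightarrow> carrier R" using y assms by simp
  show "transc (Alg K y n) (y n)" using indep_transc[OF K y'] y_indep assms by simp
  have "y \<in> {..<n} \<rightarrow> carrier R" using y' by auto
  then show "subring (Alg K y n) R" by (rule Alg_subring[OF K])
  show "y n \<in> carrier R" using y' by auto
  show "adjoin (Alg K y n) (y n) = Alg K y k" using Alg_Suc[OF K y'] assms by simp
qed

text \<open>If a variable remained, the last one would be a unit of leading degree one, against
  \<open>unit_lead_degree\<close>.\<close>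

lemma Zariski:
  assumes inv: "\<And>a. a \<in> carrier R \<Longrightarrow> a \<noteq> \<zero> \<Longrightarrow> \<exists>b\<in>carrier R. a \<otimes> b = \<one>"
  shows "k = 0"
proof (rule ccontr)
  assume "k \<noteq> 0"
  then obtain n where n: "k = Suc n" by (cases k) auto
  note C = last_transc[OF n]
  note oneC = subringE(3)[OF C(2)]
  have "y n \<noteq> \<zero>"
  proof
    assume "y n = \<zero>"
    then have "lead (Alg K y n) (y n) \<one> (Suc 0) \<zero>" using lead_t[OF C(2,3)] by simp
    then show False using C(1) oneC one_not_zero unfolding transc_def by blast
  qed
  then obtain b where "b \<in> carrier R" "y n \<otimes> b = \<one>" using inv C(3) by blast
  then show False
    using unit_lead_degree[OF C(2,3,1) V _ lead_t[OF C(2,3)] oneC] gen C(4) by auto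
qed

text \<open>The Jacobson radical vanishes: if \<open>a\<close> divides the nonzero polynomial \<open>h\<close>, then \<open>1 + x h\<close> is not a
  unit, and a maximal ideal containing it does not contain \<open>a\<close>.\<close>

lemma Jacobson:
  assumes a: "a \<in> carrier R" "a \<noteq> \<zero>"
  obtains M where "maximalideal M R" "a \<notin> M"
proof (cases k)
  case 0
  \<comment> \<open>Without variables \<open>a\<close> is a unit, so any maximal ideal will
    do.\<close>
  obtain b where b: "b \<in> carrier R" "a \<otimes> b = \<one>" using unit_if_algebraic[OF 0 a] .
  have "\<one> \<notin> {\<zero>}" by simp
  then obtain M where M: "maximalideal M R" by (rule exists_maximalideal_above[OF zeroideal])
  interpret M: maximalideal M R by fact
  have "a \<notin> M"
  proof
    assume "a \<in> M"
    then have "\<one> \<in> M" using M.I_r_closed[OF _ b(1)] b(2) by metis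
    then show False using M.one_imp_carrier M.I_notcarr by blast
  qed
  then show thesis using that M by blast
next
  case (Suc n)
  note C = last_transc[OF Suc]
  note Cc = subringE(1)[OF C(2)] and oneC = subringE(3)[OF C(2)]
  obtain g where g: "g \<in> carrier R" "a \<otimes> g \<in> Alg K y k" "a \<otimes> g \<noteq> \<zero>" using divides_polynomial[OF a] .
  obtain N where "a \<otimes> g \<in> low (Alg K y n) (y n) N" using g(2) C(4) unfolding adjoin_def by blast
  then obtain c j where c: "c \<in> Alg K y n" "c \<noteq> \<zero>" "lead (Alg K y n) (y n) c j (a \<otimes> g)"
    using lead_exists[OF C(2,3)] g(3) by metis
  have cc: "c \<in> carrier R" using c Cc by blast
  \<comment> \<open>The factor \<open>y n\<close> makes the degree positive even if
    \<open>a g\<close> is constant, as required to exclude an inverse by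
    \<open>unit_lead_degree\<close>.\<close>
  define b where "b = y n \<otimes> (a \<otimes> g) \<oplus> \<one>"
  have bc: "b \<in> carrier R" unfolding b_def using C a g by simp
  have "lead (Alg K y n) (y n) (\<one> \<otimes> c) (Suc 0 + j) (y n \<otimes> (a \<otimes> g))"
    by (rule lead_mult[OF C(2,3) lead_t[OF C(2,3)] c(3) oneC c(1)])
  moreover have "\<one> \<in> low (Alg K y n) (y n) (Suc 0 + j)"
    using lead_low[OF C(2,3) lead_const[OF C(2,3) oneC] oneC]
      low_mono[of "Suc 0" "Suc 0 + j" "Alg K y n" "y n"] by auto
  ultimately have "lead (Alg K y n) (y n) c (Suc j) b"
    using lead_add_low[OF C(2,3)] c(1) cc unfolding b_def by auto
  then have nonunit: "b \<otimes> b' \<noteq> \<one>" if "b' \<in> carrier R" for b'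
    using unit_lead_degree[OF C(2,3,1) V _ _ c(1,2) that] gen C(4) by auto
  have "\<one> \<notin> PIdl b"
  proof
    assume "\<one> \<in> PIdl b"
    then obtain x where "x \<in> carrier R" "\<one> = x \<otimes> b" unfolding cgenideal_def by blast
    then show False using nonunit[of x] m_comm[OF bc, of x] by metis
  qed
  then obtain M where M: "maximalideal M R" "PIdl b \<subseteq> M"
    by (rule exists_maximalideal_above[OF cgenideal_ideal[OF bc]])
  interpret M: maximalideal M R by fact
  have "a \<notin> M"
  proof
    assume aM: "a \<in> M"
    have bM: "b \<in> M" using M(2) cgenideal_self[OF bc] by blast
    have "y n \<otimes> (a \<otimes> g) \<in> M" using aM M.I_l_closed M.I_r_closed g C by simp
    then have "b \<oplus> \<ominus> (y n \<otimes> (a \<otimes> g)) \<in> M" using bM M.a_closed M.a_inv_closed by simp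
    moreover have "b \<oplus> \<ominus> (y n \<otimes> (a \<otimes> g)) = \<one>" unfolding b_def using C(3) a(1) g(1) by algebra
    ultimately have "\<one> \<in> M" by metis
    then show False using M.one_imp_carrier M.I_notcarr by blast
  qed
  then show thesis using that M(1) by blast
qed

text \<open>There are \<open>card V + 1\<close> powers of \<open>u\<close> in a space with
  \<open>card V\<close> generators over \<open>K\<close>. Dividing a relation by the coefficient of
  its largest power makes it monic.\<close>

lemma integral_if_algebraic:
  assumes "k = 0" and u: "u \<in> carrier R"
  obtains n where "u [^] n \<in> low K u n"
proof -
  note Ks = K_subring[OF K] and Kc = K_carrier[OF K]
  have Vc: "(\<lambda>v. v) \<in> V \<rightarrow> carrier R" using V by auto
  have u_lin: "u [^] (i::nat) \<in> lin K (\<lambda>v. v) V" for i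
    using nat_pow_closed[OF u, of i] gen Alg_0[OF K] assms(1) by metis
  have "\<exists>c. c \<in> {..card V} \<rightarrow> K \<and> (\<exists>i\<in>{..card V}. c i \<noteq> \<zero>) \<and> (\<Oplus>i\<in>{..card V}. c i \<otimes> u [^] i) = \<zero>"
    by (rule dependent_of_card[OF V(1) _ _ K Vc]) (use u_lin in auto)
  then obtain c where c: "c \<in> {..card V} \<rightarrow> K" "\<exists>i\<in>{..card V}. c i \<noteq> \<zero>"
    "(\<Oplus>i\<in>{..card V}. c i \<otimes> u [^] i) = \<zero>" by blast
  define J where "J = {i \<in> {..card V}. c i \<noteq> \<zero>}"
  have J: "finite J" "J \<noteq> {}" using c(2) unfolding J_def by auto
  have cK: "c i \<in> K" "c i \<in> carrier R" if "i \<in> J" for i using that c(1) Kc unfolding J_def by auto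
  have "(\<Oplus>i\<in>J. c i \<otimes> u [^] i) = (\<Oplus>i\<in>{..card V}. c i \<otimes> u [^] i)"
    using c(1) Kc u by (intro add.finprod_mono_neutral_cong_left) (auto simp: J_def)
  then have sum0: "(\<Oplus>i\<in>J. c i \<otimes> u [^] i) = \<zero>" using c(3) by simp
  define n where "n = Max J"
  have n: "n \<in> J" "\<And>i. i \<in> J \<Longrightarrow> i \<le> n" unfolding n_def using J by auto
  define s where "s = (\<Oplus>i\<in>J - {n}. c i \<otimes> u [^] i)"
  have s: "s \<in> low K u n" unfolding s_def low_def
    using J n cK Kc u by (intro lin_of_sum) (auto simp: le_less)
  have sc: "s \<in> carrier R" using low_closed[OF Ks u s] .
  have "J = insert n (J - {n})" using n by auto
  then have "\<zero> = (\<Oplus>i\<in>insert n (J - {n}). c i \<otimes> u [^] i)" using sum0 by simp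
  also have "\<dots> = c n \<otimes> u [^] n \<oplus> s" unfolding s_def
    using J n cK u by (subst finsum_insert) auto
  finally have eq: "c n \<otimes> u [^] n \<oplus> s = \<zero>" by simp
  have i: "inv (c n) \<in> K" "inv (c n) \<otimes> c n = \<one>"
    using subfield_m_inv[OF K, of "c n"] cK[OF n(1)] n(1) unfolding J_def by auto
  have cc: "inv (c n) \<in> carrier R" "c n \<in> carrier R" "u [^] n \<in> carrier R" using i Kc cK n u by auto
  have "u [^] n \<oplus> inv (c n) \<otimes> s = inv (c n) \<otimes> (c n \<otimes> u [^] n \<oplus> s)"
    using cc sc i(2) by (simp add: r_distr flip: m_assoc)
  then have "u [^] n \<oplus> inv (c n) \<otimes> s = \<zero>" unfolding eq using cc by simp
  then have "u [^] n = \<ominus> (inv (c n) \<otimes> s)" using cc sc by (simp add: sum_zero_eq_neg)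
  then have "u [^] n \<in> low K u n" using low_minus[OF Ks u low_smult[OF Ks u s i(1)]] by simp
  then show thesis using that by blast
qed

text \<open>\<open>exists_prime_below\<close> with \<open>x = y n\<close> and \<open>C\<close>
  generated by the other variables. \<open>Q\<close> is nonzero since it contains \<open>p\<close>,
  which is monic in a transcendental element and hence nonzero.\<close>

lemma prime_of_coheight_one:
  assumes n: "k = Suc n" and m: "primeideal m R" and p: "lead K (y n) \<one> q p" "p \<in> m"
  obtains Q where "primeideal Q R" "Q \<subseteq> m" "Q \<noteq> {\<zero>}" "indep K (mon y) (Mons n) Q"
proof -
  note C = last_transc[OF n]
  have "y \<in> {..<n} \<rightarrow> carrier R" using y n by auto
  then have "K \<subseteq> Alg K y n" by (rule K_subset_Alg[OF K])
  then have p': "lead (Alg K y n) (y n) \<one> q p"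
    using p(1) low_subset[of K "Alg K y n" "y n" q] unfolding lead_def by blast
  obtain Q where Q: "primeideal Q R" "p \<in> Q" "Q \<subseteq> m" "Q \<inter> Alg K y n \<subseteq> {\<zero>}"
    using exists_prime_below[OF C(2,3,1) V _ noe m p' p(2)] gen C(4) by auto
  have "p \<noteq> \<zero>"
    using p' C(1) subringE(3)[OF C(2)] one_not_zero unfolding transc_def by blast
  then show thesis using that[of Q] Q indep_prime_disjoint[OF Q(4)] n by auto
qed

end

text \<open>The ground field is taken inside \<open>R\<close> and the generators form a numbered
  family, which is the form needed by \<open>Alg\<close> and by the inductions on the number of
  variables.\<close>

locale affine_domain = domain R for R (structure) +
  fixes K
  assumes subfield_K: "subfield K R"
    and finitely_generated: "\<exists>e n. e \<in> {..<n} \<rightarrow> carrier R \<and> carrier R = Alg K e n"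
begin

lemma normalised: "\<exists>y k V. normalised_domain R K y k V"
proof -
  obtain e n where e: "e \<in> {..<n} \<rightarrow> carrier R" "carrier R = Alg K e n" using finitely_generated by blast
  from Noether_normalisation[OF subfield_K e(1)]
  obtain k y V where H: "y \<in> {..<k} \<rightarrow> carrier R" "indep K (mon y) (Mons k) {\<zero>}" "finite V"
    "V \<subseteq> carrier R" "carrier R = lin (Alg K y k) (\<lambda>v. v) V"
    unfolding e(2)[symmetric] by (elim exE conjE) (rule that)
  have "noeth (carrier R)" using noeth_Alg[OF subfield_K e(1)] e(2) by simp
  then have "normalised_domain R K y k V"
    using H subfield_K by (intro normalised_domain.intro normalised_domain_axioms.intro domain_axioms)
  then show ?thesis by blast
qed

end

section \<open>Quotients\<close>

context ring_hom_cring
begin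

lemma hom_mon:
  assumes "z \<in> set_mset m \<rightarrow> carrier R" shows "h (R.mon z m) = S.mon (\<lambda>i. h (z i)) m"
  using assms
proof (induction m)
  case (add i m)
  then have "h (R.mon z (add_mset i m)) = h (z i) \<otimes>\<^bsub>S\<^esub> h (R.mon z m)"
    using R.mon_closed[of z m] by (simp add: R.mon_add_mset)
  also have "\<dots> = S.mon (\<lambda>i. h (z i)) (add_mset i m)"
    using add by (subst S.mon_add_mset) auto
  finally show ?case .
qed simp

lemma hom_lin_sum:
  assumes "a \<in> J \<rightarrow> carrier R" "g \<in> J \<rightarrow> carrier R"
  shows "h (\<Oplus>j\<in>J. a j \<otimes> g j) = (\<Oplus>\<^bsub>S\<^esub>j\<in>J. h (a j) \<otimes>\<^bsub>S\<^esub> h (g j))"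
proof -
  have "h (\<Oplus>j\<in>J. a j \<otimes> g j) = (\<Oplus>\<^bsub>S\<^esub>j\<in>J. h (a j \<otimes> g j))"
    using hom_finsum[of "\<lambda>j. a j \<otimes> g j" J] assms by (simp add: Pi_iff comp_def)
  also have "\<dots> = (\<Oplus>\<^bsub>S\<^esub>j\<in>J. h (a j) \<otimes>\<^bsub>S\<^esub> h (g j))"
    using assms by (intro S.finsum_cong') (auto simp: Pi_iff)
  finally show ?thesis .
qed

text \<open>Injectivity is asked on the coefficients only. This covers both the projection to a
  quotient, where \<open>P\<close> is the preimage of \<open>P'\<close>, and the embedding into the
  fraction field.\<close>

lemma indep_hom_iff:
  assumes K: "K \<subseteq> carrier R" "inj_on h K" "\<zero> \<in> K"
    and g: "g \<in> I \<rightarrow> carrier R" "\<And>i. i \<in> I \<Longrightarrow> g' i = h (g i)"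
    and P: "\<And>x. x \<in> carrier R \<Longrightarrow> x \<in> P \<longleftrightarrow> h x \<in> P'"
  shows "R.indep K g I P \<longleftrightarrow> S.indep (h ` K) g' I P'"
proof
  assume L: "R.indep K g I P"
  show "S.indep (h ` K) g' I P'" unfolding S.indep_def
  proof (intro allI impI ballI)
    fix J a j assume J: "finite J" "J \<subseteq> I" "a \<in> J \<rightarrow> h ` K" "(\<Oplus>\<^bsub>S\<^esub>i\<in>J. a i \<otimes>\<^bsub>S\<^esub> g' i) \<in> P'" "j \<in> J"
    define b where "b j = inv_into K h (a j)" for j
    have b: "b j \<in> K" "h (b j) = a j" if "j \<in> J" for j
      using that J(3) unfolding b_def by (auto intro: inv_into_into f_inv_into_f simp: Pi_iff)
    have bc: "b \<in> J \<rightarrow> carrier R" and gJ: "g \<in> J \<rightarrow> carrier R" using b K g J(2) by auto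
    have aS: "a i \<in> carrier S" if "i \<in> J" for i using b[OF that] K(1) hom_closed[of "b i"] by auto
    have "h (\<Oplus>i\<in>J. b i \<otimes> g i) = (\<Oplus>\<^bsub>S\<^esub>i\<in>J. a i \<otimes>\<^bsub>S\<^esub> g' i)"
      unfolding hom_lin_sum[OF bc gJ] using b g J(2) aS gJ
      by (intro S.finsum_cong') (auto simp: Pi_iff subset_iff)
    then have "(\<Oplus>i\<in>J. b i \<otimes> g i) \<in> P" using P[of "\<Oplus>i\<in>J. b i \<otimes> g i"] J(4) bc gJ
      by (simp add: R.finsum_closed Pi_iff)
    moreover have "b \<in> J \<rightarrow> K" using b(1) by blast
    ultimately have "b j = \<zero>" using R.indepD[OF L J(1,2) _ _ J(5), of b] by blast
    then show "a j = \<zero>\<^bsub>S\<^esub>" using b(2)[OF J(5)] by simp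
  qed
next
  assume L: "S.indep (h ` K) g' I P'"
  show "R.indep K g I P" unfolding R.indep_def
  proof (intro allI impI ballI)
    fix J a j assume J: "finite J" "J \<subseteq> I" "a \<in> J \<rightarrow> K" "(\<Oplus>i\<in>J. a i \<otimes> g i) \<in> P" "j \<in> J"
    have ac: "a \<in> J \<rightarrow> carrier R" and gJ: "g \<in> J \<rightarrow> carrier R" using J K g by auto
    have "h (\<Oplus>i\<in>J. a i \<otimes> g i) = (\<Oplus>\<^bsub>S\<^esub>i\<in>J. h (a i) \<otimes>\<^bsub>S\<^esub> g' i)"
      unfolding hom_lin_sum[OF ac gJ] using g J(2) ac gJ
      by (intro S.finsum_cong') (auto simp: Pi_iff subset_iff)
    then have "(\<Oplus>\<^bsub>S\<^esub>i\<in>J. h (a i) \<otimes>\<^bsub>S\<^esub> g' i) \<in> P'"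
      using P[of "\<Oplus>i\<in>J. a i \<otimes> g i"] J(4) ac gJ by (simp add: R.finsum_closed Pi_iff)
    then have "h (a j) = \<zero>\<^bsub>S\<^esub>" using S.indepD[OF L J(1,2) _ _ J(5), of "\<lambda>i. h (a i)"] J(3) by auto
    then have "h (a j) = h \<zero>" by simp
    then show "a j = \<zero>" using inj_onD[OF K(2), of "a j" \<zero>] K(3) J(3,5) by blast
  qed
qed

lemma hom_low:
  assumes "subring K R" "t \<in> carrier R" "x \<in> R.low K t n"
  shows "h x \<in> S.low (h ` K) (h t) n"
proof -
  have Kc: "K \<subseteq> carrier R" using subringE(1)[OF assms(1)] .
  have S: "subring (h ` K) S" using ring.img_is_subring[OF assms(1)] .
  have t: "h t \<in> carrier S" using assms by simp
  have "x \<in> {x \<in> carrier R. h x \<in> S.low (h ` K) (h t) n}"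
  proof (rule R.low_minimal[OF assms])
    show "\<zero> \<in> {x \<in> carrier R. h x \<in> S.low (h ` K) (h t) n}" using S.zero_low by simp
    show "u \<oplus> v \<in> {x \<in> carrier R. h x \<in> S.low (h ` K) (h t) n}"
      if "u \<in> {x \<in> carrier R. h x \<in> S.low (h ` K) (h t) n}"
        "v \<in> {x \<in> carrier R. h x \<in> S.low (h ` K) (h t) n}" for u v
      using that S.low_add[OF S t] by simp
    show "a \<otimes> t [^] j \<in> {x \<in> carrier R. h x \<in> S.low (h ` K) (h t) n}" if "a \<in> K" "j < n" for a j
      using that S.low_base[OF S t, of "h a" j n] Kc assms(2) by (auto simp: ring.hom_nat_pow)
  qed
  then show ?thesis by simp
qed

lemma hom_Alg:
  assumes K: "subfield K R" "subfield (h ` K) S" and e: "e \<in> {..<n} \<rightarrow> carrier R"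
    and surj: "h ` carrier R = carrier S" and gen: "carrier R = R.Alg K e n"
  shows "carrier S = S.Alg (h ` K) (\<lambda>i. h (e i)) n"
proof
  have e': "(\<lambda>i. h (e i)) \<in> {..<n} \<rightarrow> carrier S" using e by auto
  show "S.Alg (h ` K) (\<lambda>i. h (e i)) n \<subseteq> carrier S" using S.Alg_carrier[OF K(2) e'] .
  have "x \<in> {x \<in> carrier R. h x \<in> S.Alg (h ` K) (\<lambda>i. h (e i)) n}" if x: "x \<in> carrier R" for x
  proof -
    note T = S.Alg_subring[OF K(2) e']
    have "x \<in> R.lin K (R.mon e) (Mons n)" using x gen unfolding R.Alg_def by simp
    then show ?thesis
    proof (rule R.lin_minimal)
      show "a \<otimes> R.mon e m \<in> {x \<in> carrier R. h x \<in> S.Alg (h ` K) (\<lambda>i. h (e i)) n}"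
        if a: "a \<in> K" and m: "m \<in> Mons n" for a m
      proof -
        have c: "a \<in> carrier R" "R.mon e m \<in> carrier R"
          using a m R.K_carrier[OF K(1)] R.mon_Mons[OF K(1) e] by auto
        have "h (R.mon e m) = S.mon (\<lambda>i. h (e i)) m" using m e unfolding Mons_def by (intro hom_mon) auto
        then have "h (R.mon e m) \<in> S.Alg (h ` K) (\<lambda>i. h (e i)) n" using S.mon_mem_Alg[OF K(2) e' m] by simp
        moreover have "h a \<in> S.Alg (h ` K) (\<lambda>i. h (e i)) n" using S.K_subset_Alg[OF K(2) e'] a by blast
        ultimately show ?thesis using c subringE(6)[OF T] by simp
      qed
    qed (use subringE(2,7)[OF T] in auto)
  qed
  then show "carrier S \<subseteq> S.Alg (h ` K) (\<lambda>i. h (e i)) n" unfolding surj[symmetric] by blast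
qed

end

context affine_domain
begin

lemma quotient:
  assumes "primeideal P R"
  shows "affine_domain (R Quot P) ((+>) P ` K)" "ring_hom_cring R (R Quot P) ((+>) P)"
    "inj_on ((+>) P) K"
proof -
  interpret P: primeideal P R by fact
  interpret Q: domain "R Quot P" by (rule P.quotient_is_domain)
  interpret h: ring_hom_cring R "R Quot P" "(+>) P" by (rule P.rcos_ring_hom_cring)
  show "ring_hom_cring R (R Quot P) ((+>) P)" by (rule P.rcos_ring_hom_cring)
  have K: "inj_on ((+>) P) K" "subfield ((+>) P ` K) (R Quot P)"
    using h.ring.img_is_subfield[OF subfield_K] Q.one_not_zero by auto
  show "inj_on ((+>) P) K" by fact
  have surj: "(+>) P ` carrier R = carrier (R Quot P)" unfolding FactRing_simps by auto
  obtain e n where e: "e \<in> {..<n} \<rightarrow> carrier R" "carrier R = Alg K e n" using finitely_generated by blast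
  have "carrier (R Quot P) = Q.Alg ((+>) P ` K) (\<lambda>i. P +> e i) n"
    by (rule h.hom_Alg[OF subfield_K K(2) e(1) surj e(2)])
  moreover have "(\<lambda>i. P +> e i) \<in> {..<n} \<rightarrow> carrier (R Quot P)" using e(1) by auto
  ultimately show "affine_domain (R Quot P) ((+>) P ` K)"
    using K(2) Q.domain_axioms by (intro affine_domain.intro affine_domain_axioms.intro) blast+
qed

end

section \<open>Transcendence degrees of prime ideals\<close>

context ring_hom_cring
begin

text \<open>Lifts the lower terms of an integral equation from a residue ring back to
  \<open>R\<close>, keeping the coefficients in \<open>K\<close>.\<close>

lemma hom_low_surj:
  assumes "subring K R" "t \<in> carrier R" "x \<in> S.low (h ` K) (h t) n"
  obtains l where "l \<in> R.low K t n" "h l = x"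
proof -
  have S: "subring (h ` K) S" using ring.img_is_subring[OF assms(1)] .
  have Kc: "K \<subseteq> carrier R" using subringE(1)[OF assms(1)] .
  have t: "h t \<in> carrier S" using assms by simp
  have "x \<in> h ` R.low K t n"
  proof (rule S.low_minimal[OF S t assms(3)])
    show "\<zero>\<^bsub>S\<^esub> \<in> h ` R.low K t n" using R.zero_low by (metis hom_zero imageI)
  next
    fix u v assume "u \<in> h ` R.low K t n" "v \<in> h ` R.low K t n"
    then obtain u' v' where uv: "u' \<in> R.low K t n" "u = h u'" "v' \<in> R.low K t n" "v = h v'" by blast
    have "u' \<in> carrier R" "v' \<in> carrier R" using uv R.low_closed[OF assms(1,2)] by auto
    then have "u \<oplus>\<^bsub>S\<^esub> v = h (u' \<oplus> v')" using uv by simp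
    then show "u \<oplus>\<^bsub>S\<^esub> v \<in> h ` R.low K t n" using R.low_add[OF assms(1,2) uv(1,3)] by simp
  next
    fix a and j :: nat assume "a \<in> h ` K" "j < n"
    then obtain b where b: "b \<in> K" "a = h b" by blast
    then have "a \<otimes>\<^bsub>S\<^esub> h t [^]\<^bsub>S\<^esub> j = h (b \<otimes> t [^] j)"
      using Kc assms(2) by (auto simp: ring.hom_nat_pow)
    then show "a \<otimes>\<^bsub>S\<^esub> h t [^]\<^bsub>S\<^esub> j \<in> h ` R.low K t n"
      using R.low_base[OF assms(1,2) b(1) \<open>j < n\<close>] by simp
  qed
  then show thesis using that by blast
qed

end

lemma (in ideal) coset_eq_zero_iff:
  assumes "x \<in> carrier R" shows "I +> x = \<zero>\<^bsub>R Quot I\<^esub> \<longleftrightarrow> x \<in> I"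
  using assms rcos_const_imp_mem[OF assms] a_rcos_zero[OF ideal_axioms, of x]
  unfolding FactRing_def by auto

text \<open>The transcendence degree of \<open>R/P\<close>, in terms of elements of \<open>R\<close> independent modulo \<open>P\<close>.\<close>

definition (in ring) rk :: "'a set \<Rightarrow> 'a set \<Rightarrow> nat" where
  "rk K P = (GREATEST j. \<exists>z \<in> {..<j} \<rightarrow> carrier R. indep K (mon z) (Mons j) P)"

context affine_domain
begin

abbreviation "\<rho> \<equiv> rk K"

text \<open>\<open>Q\<close> is the preimage of \<open>Q'\<close>. The case of the zero ideal
  handles \<open>P\<close> itself; a nonzero prime of \<open>R/P\<close> occurs in the construction
  of chains.\<close>

lemma indep_quotient_iff:
  assumes P: "primeideal P R" and z: "z \<in> {..<j} \<rightarrow> carrier R" "\<And>i. i < j \<Longrightarrow> y i = P +> z i"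
    and Q: "\<And>x. x \<in> carrier R \<Longrightarrow> x \<in> Q \<longleftrightarrow> P +> x \<in> Q'"
  shows "indep K (mon z) (Mons j) Q \<longleftrightarrow>
    ring.indep (R Quot P) ((+>) P ` K) (ring.mon (R Quot P) y) (Mons j) Q'"
proof -
  interpret h: ring_hom_cring R "R Quot P" "(+>) P" by (rule quotient(2)[OF P])
  show ?thesis
  proof (rule h.indep_hom_iff[OF K_carrier[OF subfield_K] quotient(3)[OF P] _ mon_Mons[OF subfield_K z(1)] _ Q])
    show "\<zero> \<in> K" using subringE(2)[OF K_subring[OF subfield_K]] .
    fix m assume m: "m \<in> Mons j"
    have "P +> mon z m = h.S.mon (\<lambda>i. P +> z i) m" using m z unfolding Mons_def by (intro h.hom_mon) auto
    also have "\<dots> = h.S.mon y m" using m z unfolding Mons_def by (intro h.S.mon_cong) (auto simp: subset_iff Pi_iff)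
    finally show "h.S.mon y m = P +> mon z m" by simp
  qed
qed

text \<open>The maximum in \<open>rk\<close> exists because a normalisation of the quotient supplies
  both sides: its variables lift to a system of size \<open>k\<close>, and
  \<open>independent_bound\<close> excludes larger ones. In particular \<open>k\<close> is the same
  for all normalisations.\<close>

lemma quotient_rank:
  assumes P: "primeideal P R" and nd: "normalised_domain (R Quot P) ((+>) P ` K) y k V"
  shows "\<rho> P = k"
    and "\<exists>z \<in> {..<k} \<rightarrow> carrier R. (\<forall>i<k. y i = P +> z i) \<and> indep K (mon z) (Mons k) P"
    and "\<And>z j. z \<in> {..<j} \<rightarrow> carrier R \<Longrightarrow> indep K (mon z) (Mons j) P \<Longrightarrow> j \<le> \<rho> P"
proof -
  interpret P: primeideal P R by fact
  interpret N: normalised_domain "R Quot P" "(+>) P ` K" y k V by fact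
  have P0: "x \<in> P \<longleftrightarrow> P +> x \<in> {\<zero>\<^bsub>R Quot P\<^esub>}" if "x \<in> carrier R" for x
    using P.coset_eq_zero_iff[OF that] by simp
  have bound: "j \<le> k" if z: "z \<in> {..<j} \<rightarrow> carrier R" "indep K (mon z) (Mons j) P" for z j
  proof -
    interpret h: ring_hom_cring R "R Quot P" "(+>) P" by (rule quotient(2)[OF P])
    have "N.indep ((+>) P ` K) (N.mon (\<lambda>i. P +> z i)) (Mons j) {\<zero>\<^bsub>R Quot P\<^esub>}"
      using indep_quotient_iff[OF P z(1) _ P0, of "\<lambda>i. P +> z i"] z(2) by simp
    then show ?thesis
      using N.independent_bound[OF N.K N.y N.V N.gen, of "\<lambda>i. P +> z i" j] z(1) by auto
  qed
  have "\<exists>x\<in>carrier R. y i = P +> x" if "i < k" for i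
    using N.y that unfolding FactRing_simps by auto
  then obtain z where z: "\<And>i. i < k \<Longrightarrow> z i \<in> carrier R \<and> y i = P +> z i" by metis
  then have zc: "z \<in> {..<k} \<rightarrow> carrier R" by auto
  have zi: "indep K (mon z) (Mons k) P"
    using indep_quotient_iff[OF P zc _ P0, of y] N.y_indep z by simp
  show "\<exists>z \<in> {..<k} \<rightarrow> carrier R. (\<forall>i<k. y i = P +> z i) \<and> indep K (mon z) (Mons k) P"
    using zc zi z by blast
  show rk: "\<rho> P = k" unfolding rk_def
    using zc zi bound by (intro Greatest_equality) blast+
  show "j \<le> \<rho> P" if "z \<in> {..<j} \<rightarrow> carrier R" "indep K (mon z) (Mons j) P" for z j
    using bound[OF that] rk by simp
qed

lemma normalised_quotient:
  assumes "primeideal P R"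
  obtains y k V where "normalised_domain (R Quot P) ((+>) P ` K) y k V"
  using affine_domain.normalised[OF quotient(1)[OF assms]] by blast

lemma rank_attained:
  assumes "primeideal P R"
  obtains z where "z \<in> {..<\<rho> P} \<rightarrow> carrier R" "indep K (mon z) (Mons (\<rho> P)) P"
proof -
  obtain y k V where "normalised_domain (R Quot P) ((+>) P ` K) y k V" using normalised_quotient[OF assms] .
  from quotient_rank(1,2)[OF assms this] show thesis using that by blast
qed

lemma rank_max:
  assumes "primeideal P R" "z \<in> {..<j} \<rightarrow> carrier R" "indep K (mon z) (Mons j) P"
  shows "j \<le> \<rho> P"
proof -
  obtain y k V where "normalised_domain (R Quot P) ((+>) P ` K) y k V" using normalised_quotient[OF assms(1)] .
  from quotient_rank(3)[OF assms(1) this assms(2,3)] show ?thesis .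
qed

text \<open>An element of \<open>P'\<close> outside \<open>P\<close> enlarges a system independent
  modulo \<open>P'\<close> to one independent modulo \<open>P\<close>.\<close>

lemma rank_strict:
  assumes "primeideal P R" "primeideal P' R" "P \<subset> P'"
  shows "\<rho> P' < \<rho> P"
proof -
  obtain z where z: "z \<in> {..<\<rho> P'} \<rightarrow> carrier R" "indep K (mon z) (Mons (\<rho> P')) P'"
    using rank_attained[OF assms(2)] .
  obtain f where f: "f \<in> P'" "f \<notin> P" using assms(3) by blast
  have fc: "f \<in> carrier R" using f ideal.Icarr[OF primeideal.axioms(1)[OF assms(2)]] by blast
  have "indep K (mon (z(\<rho> P' := f))) (Mons (Suc (\<rho> P'))) P"
    using independent_extend[OF subfield_K assms(1,2) _ f z] assms(3) by blast
  moreover have "z(\<rho> P' := f) \<in> {..<Suc (\<rho> P')} \<rightarrow> carrier R"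
    using z(1) fc by (auto simp: Pi_iff less_Suc_eq)
  ultimately have "Suc (\<rho> P') \<le> \<rho> P" using rank_max[OF assms(1)] by blast
  then show ?thesis by simp
qed

lemma normalised_maximal:
  assumes M: "maximalideal M R" and nd: "normalised_domain (R Quot M) ((+>) M ` K) y k V"
  shows "k = 0"
proof -
  interpret M: maximalideal M R by fact
  interpret N: normalised_domain "R Quot M" "(+>) M ` K" y k V by fact
  interpret F: field "R Quot M" by (rule M.quotient_is_field[OF is_cring])
  show ?thesis
  proof (rule N.Zariski)
    fix a assume "a \<in> carrier (R Quot M)" "a \<noteq> \<zero>\<^bsub>R Quot M\<^esub>"
    then have "a \<in> Units (R Quot M)" using F.field_Units by blast
    then show "\<exists>b\<in>carrier (R Quot M). a \<otimes>\<^bsub>R Quot M\<^esub> b = \<one>\<^bsub>R Quot M\<^esub>"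
      using N.Units_r_inv_ex by blast
  qed
qed

lemma rank_maximal:
  assumes "maximalideal M R" shows "\<rho> M = 0"
proof -
  have M: "primeideal M R" using maximalideal_prime[OF assms] .
  obtain y k V where nd: "normalised_domain (R Quot M) ((+>) M ` K) y k V" using normalised_quotient[OF M] .
  show ?thesis using quotient_rank(1)[OF M nd] normalised_maximal[OF assms nd] by simp
qed

text \<open>The origin of the monic polynomial: by Zariski's lemma \<open>R/M\<close> is finite over
  \<open>K\<close>, so the residue class of \<open>x\<close> is integral over
  \<open>K\<close>.\<close>

lemma integral_mod_maximal:
  assumes M: "maximalideal M R" and x: "x \<in> carrier R"
  obtains q l where "l \<in> low K x q" "x [^] (q::nat) \<ominus> l \<in> M"
proof -
  interpret M: maximalideal M R by fact
  have Mp: "primeideal M R" using maximalideal_prime[OF M] .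
  interpret h: ring_hom_cring R "R Quot M" "(+>) M" by (rule quotient(2)[OF Mp])
  obtain y k V where nd: "normalised_domain (R Quot M) ((+>) M ` K) y k V" using normalised_quotient[OF Mp] .
  interpret N: normalised_domain "R Quot M" "(+>) M ` K" y k V by fact
  obtain q where q: "(M +> x) [^]\<^bsub>R Quot M\<^esub> (q::nat) \<in> h.S.low ((+>) M ` K) (M +> x) q"
    using N.integral_if_algebraic[OF normalised_maximal[OF M nd], of "M +> x"] x by auto
  obtain l where l: "l \<in> low K x q" "M +> l = (M +> x) [^]\<^bsub>R Quot M\<^esub> q"
    using h.hom_low_surj[OF K_subring[OF subfield_K] x q] .
  have lc: "l \<in> carrier R" using low_closed[OF K_subring[OF subfield_K] x l(1)] .
  have "M +> (x [^] q) = M +> l" using l(2) x h.ring.hom_nat_pow by simp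
  then have "x [^] q \<ominus> l \<in> M"
    using quotient_eq_iff_same_a_r_cos[OF M.is_ideal, of "x [^] q" l] x lc by simp
  then show thesis using that l(1) by blast
qed

text \<open>The step that builds chains upwards: a nonzero prime of \<open>R/P\<close> inside the
  image of \<open>M\<close> is pulled back to \<open>R\<close>. The rank falls by at most one, since
  all but one of the \<open>k\<close> lifted variables stay independent modulo
  \<open>P'\<close>.\<close>

lemma exists_prime_above_coheight_one:
  assumes P: "primeideal P R" and M: "maximalideal M R" and PM: "P \<subset> M"
  obtains P' where "primeideal P' R" "P \<subset> P'" "P' \<subseteq> M" "\<rho> P \<le> Suc (\<rho> P')"
proof -
  interpret P: primeideal P R by fact
  interpret M: maximalideal M R by fact
  have Mp: "primeideal M R" using maximalideal_prime[OF M] .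
  interpret Mp: primeideal M R by fact
  interpret h: ring_hom_cring R "R Quot P" "(+>) P" by (rule quotient(2)[OF P])
  have surj: "(+>) P ` carrier R = carrier (R Quot P)" unfolding FactRing_simps by auto
  obtain y k V where nd: "normalised_domain (R Quot P) ((+>) P ` K) y k V" using normalised_quotient[OF P] .
  interpret N: normalised_domain "R Quot P" "(+>) P ` K" y k V by fact
  have k: "\<rho> P = k" using quotient_rank(1)[OF P nd] .
  have "k > 0" using rank_strict[OF P Mp PM] k by simp
  then obtain n where n: "k = Suc n" by (cases k) auto
  obtain z where z: "z \<in> {..<k} \<rightarrow> carrier R" "\<And>i. i < k \<Longrightarrow> y i = P +> z i"
    using quotient_rank(2)[OF P nd] by blast
  have zn: "z n \<in> carrier R" "y n = P +> z n" using z n by auto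
  obtain q l where l: "l \<in> low K (z n) q" "z n [^] q \<ominus> l \<in> M"
    using integral_mod_maximal[OF M zn(1)] .
  have lc: "l \<in> carrier R" using low_closed[OF K_subring[OF subfield_K] zn(1) l(1)] .
  let ?m = "(+>) P ` M"
  \<comment> \<open>As \<open>P\<close> lies in \<open>M\<close>, whether a coset belongs to the
    image of \<open>M\<close> does not depend on the representative.\<close>
  have mem: "x \<in> M" if "x \<in> carrier R" "P +> x \<in> ?m" for x
  proof -
    from that(2) obtain c where c: "P +> x = P +> c" "c \<in> M" by (rule imageE)
    have cc: "c \<in> carrier R" using c M.Icarr by blast
    have "x \<ominus> c \<in> P" using quotient_eq_iff_same_a_r_cos[OF P.is_ideal that(1) cc] c(1) by simp
    then have "x \<ominus> c \<oplus> c \<in> M" using PM c(2) M.a_closed by blast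
    moreover have "x \<ominus> c \<oplus> c = x" using that(1) cc by algebra
    ultimately show ?thesis by simp
  qed
  have m: "primeideal ?m (R Quot P)"
  proof (rule primeidealI)
    show "ideal ?m (R Quot P)" using ring_ideal_imp_quot_ideal[OF P.is_ideal M.is_ideal] .
    show "cring (R Quot P)" by (rule h.S.is_cring)
    show "carrier (R Quot P) \<noteq> ?m"
    proof
      assume "carrier (R Quot P) = ?m"
      then have "P +> \<one> \<in> ?m" using surj by blast
      then have "\<one> \<in> M" using mem by blast
      then show False using M.one_imp_carrier M.I_notcarr by blast
    qed
    fix a b assume "a \<in> carrier (R Quot P)" "b \<in> carrier (R Quot P)" "a \<otimes>\<^bsub>R Quot P\<^esub> b \<in> ?m"
    then obtain a' b' where ab: "a' \<in> carrier R" "a = P +> a'" "b' \<in> carrier R" "b = P +> b'"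
      "(P +> a') \<otimes>\<^bsub>R Quot P\<^esub> (P +> b') \<in> ?m" unfolding surj[symmetric] by blast
    then have "P +> (a' \<otimes> b') \<in> ?m" by simp
    then have "a' \<otimes> b' \<in> M" using mem[of "a' \<otimes> b'"] ab(1,3) by simp
    then show "a \<in> ?m \<or> b \<in> ?m" using Mp.I_prime ab by blast
  qed
  \<comment> \<open>The monic equation of \<open>z n\<close> modulo \<open>M\<close>, read in
    \<open>R/P\<close> as a monic polynomial in \<open>y n\<close> over the image of
    \<open>K\<close>; its value lies in the image of \<open>M\<close>.\<close>
  let ?p = "P +> (z n [^] q \<ominus> l)"
  have "?p = \<one>\<^bsub>R Quot P\<^esub> \<otimes>\<^bsub>R Quot P\<^esub> y n [^]\<^bsub>R Quot P\<^esub> q \<oplus>\<^bsub>R Quot P\<^esub> \<ominus>\<^bsub>R Quot P\<^esub> (P +> l)"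
    using zn lc by (simp add: a_minus_def h.ring.hom_nat_pow)
  moreover have "\<ominus>\<^bsub>R Quot P\<^esub> (P +> l) \<in> h.S.low ((+>) P ` K) (y n) q"
    unfolding zn(2)
    by (rule h.S.low_minus[OF h.S.K_subring[OF N.K] _ h.hom_low[OF K_subring[OF subfield_K] zn(1) l(1)]])
      (use zn in simp)
  ultimately have lead: "h.S.lead ((+>) P ` K) (y n) \<one>\<^bsub>R Quot P\<^esub> q ?p" unfolding h.S.lead_def by blast
  obtain Q where Q: "primeideal Q (R Quot P)" "Q \<subseteq> ?m" "Q \<noteq> {\<zero>\<^bsub>R Quot P\<^esub>}"
    "h.S.indep ((+>) P ` K) (h.S.mon y) (Mons n) Q"
    using N.prime_of_coheight_one[OF n m lead imageI[OF l(2)]] .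
  interpret Q: primeideal Q "R Quot P" by fact
  define P' where "P' = {r \<in> carrier R. P +> r \<in> Q}"
  have P': "primeideal P' R" unfolding P'_def by (rule h.ring.primeideal_vimage[OF is_cring Q(1)])
  have "P \<subseteq> P'"
  proof
    fix x assume "x \<in> P"
    then show "x \<in> P'" unfolding P'_def using P.Icarr P.coset_eq_zero_iff[of x] Q.zero_closed by simp
  qed
  moreover have "P \<noteq> P'"
  proof -
    obtain w where w: "w \<in> Q" "w \<noteq> \<zero>\<^bsub>R Quot P\<^esub>" using Q(3) Q.zero_closed by blast
    then obtain x where x: "x \<in> carrier R" "w = P +> x" using Q.Icarr surj by blast
    then have "x \<in> P'" "x \<notin> P" using w P.coset_eq_zero_iff[of x] unfolding P'_def by auto
    then show ?thesis by blast
  qed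
  moreover have "P' \<subseteq> M" unfolding P'_def using Q(2) mem by blast
  moreover have "\<rho> P \<le> Suc (\<rho> P')"
  proof -
    have zc: "z \<in> {..<n} \<rightarrow> carrier R" using z(1) n by auto
    have "indep K (mon z) (Mons n) P'"
      using indep_quotient_iff[OF P zc, of y P' Q] Q(4) z(2) n unfolding P'_def by simp
    then show ?thesis using rank_max[OF P' zc] k n by simp
  qed
  ultimately show thesis using that[OF P'] by blast
qed

section \<open>Heights\<close>

lemma chain_rank:
  assumes "\<forall>i\<le>n. primeideal (C i) R" "\<forall>i<n. C i \<subset> C (Suc i)"
  shows "n + \<rho> (C n) \<le> \<rho> (C 0)"
  using assms
proof (induction n)
  case (Suc n)
  then have "n + \<rho> (C n) \<le> \<rho> (C 0)" by simp
  moreover have "\<rho> (C (Suc n)) < \<rho> (C n)" using Suc.prems by (intro rank_strict) auto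
  ultimately show ?case by simp
qed simp

lemma rank_le_zero:
  assumes "primeideal P R" shows "\<rho> P \<le> \<rho> {\<zero>}"
proof (cases "P = {\<zero>}")
  case False
  have "\<zero> \<in> P" using additive_subgroup.zero_closed[OF ideal.axioms(1)[OF primeideal.axioms(1)[OF assms]]] .
  then have "{\<zero>} \<subset> P" using False by blast
  then show ?thesis using rank_strict[OF zeroprimeideal assms] by simp
qed simp

lemma height_le: "height R P \<le> enat (\<rho> {\<zero>})"
  unfolding height_def
proof (rule Sup_least)
  fix x assume "x \<in> {enat n |n. \<exists>C. (\<forall>i\<le>n. prime_ideal (C i) R) \<and> (\<forall>i<n. C i \<subset> C (Suc i)) \<and> C n = P}"
  then obtain n C where x: "x = enat n" and C: "\<forall>i\<le>n. primeideal (C i) R" "\<forall>i<n. C i \<subset> C (Suc i)"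
    using prime_ideal_cring_iff[OF is_cring] by auto
  have "n \<le> \<rho> (C 0)" using chain_rank[OF C] by simp
  also have "\<dots> \<le> \<rho> {\<zero>}" using rank_le_zero C by simp
  finally show "x \<le> enat (\<rho> {\<zero>})" using x by simp
qed

text \<open>Each step costs at most one in rank, and the rank is zero at \<open>M\<close>, so at
  least \<open>\<rho> P\<close> steps are made. The induction on the rank terminates by
  \<open>rank_strict\<close>.\<close>

lemma exists_chain:
  assumes "primeideal P R" "maximalideal M R" "P \<subseteq> M"
  shows "\<exists>n C. \<rho> P \<le> n \<and> (\<forall>i\<le>n. primeideal (C i) R) \<and> (\<forall>i<n. C i \<subset> C (Suc i)) \<and> C 0 = P \<and> C n = M"
  using assms(1,3)
proof (induction "\<rho> P" arbitrary: P rule: less_induct)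
  case less
  show ?case
  proof (cases "P = M")
    case True
    then show ?thesis using rank_maximal[OF assms(2)] less.prems
      by (intro exI[of _ 0] exI[of _ "\<lambda>_. M"]) auto
  next
    case False
    then have "P \<subset> M" using less.prems by blast
    then obtain P' where P': "primeideal P' R" "P \<subset> P'" "P' \<subseteq> M" "\<rho> P \<le> Suc (\<rho> P')"
      by (rule exists_prime_above_coheight_one[OF less.prems(1) assms(2)])
    from less.hyps[OF rank_strict[OF less.prems(1) P'(1,2)] P'(1,3)]
    obtain n C where C: "\<rho> P' \<le> n" "\<forall>i\<le>n. primeideal (C i) R" "\<forall>i<n. C i \<subset> C (Suc i)"
      "C 0 = P'" "C n = M" by blast
    define D where "D i = (case i of 0 \<Rightarrow> P | Suc j \<Rightarrow> C j)" for i
    have "\<rho> P \<le> Suc n" using P'(4) C(1) by simp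
    moreover have "\<forall>i\<le>Suc n. primeideal (D i) R"
      using C(2) less.prems(1) unfolding D_def by (auto split: nat.split)
    moreover have "\<forall>i<Suc n. D i \<subset> D (Suc i)"
      using C(3,4) P'(2) unfolding D_def by (auto split: nat.split)
    moreover have "D 0 = P" "D (Suc n) = M" unfolding D_def using C(5) by auto
    ultimately show ?thesis by (intro exI[of _ "Suc n"] exI[of _ D]) simp
  qed
qed

lemma height_maximal:
  assumes "maximalideal M R" shows "height R M = enat (\<rho> {\<zero>})"
proof (rule antisym[OF height_le])
  have "{\<zero>} \<subseteq> M"
    using additive_subgroup.zero_closed[OF ideal.axioms(1)[OF maximalideal.axioms(1)[OF assms]]] by blast
  from exists_chain[OF zeroprimeideal assms this]
  obtain n C where C: "\<rho> {\<zero>} \<le> n" "\<forall>i\<le>n. primeideal (C i) R" "\<forall>i<n. C i \<subset> C (Suc i)" "C n = M"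
    by blast
  have "enat n \<le> height R M" unfolding height_def
    using C prime_ideal_cring_iff[OF is_cring] by (intro Sup_upper) auto
  then show "enat (\<rho> {\<zero>}) \<le> height R M" using C(1) by (meson enat_ord_simps(1) order_trans)
qed

lemma Jacobson_radical:
  assumes "a \<in> carrier R" "a \<noteq> \<zero>"
  obtains M where "maximalideal M R" "a \<notin> M"
proof -
  obtain y k V where "normalised_domain R K y k V" using normalised by blast
  then interpret N: normalised_domain R K y k V .
  show thesis using N.Jacobson[OF assms] that .
qed

text \<open>No height exceeds the rank of the zero ideal, so at that bound the intersection is all
  of \<open>R\<close>. For smaller \<open>d\<close> every maximal ideal takes part, and their
  intersection is zero.\<close>

lemma locality:
  "Inf {enat d | d. carrier R \<inter> \<Inter>{Q. prime_ideal Q R \<and> height R Q > enat d} \<noteq> {\<zero>}} = enat (\<rho> {\<zero>})"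
proof (rule antisym)
  have "{Q. prime_ideal Q R \<and> height R Q > enat (\<rho> {\<zero>})} = {}" using height_le by (auto simp: leD)
  then have "carrier R \<inter> \<Inter>{Q. prime_ideal Q R \<and> height R Q > enat (\<rho> {\<zero>})} \<noteq> {\<zero>}"
    using one_closed one_not_zero by (simp only: Inf_empty Int_UNIV_right) blast
  then show "Inf {enat d | d. carrier R \<inter> \<Inter>{Q. prime_ideal Q R \<and> height R Q > enat d} \<noteq> {\<zero>}}
      \<le> enat (\<rho> {\<zero>})"
    by (intro Inf_lower) blast
next
  show "enat (\<rho> {\<zero>}) \<le> Inf {enat d | d. carrier R \<inter> \<Inter>{Q. prime_ideal Q R \<and> height R Q > enat d} \<noteq> {\<zero>}}"
  proof (rule Inf_greatest)
    fix x assume "x \<in> {enat d | d. carrier R \<inter> \<Inter>{Q. prime_ideal Q R \<and> height R Q > enat d} \<noteq> {\<zero>}}"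
    then obtain d where x: "x = enat d"
      and d: "carrier R \<inter> \<Inter>{Q. prime_ideal Q R \<and> height R Q > enat d} \<noteq> {\<zero>}" by blast
    have "\<rho> {\<zero>} \<le> d"
    proof (rule ccontr)
      assume "\<not> \<rho> {\<zero>} \<le> d"
      then have big: "prime_ideal M R \<and> height R M > enat d" if "maximalideal M R" for M
        using height_maximal[OF that] maximalideal_prime[OF that] prime_ideal_cring_iff[OF is_cring] by simp
      have "a = \<zero>" if a: "a \<in> carrier R \<inter> \<Inter>{Q. prime_ideal Q R \<and> height R Q > enat d}" for a
      proof (rule ccontr)
        assume "a \<noteq> \<zero>"
        then obtain M where "maximalideal M R" "a \<notin> M" using Jacobson_radical a by blast
        then show False using a big by blast
      qed
      moreover have "\<zero> \<in> Q" if "prime_ideal Q R" for Q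
        using that additive_subgroup.zero_closed[OF ideal.axioms(1)] unfolding prime_ideal_def by blast
      ultimately have "carrier R \<inter> \<Inter>{Q. prime_ideal Q R \<and> height R Q > enat d} = {\<zero>}" by blast
      then show False using d by blast
    qed
    then show "enat (\<rho> {\<zero>}) \<le> x" using x by simp
  qed
qed

end

section \<open>Primitive ideals of a commutative ring\<close>

text \<open>A nonzero \<open>x\<close> generates \<open>M\<close>, and by commutativity whatever
  kills \<open>x\<close> kills \<open>M\<close>. If an ideal \<open>J\<close> above the annihilator
  contains some \<open>r\<close> not killing \<open>x\<close>, then \<open>x = s x\<close> for an
  \<open>s\<close> in \<open>J\<close>; so \<open>1 - s\<close> annihilates \<open>M\<close>, and
  the unit lies in \<open>J\<close>.\<close>

lemma (in cring) maximalideal_annihilator: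
  assumes M: "simple_module R M"
  shows "maximalideal (annihilator R M) R"
proof -
  have sm: "left_module R M" "carrier M \<noteq> {\<zero>\<^bsub>M\<^esub>}"
    "\<And>N. submodule N R M \<Longrightarrow> N = {\<zero>\<^bsub>M\<^esub>} \<or> N = carrier M"
    using M unfolding simple_module_def by auto
  have "module R M" by (rule left_module_cring_iff[OF is_cring, THEN iffD1, OF sm(1)])
  then interpret M: module R M .
  let ?A = "annihilator R M"
  have AI: "r \<in> ?A" if "r \<in> carrier R" "\<And>x. x \<in> carrier M \<Longrightarrow> r \<odot>\<^bsub>M\<^esub> x = \<zero>\<^bsub>M\<^esub>" for r
    using that unfolding annihilator_def by blast
  have AD: "r \<in> carrier R" "x \<in> carrier M \<Longrightarrow> r \<odot>\<^bsub>M\<^esub> x = \<zero>\<^bsub>M\<^esub>" if "r \<in> ?A" for r x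
    using that unfolding annihilator_def by auto
  have comm: "r \<odot>\<^bsub>M\<^esub> (s \<odot>\<^bsub>M\<^esub> x) = s \<odot>\<^bsub>M\<^esub> (r \<odot>\<^bsub>M\<^esub> x)"
    if "r \<in> carrier R" "s \<in> carrier R" "x \<in> carrier M" for r s x
    using that M.smult_assoc1[of r s x] M.smult_assoc1[of s r x] m_comm[of r s] by simp
  \<comment> \<open>Stated for every ideal because simplicity is applied both to \<open>R x\<close>
    and to \<open>J x\<close>.\<close>
  have cyclic: "ideal I R \<Longrightarrow> x \<in> carrier M \<Longrightarrow> submodule ((\<lambda>r. r \<odot>\<^bsub>M\<^esub> x) ` I) R M" for I x
  proof -
    assume I: "ideal I R" and x: "x \<in> carrier M"
    interpret I: ideal I R by fact
    show "submodule ((\<lambda>r. r \<odot>\<^bsub>M\<^esub> x) ` I) R M"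
    proof (rule M.submoduleI)
      show "(\<lambda>r. r \<odot>\<^bsub>M\<^esub> x) ` I \<subseteq> carrier M" using x I.Icarr by auto
      show "\<zero>\<^bsub>M\<^esub> \<in> (\<lambda>r. r \<odot>\<^bsub>M\<^esub> x) ` I"
        using I.zero_closed x by (intro image_eqI[of _ _ \<zero>]) auto
    next
      fix a assume "a \<in> (\<lambda>r. r \<odot>\<^bsub>M\<^esub> x) ` I"
      then obtain r where r: "r \<in> I" "a = r \<odot>\<^bsub>M\<^esub> x" by blast
      then have "\<ominus>\<^bsub>M\<^esub> a = (\<ominus> r) \<odot>\<^bsub>M\<^esub> x" using x I.Icarr M.smult_l_minus by simp
      then show "\<ominus>\<^bsub>M\<^esub> a \<in> (\<lambda>r. r \<odot>\<^bsub>M\<^esub> x) ` I" using r I.a_inv_closed by blast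
    next
      fix a b assume "a \<in> (\<lambda>r. r \<odot>\<^bsub>M\<^esub> x) ` I" "b \<in> (\<lambda>r. r \<odot>\<^bsub>M\<^esub> x) ` I"
      then obtain r s where rs: "r \<in> I" "a = r \<odot>\<^bsub>M\<^esub> x" "s \<in> I" "b = s \<odot>\<^bsub>M\<^esub> x" by blast
      then have "a \<oplus>\<^bsub>M\<^esub> b = (r \<oplus> s) \<odot>\<^bsub>M\<^esub> x" using x I.Icarr M.smult_l_distr by simp
      then show "a \<oplus>\<^bsub>M\<^esub> b \<in> (\<lambda>r. r \<odot>\<^bsub>M\<^esub> x) ` I" using rs I.a_closed by blast
    next
      fix a b assume a: "a \<in> carrier R" and "b \<in> (\<lambda>r. r \<odot>\<^bsub>M\<^esub> x) ` I"
      then obtain r where r: "r \<in> I" "b = r \<odot>\<^bsub>M\<^esub> x" by blast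
      then have "a \<odot>\<^bsub>M\<^esub> b = (a \<otimes> r) \<odot>\<^bsub>M\<^esub> x" using x a I.Icarr M.smult_assoc1 by simp
      then show "a \<odot>\<^bsub>M\<^esub> b \<in> (\<lambda>r. r \<odot>\<^bsub>M\<^esub> x) ` I" using r I.I_l_closed[OF _ a] by blast
    qed
  qed
  obtain x where x: "x \<in> carrier M" "x \<noteq> \<zero>\<^bsub>M\<^esub>" using sm(2) M.M.zero_closed by blast
  have gen: "(\<lambda>r. r \<odot>\<^bsub>M\<^esub> x) ` I = carrier M" if I: "ideal I R" and r: "r \<in> I" "r \<odot>\<^bsub>M\<^esub> x \<noteq> \<zero>\<^bsub>M\<^esub>" for I r
    using sm(3)[OF cyclic[OF I x(1)]] r by blast
  have ann: "r \<in> ?A" if r: "r \<in> carrier R" "r \<odot>\<^bsub>M\<^esub> x = \<zero>\<^bsub>M\<^esub>" for r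
  proof (rule AI[OF r(1)])
    fix z assume "z \<in> carrier M"
    moreover have "\<one> \<odot>\<^bsub>M\<^esub> x \<noteq> \<zero>\<^bsub>M\<^esub>" using x by simp
    then have "(\<lambda>r. r \<odot>\<^bsub>M\<^esub> x) ` carrier R = carrier M" using gen[OF oneideal one_closed] by blast
    ultimately obtain s where s: "s \<in> carrier R" "z = s \<odot>\<^bsub>M\<^esub> x" by blast
    then show "r \<odot>\<^bsub>M\<^esub> z = \<zero>\<^bsub>M\<^esub>" using comm[OF r(1) s(1) x(1)] r(2) by simp
  qed
  have A: "ideal ?A R"
  proof (rule idealI[OF ring_axioms])
    show "subgroup ?A (add_monoid R)"
    proof (rule add.subgroupI)
      show "?A \<subseteq> carrier R" using AD by blast
      have "\<zero> \<in> ?A" by (rule AI) auto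
      then show "?A \<noteq> {}" by blast
      show "\<ominus> a \<in> ?A" if "a \<in> ?A" for a
        using AD[OF that] by (intro AI) (auto simp: M.smult_l_minus)
      show "a \<oplus> b \<in> ?A" if "a \<in> ?A" "b \<in> ?A" for a b
        using AD[OF that(1)] AD[OF that(2)] by (intro AI) (auto simp: M.smult_l_distr)
    qed
    show "s \<otimes> a \<in> ?A" if "a \<in> ?A" "s \<in> carrier R" for a s
      using AD[OF that(1)] that(2) by (intro AI) (auto simp: M.smult_assoc1)
    show "a \<otimes> s \<in> ?A" if "a \<in> ?A" "s \<in> carrier R" for a s
      using AD[OF that(1)] that(2) by (intro AI) (auto simp: M.smult_assoc1)
  qed
  show ?thesis
  proof (rule maximalidealI[OF A])
    show "carrier R \<noteq> ?A"
    proof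
      assume "carrier R = ?A"
      then have "\<one> \<odot>\<^bsub>M\<^esub> x = \<zero>\<^bsub>M\<^esub>" using AD(2)[OF _ x(1)] one_closed by blast
      then show False using x by simp
    qed
    fix J assume J: "ideal J R" "?A \<subseteq> J" "J \<subseteq> carrier R"
    interpret J: ideal J R by fact
    show "J = ?A \<or> J = carrier R"
    proof (rule disjCI)
      assume "J \<noteq> carrier R"
      show "J = ?A"
      proof (rule ccontr)
        assume "J \<noteq> ?A"
        then obtain r where r: "r \<in> J" "r \<notin> ?A" using J(2) by blast
        then have "r \<odot>\<^bsub>M\<^esub> x \<noteq> \<zero>\<^bsub>M\<^esub>" using ann J(3) by blast
        then obtain s where s: "s \<in> J" "x = s \<odot>\<^bsub>M\<^esub> x" using gen[OF J(1) r(1)] x(1) by blast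
        have sc: "s \<in> carrier R" using s J(3) by blast
        have "(\<one> \<ominus> s) \<odot>\<^bsub>M\<^esub> x = x \<oplus>\<^bsub>M\<^esub> \<ominus>\<^bsub>M\<^esub> (s \<odot>\<^bsub>M\<^esub> x)"
          using sc x(1) by (simp add: a_minus_def M.smult_l_distr M.smult_l_minus)
        also have "\<dots> = \<zero>\<^bsub>M\<^esub>" using s(2) x(1) M.M.r_neg by simp
        finally have "\<one> \<ominus> s \<in> J" using ann sc J(2) by blast
        then have "(\<one> \<ominus> s) \<oplus> s \<in> J" using s(1) J.a_closed by blast
        moreover have "(\<one> \<ominus> s) \<oplus> s = \<one>" using sc by algebra
        ultimately show False using J.one_imp_carrier \<open>J \<noteq> carrier R\<close> by simp
      qed
    qed
  qed
qed

text \<open>The simple module is \<open>R/Q\<close> itself; its elements are cosets, which fits the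
  type \<open>'a set\<close> prescribed in \<open>primitive_ideal\<close>.\<close>

lemma (in cring) maximalideal_imp_primitive_ideal:
  assumes Q: "maximalideal Q R" shows "primitive_ideal Q R"
proof -
  interpret Q: maximalideal Q R by fact
  interpret F: field "R Quot Q" by (rule Q.quotient_is_field[OF is_cring])
  interpret h: ring_hom_cring R "R Quot Q" "(+>) Q" by (rule Q.rcos_ring_hom_cring[OF is_cring])
  have surj: "\<And>z. z \<in> carrier (R Quot Q) \<Longrightarrow> \<exists>x\<in>carrier R. z = Q +> x" unfolding FactRing_simps by auto
  define M where "M = \<lparr>carrier = carrier (R Quot Q), monoid.mult = monoid.mult (R Quot Q),
    one = \<one>\<^bsub>R Quot Q\<^esub>, ring.zero = \<zero>\<^bsub>R Quot Q\<^esub>, ring.add = ring.add (R Quot Q),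
    smult = (\<lambda>a z. (Q +> a) \<otimes>\<^bsub>R Quot Q\<^esub> z)\<rparr>"
  have M_simps [simp]: "carrier M = carrier (R Quot Q)" "\<zero>\<^bsub>M\<^esub> = \<zero>\<^bsub>R Quot Q\<^esub>"
    "\<And>x z. x \<oplus>\<^bsub>M\<^esub> z = x \<oplus>\<^bsub>R Quot Q\<^esub> z" "\<And>a z. a \<odot>\<^bsub>M\<^esub> z = (Q +> a) \<otimes>\<^bsub>R Quot Q\<^esub> z"
    unfolding M_def by auto
  have "module R M"
  proof (rule moduleI[OF is_cring])
    show "abelian_group M"
    proof (rule abelian_groupI)
      show "\<exists>z\<in>carrier M. z \<oplus>\<^bsub>M\<^esub> x = \<zero>\<^bsub>M\<^esub>" if "x \<in> carrier M" for x
        using that F.l_neg F.a_inv_closed by auto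
    qed (auto simp: F.a_ac)
  qed (auto simp: F.l_distr F.r_distr F.m_assoc)
  then have lm: "left_module R M" by (rule left_module_cring_iff[OF is_cring, THEN iffD2])
  have "N = {\<zero>\<^bsub>M\<^esub>} \<or> N = carrier M" if N: "submodule N R M" for N
  proof (rule disjCI)
    assume N': "N \<noteq> carrier M"
    interpret N: submodule N R M by fact
    have sub: "N \<subseteq> carrier (R Quot Q)" and zero: "\<zero>\<^bsub>R Quot Q\<^esub> \<in> N"
      using N.subset N.one_closed by auto
    show "N = {\<zero>\<^bsub>M\<^esub>}"
    proof (rule ccontr)
      assume "N \<noteq> {\<zero>\<^bsub>M\<^esub>}"
      then obtain x where x: "x \<in> N" "x \<noteq> \<zero>\<^bsub>R Quot Q\<^esub>" using zero by auto
      have xc: "x \<in> carrier (R Quot Q)" using x sub by blast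
      have "x \<in> Units (R Quot Q)" using x xc F.field_Units by blast
      then have i: "inv\<^bsub>R Quot Q\<^esub> x \<in> carrier (R Quot Q)" "inv\<^bsub>R Quot Q\<^esub> x \<otimes>\<^bsub>R Quot Q\<^esub> x = \<one>\<^bsub>R Quot Q\<^esub>"
        by auto
      have "z \<in> N" if z: "z \<in> carrier (R Quot Q)" for z
      proof -
        obtain a where a: "a \<in> carrier R" "z \<otimes>\<^bsub>R Quot Q\<^esub> inv\<^bsub>R Quot Q\<^esub> x = Q +> a"
          using surj[OF F.m_closed[OF z i(1)]] by blast
        have "(Q +> a) \<otimes>\<^bsub>R Quot Q\<^esub> x = z" unfolding a(2)[symmetric] using z xc i by (simp add: F.m_assoc)
        then show ?thesis using N.smult_closed[OF a(1) x(1)] by simp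
      qed
      then show False using N' sub by auto
    qed
  qed
  moreover have "carrier (R Quot Q) \<noteq> {\<zero>\<^bsub>R Quot Q\<^esub>}" using F.one_not_zero F.one_closed by blast
  ultimately have "simple_module R M" using lm unfolding simple_module_def by auto
  moreover have "Q = annihilator R M"
  proof
    show "Q \<subseteq> annihilator R M"
    proof
      fix r assume r: "r \<in> Q"
      have rc: "r \<in> carrier R" using Q.Icarr[OF r] .
      moreover have "Q +> r = \<zero>\<^bsub>R Quot Q\<^esub>" using Q.coset_eq_zero_iff[OF rc] r by simp
      ultimately show "r \<in> annihilator R M" unfolding annihilator_def by simp
    qed
    show "annihilator R M \<subseteq> Q"
    proof
      fix r assume r: "r \<in> annihilator R M"
      then have "r \<in> carrier R" "(Q +> r) \<otimes>\<^bsub>R Quot Q\<^esub> \<one>\<^bsub>R Quot Q\<^esub> = \<zero>\<^bsub>R Quot Q\<^esub>"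
        unfolding annihilator_def M_simps using F.one_closed by blast+
      then show "r \<in> Q" using Q.coset_eq_zero_iff by simp
    qed
  qed
  ultimately show ?thesis unfolding primitive_ideal_def by blast
qed

lemma (in cring) primitive_ideal_iff: "primitive_ideal Q R \<longleftrightarrow> maximalideal Q R"
  using maximalideal_imp_primitive_ideal maximalideal_annihilator unfolding primitive_ideal_def by blast

text \<open>All the heights agree. That a maximal ideal exists matters too, as the infimum of the
  empty set would be infinite.\<close>

lemma (in affine_domain) primitivity:
  "Inf {height R Q | Q. primitive_ideal Q R} = enat (\<rho> {\<zero>})"
proof -
  obtain M where "maximalideal M R" using Jacobson_radical[OF one_closed one_not_zero] .
  then have "{height R Q | Q. primitive_ideal Q R} = {enat (\<rho> {\<zero>})}"
    by (auto simp: primitive_ideal_iff height_maximal intro!: exI[of _ M])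
  then show ?thesis by simp
qed

section \<open>The quotient field\<close>

context domain
begin

lemma Frac_carrierE:
  assumes "u \<in> carrier (Frac R)"
  obtains a s where "a \<in> carrier R" "s \<in> carrier R - {\<zero>}" "u = ore_frac R a s"
  using assms unfolding Frac_def regular_elements_domain by auto

lemma Frac_carrierI: "a \<in> carrier R \<Longrightarrow> s \<in> carrier R - {\<zero>} \<Longrightarrow> ore_frac R a s \<in> carrier (Frac R)"
  unfolding Frac_def regular_elements_domain by auto

lemma nonzero_mult: "s \<in> carrier R - {\<zero>} \<Longrightarrow> t \<in> carrier R - {\<zero>} \<Longrightarrow> s \<otimes> t \<in> carrier R - {\<zero>}"
  using integral by auto

lemma Frac_cring: "cring (Frac R)"
proof (rule cringI)
  have zero: "\<zero>\<^bsub>Frac R\<^esub> = ore_frac R \<zero> \<one>" and one: "\<one>\<^bsub>Frac R\<^esub> = ore_frac R \<one> \<one>"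
    unfolding Frac_def by auto
  have one_nz: "\<one> \<in> carrier R - {\<zero>}" by simp
  show "abelian_group (Frac R)"
  proof (rule abelian_groupI)
    fix u v w assume "u \<in> carrier (Frac R)" "v \<in> carrier (Frac R)" "w \<in> carrier (Frac R)"
    then obtain a s b t c r where H: "a \<in> carrier R" "s \<in> carrier R - {\<zero>}" "u = ore_frac R a s"
      "b \<in> carrier R" "t \<in> carrier R - {\<zero>}" "v = ore_frac R b t"
      "c \<in> carrier R" "r \<in> carrier R - {\<zero>}" "w = ore_frac R c r" by (metis Frac_carrierE)
    have c: "s \<in> carrier R" "t \<in> carrier R" "r \<in> carrier R" using H by auto
    note nz = nonzero_mult[OF H(2,5)] nonzero_mult[OF H(5,8)] nonzero_mult[OF H(5,2)]
    show "u \<oplus>\<^bsub>Frac R\<^esub> v \<in> carrier (Frac R)"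
      using H c nz by (simp only: Frac_add) (intro Frac_carrierI; simp)
    have "((a \<otimes> t \<oplus> b \<otimes> s) \<otimes> r \<oplus> c \<otimes> (s \<otimes> t)) = (a \<otimes> (t \<otimes> r) \<oplus> (b \<otimes> r \<oplus> c \<otimes> t) \<otimes> s)"
      using H c by algebra
    moreover have "(s \<otimes> t) \<otimes> r = s \<otimes> (t \<otimes> r)" using c by (simp add: m_assoc)
    ultimately show "u \<oplus>\<^bsub>Frac R\<^esub> v \<oplus>\<^bsub>Frac R\<^esub> w = u \<oplus>\<^bsub>Frac R\<^esub> (v \<oplus>\<^bsub>Frac R\<^esub> w)"
      using H c nz by (simp add: Frac_add)
    show "u \<oplus>\<^bsub>Frac R\<^esub> v = v \<oplus>\<^bsub>Frac R\<^esub> u"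
      using H c nz by (simp add: Frac_add a_comm m_comm[of s t])
    show "\<zero>\<^bsub>Frac R\<^esub> \<oplus>\<^bsub>Frac R\<^esub> u = u"
      using H c by (simp add: zero Frac_add)
    have "ore_frac R (\<ominus> a) s \<oplus>\<^bsub>Frac R\<^esub> u = ore_frac R (\<ominus> a \<otimes> s \<oplus> a \<otimes> s) (s \<otimes> s)"
      using H by (simp add: Frac_add)
    also have "\<ominus> a \<otimes> s \<oplus> a \<otimes> s = \<zero>" using H(1) c by algebra
    also have "ore_frac R \<zero> (s \<otimes> s) = \<zero>\<^bsub>Frac R\<^esub>"
      unfolding zero using c nonzero_mult[OF H(2,2)] by (subst ore_frac_eq_iff) auto
    finally show "\<exists>v\<in>carrier (Frac R). v \<oplus>\<^bsub>Frac R\<^esub> u = \<zero>\<^bsub>Frac R\<^esub>"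
      using H Frac_carrierI[of "\<ominus> a" s] by auto
  next
    show "\<zero>\<^bsub>Frac R\<^esub> \<in> carrier (Frac R)" unfolding zero using one_nz by (intro Frac_carrierI) auto
  qed
  show "comm_monoid (Frac R)"
  proof (rule comm_monoidI)
    fix u v w assume "u \<in> carrier (Frac R)" "v \<in> carrier (Frac R)" "w \<in> carrier (Frac R)"
    then obtain a s b t c r where H: "a \<in> carrier R" "s \<in> carrier R - {\<zero>}" "u = ore_frac R a s"
      "b \<in> carrier R" "t \<in> carrier R - {\<zero>}" "v = ore_frac R b t"
      "c \<in> carrier R" "r \<in> carrier R - {\<zero>}" "w = ore_frac R c r" by (metis Frac_carrierE)
    have c: "s \<in> carrier R" "t \<in> carrier R" "r \<in> carrier R" using H by auto
    note nz = nonzero_mult[OF H(2,5)] nonzero_mult[OF H(5,8)]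
    show "u \<otimes>\<^bsub>Frac R\<^esub> v \<in> carrier (Frac R)"
      using H c nz by (simp only: Frac_mult) (intro Frac_carrierI; simp)
    show "u \<otimes>\<^bsub>Frac R\<^esub> v \<otimes>\<^bsub>Frac R\<^esub> w = u \<otimes>\<^bsub>Frac R\<^esub> (v \<otimes>\<^bsub>Frac R\<^esub> w)"
      using H c nz by (simp add: Frac_mult m_assoc)
    show "u \<otimes>\<^bsub>Frac R\<^esub> v = v \<otimes>\<^bsub>Frac R\<^esub> u"
      using H c nz by (simp add: Frac_mult m_comm)
    show "\<one>\<^bsub>Frac R\<^esub> \<otimes>\<^bsub>Frac R\<^esub> u = u"
      using H c by (simp add: one Frac_mult)
  next
    show "\<one>\<^bsub>Frac R\<^esub> \<in> carrier (Frac R)" unfolding one using one_nz by (intro Frac_carrierI) auto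
  qed
  fix u v w assume "u \<in> carrier (Frac R)" "v \<in> carrier (Frac R)" "w \<in> carrier (Frac R)"
  then obtain a s b t c r where H: "a \<in> carrier R" "s \<in> carrier R - {\<zero>}" "u = ore_frac R a s"
    "b \<in> carrier R" "t \<in> carrier R - {\<zero>}" "v = ore_frac R b t"
    "c \<in> carrier R" "r \<in> carrier R - {\<zero>}" "w = ore_frac R c r" by (metis Frac_carrierE)
  have c: "s \<in> carrier R" "t \<in> carrier R" "r \<in> carrier R" using H by auto
  note nz = nonzero_mult[OF H(2,5)] nonzero_mult[OF H(2,8)] nonzero_mult[OF H(5,8)]
    nonzero_mult[OF nonzero_mult[OF H(2,5)] H(8)]
    nonzero_mult[OF nonzero_mult[OF H(2,8)] nonzero_mult[OF H(5,8)]]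
  \<comment> \<open>The two sides come with different denominators, so the distributive law reduces
    to a cross-multiplied identity in \<open>R\<close>.\<close>
  have l: "(u \<oplus>\<^bsub>Frac R\<^esub> v) \<otimes>\<^bsub>Frac R\<^esub> w = ore_frac R ((a \<otimes> t \<oplus> b \<otimes> s) \<otimes> c) ((s \<otimes> t) \<otimes> r)"
    using H c nz by (simp add: Frac_mult Frac_add)
  have r: "u \<otimes>\<^bsub>Frac R\<^esub> w \<oplus>\<^bsub>Frac R\<^esub> v \<otimes>\<^bsub>Frac R\<^esub> w
      = ore_frac R ((a \<otimes> c) \<otimes> (t \<otimes> r) \<oplus> (b \<otimes> c) \<otimes> (s \<otimes> r)) ((s \<otimes> r) \<otimes> (t \<otimes> r))"
    using H c nz by (simp add: Frac_mult Frac_add)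
  have "((a \<otimes> t \<oplus> b \<otimes> s) \<otimes> c) \<otimes> ((s \<otimes> r) \<otimes> (t \<otimes> r))
      = ((a \<otimes> c) \<otimes> (t \<otimes> r) \<oplus> (b \<otimes> c) \<otimes> (s \<otimes> r)) \<otimes> ((s \<otimes> t) \<otimes> r)"
    using H c by algebra
  then show "(u \<oplus>\<^bsub>Frac R\<^esub> v) \<otimes>\<^bsub>Frac R\<^esub> w = u \<otimes>\<^bsub>Frac R\<^esub> w \<oplus>\<^bsub>Frac R\<^esub> v \<otimes>\<^bsub>Frac R\<^esub> w"
    unfolding l r using H c nz by (subst ore_frac_eq_iff) auto
qed

lemma centre_Frac: "centre (Frac R) = Frac R"
proof -
  interpret F: cring "Frac R" by (rule Frac_cring)
  have "{z \<in> carrier (Frac R). \<forall>x \<in> carrier (Frac R). z \<otimes>\<^bsub>Frac R\<^esub> x = x \<otimes>\<^bsub>Frac R\<^esub> z} = carrier (Frac R)"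
    using F.m_comm by blast
  then show ?thesis unfolding centre_def by simp
qed

lemma Frac_embedding:
  "ring_hom_cring R (Frac R) (\<lambda>a. ore_frac R a \<one>)" "inj_on (\<lambda>a. ore_frac R a \<one>) (carrier R)"
proof -
  have one_nz: "\<one> \<in> carrier R - {\<zero>}" by simp
  show "ring_hom_cring R (Frac R) (\<lambda>a. ore_frac R a \<one>)"
  proof (rule RingHom.ring_hom_cringI[OF ring_hom_ringI2 is_cring Frac_cring])
    show "ring R" "ring (Frac R)" using ring_axioms cring.axioms(1)[OF Frac_cring] by auto
    show "(\<lambda>a. ore_frac R a \<one>) \<in> ring_hom R (Frac R)"
    proof (rule ring_hom_memI)
      show "ore_frac R \<one> \<one> = \<one>\<^bsub>Frac R\<^esub>" unfolding Frac_def by simp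
    qed (use one_nz in \<open>auto simp: Frac_mult Frac_add intro: Frac_carrierI\<close>)
  qed
  show "inj_on (\<lambda>a. ore_frac R a \<one>) (carrier R)"
    using one_nz by (auto simp: inj_on_def ore_frac_eq_iff)
qed

text \<open>One denominator for all fractions is required in \<open>Frac_rank_bound\<close>, where
  the power of \<open>b\<close> clearing a monomial may depend only on its size.\<close>

lemma common_denominator:
  fixes n :: nat
  assumes "\<And>i. i < n \<Longrightarrow> g i \<in> carrier (Frac R)"
  shows "\<exists>b \<in> carrier R - {\<zero>}. \<exists>a \<in> {..<n} \<rightarrow> carrier R. \<forall>i<n. g i = ore_frac R (a i) b"
  using assms
proof (induction n)
  case 0
  show ?case by (intro bexI[of _ \<one>]) auto
next
  case (Suc n)
  then obtain b a where ba: "b \<in> carrier R - {\<zero>}" "a \<in> {..<n} \<rightarrow> carrier R"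
    "\<And>i. i < n \<Longrightarrow> g i = ore_frac R (a i) b" by auto
  obtain c s where cs: "c \<in> carrier R" "s \<in> carrier R - {\<zero>}" "g n = ore_frac R c s"
    using Suc.prems Frac_carrierE by blast
  define a' where "a' i = (if i < n then a i \<otimes> s else c \<otimes> b)" for i
  note nz = nonzero_mult[OF ba(1) cs(2)]
  have c: "b \<in> carrier R" "s \<in> carrier R" using ba cs by auto
  have "g i = ore_frac R (a' i) (b \<otimes> s)" if "i < Suc n" for i
  proof (cases "i < n")
    case True
    then have "a i \<in> carrier R" using ba by auto
    then have "ore_frac R (a i) b = ore_frac R (a i \<otimes> s) (b \<otimes> s)"
      using ba(1) nz c by (subst ore_frac_eq_iff) (auto simp: m_ac)
    then show ?thesis using ba(3) True unfolding a'_def by simp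
  next
    case False
    then have "i = n" using that by simp
    moreover have "ore_frac R c s = ore_frac R (c \<otimes> b) (b \<otimes> s)"
      using cs nz c by (subst ore_frac_eq_iff) (auto simp: m_ac)
    ultimately show ?thesis using cs(3) unfolding a'_def by simp
  qed
  moreover have "a' \<in> {..<Suc n} \<rightarrow> carrier R" using ba(2) cs c unfolding a'_def by (auto simp: Pi_iff)
  ultimately show ?case using nz by blast
qed

end

section \<open>Transcendence degrees\<close>

context ring
begin

lemma indexed_monomial_mem:
  assumes "k \<in> carrier R" "set_mset m \<subseteq> B"
  shows "(\<lambda>m'. if m' = m then k else \<zero>) \<in> indexed_pset B (carrier R)"
  using assms(2)
proof (induction m)
  case empty
  then show ?case using indexed_const[OF assms(1), of B] unfolding indexed_const_def by simp
next
  case (add i m)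
  then have "indexed_pmult (\<lambda>m'. if m' = m then k else \<zero>) i \<in> indexed_pset B (carrier R)"
    by (intro indexed_pmult) auto
  moreover have "indexed_pmult (\<lambda>m'. if m' = m then k else \<zero>) i
      = (\<lambda>m'. if m' = add_mset i m then k else \<zero>)"
    unfolding indexed_pmult_def by (auto simp: fun_eq_iff dest: multi_member_split)
  ultimately show ?case by simp
qed

text \<open>Replaces the inductive construction of polynomials by finite support, which matches the
  finite sums in \<open>indep\<close>. For the converse, the support is emptied one monomial at a
  time.\<close>

lemma indexed_pset_iff:
  "p \<in> indexed_pset B (carrier R) \<longleftrightarrow>
     finite {m. p m \<noteq> \<zero>} \<and> (\<forall>m. p m \<in> carrier R) \<and> (\<forall>m. p m \<noteq> \<zero> \<longrightarrow> set_mset m \<subseteq> B)"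
  (is "_ \<longleftrightarrow> ?fin p \<and> ?car p \<and> ?sup p")
proof
  assume "p \<in> indexed_pset B (carrier R)"
  then show "?fin p \<and> ?car p \<and> ?sup p"
  proof (induction rule: indexed_pset.induct)
    case (indexed_const k)
    have "{m. indexed_const k m \<noteq> \<zero>} \<subseteq> {{#}}" unfolding indexed_const_def by auto
    then show ?case using indexed_const finite_subset unfolding indexed_const_def by auto
  next
    case (indexed_padd P Q)
    have "{m. (indexed_padd P Q) m \<noteq> \<zero>} \<subseteq> {m. P m \<noteq> \<zero>} \<union> {m. Q m \<noteq> \<zero>}"
      unfolding indexed_padd_def by auto
    then have "finite {m. (indexed_padd P Q) m \<noteq> \<zero>}" using indexed_padd finite_subset by blast
    moreover have "set_mset m \<subseteq> B" if "indexed_padd P Q m \<noteq> \<zero>" for m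
    proof -
      have "P m \<noteq> \<zero> \<or> Q m \<noteq> \<zero>" using that unfolding indexed_padd_def by auto
      then show ?thesis using indexed_padd by blast
    qed
    ultimately show ?case using indexed_padd unfolding indexed_padd_def by auto
  next
    case (indexed_pmult P i)
    have "{m. indexed_pmult P i m \<noteq> \<zero>} \<subseteq> add_mset i ` {m. P m \<noteq> \<zero>}"
    proof
      fix m assume "m \<in> {m. indexed_pmult P i m \<noteq> \<zero>}"
      then have "i \<in># m" "P (m - {#i#}) \<noteq> \<zero>" unfolding indexed_pmult_def by (auto split: if_splits)
      then show "m \<in> add_mset i ` {m. P m \<noteq> \<zero>}" by (intro image_eqI[of _ _ "m - {#i#}"]) auto
    qed
    then have "finite {m. indexed_pmult P i m \<noteq> \<zero>}" using indexed_pmult finite_subset by blast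
    moreover have "set_mset m \<subseteq> B" if "indexed_pmult P i m \<noteq> \<zero>" for m
    proof -
      have "i \<in># m" "P (m - {#i#}) \<noteq> \<zero>"
        using that unfolding indexed_pmult_def by (auto split: if_splits)
      then have "set_mset (m - {#i#}) \<subseteq> B" using indexed_pmult.IH by blast
      then have "set_mset (add_mset i (m - {#i#})) \<subseteq> B" using indexed_pmult.hyps(2) by simp
      then show ?thesis using \<open>i \<in># m\<close> by simp
    qed
    ultimately show ?case using indexed_pmult unfolding indexed_pmult_def by auto
  qed
next
  assume "?fin p \<and> ?car p \<and> ?sup p"
  then show "p \<in> indexed_pset B (carrier R)"
  proof (induction "card {m. p m \<noteq> \<zero>}" arbitrary: p)
    case 0
    then have "p = indexed_const \<zero>" unfolding indexed_const_def by auto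
    then show ?case using indexed_const[OF zero_closed, of B] by simp
  next
    case (Suc c)
    then have fin: "finite {m. p m \<noteq> \<zero>}" and car: "\<And>m. p m \<in> carrier R"
      and sup: "\<And>m. p m \<noteq> \<zero> \<Longrightarrow> set_mset m \<subseteq> B" by auto
    have "{m. p m \<noteq> \<zero>} \<noteq> {}" using Suc.hyps(2) by (metis card.empty nat.distinct(1))
    then obtain m where m: "p m \<noteq> \<zero>" by auto
    have S: "{m'. (p(m := \<zero>)) m' \<noteq> \<zero>} = {m. p m \<noteq> \<zero>} - {m}" by auto
    have "c = card {m'. (p(m := \<zero>)) m' \<noteq> \<zero>}" unfolding S using Suc.hyps(2) m by simp
    then have "p(m := \<zero>) \<in> indexed_pset B (carrier R)"
      using Suc.hyps(1)[of "p(m := \<zero>)"] fin car sup S by auto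
    then have "indexed_padd (p(m := \<zero>)) (\<lambda>m'. if m' = m then p m else \<zero>) \<in> indexed_pset B (carrier R)"
      using indexed_monomial_mem[OF car sup[OF m]] by (rule indexed_padd)
    moreover have "indexed_padd (p(m := \<zero>)) (\<lambda>m'. if m' = m then p m else \<zero>) = p"
      unfolding indexed_padd_def using car by (auto simp: fun_eq_iff)
    ultimately show ?case by simp
  qed
qed

end

context ring_hom_cring
begin

text \<open>Here \<open>R\<close> is the ground field and \<open>S\<close> the algebra.\<close>

lemma alg_independent_iff:
  assumes inj: "inj_on h (carrier R)" and B: "B \<subseteq> carrier S"
  shows "alg_independent R h S B \<longleftrightarrow>
    S.indep (h ` carrier R) (S.mon (\<lambda>b. b)) {m. set_mset m \<subseteq> B} {\<zero>\<^bsub>S\<^esub>}"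
proof -
  have pv: "poly_value R h S p = (\<Oplus>\<^bsub>S\<^esub>m\<in>{m. p m \<noteq> \<zero>}. h (p m) \<otimes>\<^bsub>S\<^esub> S.mon (\<lambda>b. b) m)" for p
    unfolding poly_value_def S.mon_def by simp
  have mc: "S.mon (\<lambda>b. b) m \<in> carrier S" if "set_mset m \<subseteq> B" for m
    using that B by (intro S.mon_closed) auto
  have h0: "x = \<zero>" if "x \<in> carrier R" "h x = \<zero>\<^bsub>S\<^esub>" for x
    using inj_onD[OF inj, of x \<zero>] that by simp
  show ?thesis
  proof
    assume L: "alg_independent R h S B"
    show "S.indep (h ` carrier R) (S.mon (\<lambda>b. b)) {m. set_mset m \<subseteq> B} {\<zero>\<^bsub>S\<^esub>}"
      unfolding S.indep_def
    proof (intro allI impI ballI)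
      fix J a j assume J: "finite J" "J \<subseteq> {m. set_mset m \<subseteq> B}" "a \<in> J \<rightarrow> h ` carrier R"
        "(\<Oplus>\<^bsub>S\<^esub>i\<in>J. a i \<otimes>\<^bsub>S\<^esub> S.mon (\<lambda>b. b) i) \<in> {\<zero>\<^bsub>S\<^esub>}" "j \<in> J"
      define p where "p m = (if m \<in> J then inv_into (carrier R) h (a m) else \<zero>)" for m
      have p: "p m \<in> carrier R" "m \<in> J \<Longrightarrow> h (p m) = a m" for m
        using J(3) unfolding p_def by (auto intro: inv_into_into f_inv_into_f simp: Pi_iff)
      have sub: "{m. p m \<noteq> \<zero>} \<subseteq> J" unfolding p_def by auto
      then have pset: "p \<in> R.indexed_pset B (carrier R)"
        unfolding R.indexed_pset_iff using p J(1,2) finite_subset by blast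
      have "poly_value R h S p = (\<Oplus>\<^bsub>S\<^esub>m\<in>J. a m \<otimes>\<^bsub>S\<^esub> S.mon (\<lambda>b. b) m)"
        unfolding pv
      proof (rule S.add.finprod_mono_neutral_cong_left[OF J(1) sub])
        show "a m \<otimes>\<^bsub>S\<^esub> S.mon (\<lambda>b. b) m = \<zero>\<^bsub>S\<^esub>" if "m \<in> J - {m. p m \<noteq> \<zero>}" for m
        proof -
          have "m \<in> J" "p m = \<zero>" using that by auto
          then have "a m = \<zero>\<^bsub>S\<^esub>" "set_mset m \<subseteq> B" using p(2)[of m] J(2) by auto
          then show ?thesis using mc[of m] by simp
        qed
        show "h (p m) \<otimes>\<^bsub>S\<^esub> S.mon (\<lambda>b. b) m = a m \<otimes>\<^bsub>S\<^esub> S.mon (\<lambda>b. b) m" if "m \<in> {m. p m \<noteq> \<zero>}" for m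
          using that p(2)[of m] sub by auto
        show "(\<lambda>m. a m \<otimes>\<^bsub>S\<^esub> S.mon (\<lambda>b. b) m) \<in> J \<rightarrow> carrier S"
        proof
          fix m assume m: "m \<in> J"
          have "a m \<in> carrier S" using p[of m] m hom_closed by metis
          then show "a m \<otimes>\<^bsub>S\<^esub> S.mon (\<lambda>b. b) m \<in> carrier S" using mc[of m] m J(2) by auto
        qed
      qed
      then have "poly_value R h S p = \<zero>\<^bsub>S\<^esub>" using J(4) by simp
      then have "p j = \<zero>" using L pset unfolding alg_independent_def by blast
      then show "a j = \<zero>\<^bsub>S\<^esub>" using p(2)[OF J(5)] by simp
    qed
  next
    assume L: "S.indep (h ` carrier R) (S.mon (\<lambda>b. b)) {m. set_mset m \<subseteq> B} {\<zero>\<^bsub>S\<^esub>}"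
    show "alg_independent R h S B" unfolding alg_independent_def
    proof (intro conjI B ballI impI allI)
      fix p m assume p: "p \<in> R.indexed_pset B (carrier R)" "poly_value R h S p = \<zero>\<^bsub>S\<^esub>"
      have P: "finite {m. p m \<noteq> \<zero>}" "\<And>m. p m \<in> carrier R" "{m. p m \<noteq> \<zero>} \<subseteq> {m. set_mset m \<subseteq> B}"
        using p(1) unfolding R.indexed_pset_iff by auto
      have "h (p m) = \<zero>\<^bsub>S\<^esub>" if "p m \<noteq> \<zero>" for m
        using S.indepD[OF L P(1,3), of "\<lambda>m. h (p m)" m] p(2) P(2) that unfolding pv by auto
      then show "p m = \<zero>" using h0[OF P(2)] by blast
    qed
  qed
qed

end

context cring
begin

lemma indep_reindex:
  assumes h: "inj_on h I" and g: "\<And>i. i \<in> I \<Longrightarrow> g' (h i) = g i" "g \<in> I \<rightarrow> carrier R"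
    and S: "S \<subseteq> carrier R"
  shows "indep S g' (h ` I) P \<longleftrightarrow> indep S g I P"
proof
  assume L: "indep S g' (h ` I) P"
  show "indep S g I P" unfolding indep_def
  proof (intro allI impI ballI)
    fix J a j assume J: "finite J" "J \<subseteq> I" "a \<in> J \<rightarrow> S" "(\<Oplus>i\<in>J. a i \<otimes> g i) \<in> P" "j \<in> J"
    define b where "b i = a (inv_into I h i)" for i
    have inj: "inj_on h J" using h J(2) inj_on_subset by blast
    have b: "b (h i) = a i" if "i \<in> J" for i unfolding b_def using h J(2) that by auto
    have ac: "a i \<in> carrier R" "g i \<in> carrier R" if "i \<in> J" for i using J(2,3) g(2) S that by auto
    have "(\<Oplus>i\<in>h ` J. b i \<otimes> g' i) = (\<Oplus>i\<in>J. b (h i) \<otimes> g' (h i))"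
      using inj b g(1) J(2) ac by (intro finsum_reindex) (auto simp: Pi_iff subset_iff)
    also have "\<dots> = (\<Oplus>i\<in>J. a i \<otimes> g i)"
      using b g(1) J(2) ac by (intro finsum_cong') (auto simp: subset_iff)
    finally have "(\<Oplus>i\<in>h ` J. b i \<otimes> g' i) \<in> P" using J(4) by simp
    moreover have "b \<in> h ` J \<rightarrow> S" using b J(3) by (auto simp: Pi_iff)
    ultimately have "b (h j) = \<zero>"
      using indepD[OF L finite_imageI[OF J(1)] image_mono[OF J(2)]] J(5) by blast
    then show "a j = \<zero>" using b[OF J(5)] by simp
  qed
next
  assume L: "indep S g I P"
  show "indep S g' (h ` I) P" unfolding indep_def
  proof (intro allI impI ballI)
    fix J' a j assume J': "finite J'" "J' \<subseteq> h ` I" "a \<in> J' \<rightarrow> S" "(\<Oplus>i\<in>J'. a i \<otimes> g' i) \<in> P" "j \<in> J'"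
    obtain J where J: "J \<subseteq> I" "J' = h ` J" using J'(2) subset_imageE by metis
    have inj: "inj_on h J" using h J(1) inj_on_subset by blast
    have fin: "finite J" using J'(1) inj J(2) finite_imageD by blast
    have ac: "a (h i) \<in> carrier R" "g i \<in> carrier R" if "i \<in> J" for i using J J'(3) g(2) S that by auto
    have "(\<Oplus>i\<in>J'. a i \<otimes> g' i) = (\<Oplus>i\<in>J. a (h i) \<otimes> g' (h i))"
      unfolding J(2) using inj g(1) J(1) ac by (intro finsum_reindex) (auto simp: Pi_iff subset_iff)
    also have "\<dots> = (\<Oplus>i\<in>J. a (h i) \<otimes> g i)"
      using g(1) J(1) ac by (intro finsum_cong') (auto simp: subset_iff)
    finally have "(\<Oplus>i\<in>J. a (h i) \<otimes> g i) \<in> P" using J'(4) by simp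
    moreover have "(\<lambda>i. a (h i)) \<in> J \<rightarrow> S" using J'(3) J(2) by auto
    moreover obtain i where i: "i \<in> J" "j = h i" using J'(5) J(2) by blast
    ultimately show "a j = \<zero>" using indepD[OF L fin J(1), of "\<lambda>i. a (h i)" i] by simp
  qed
qed

lemma mon_image:
  assumes "g \<in> set_mset m \<rightarrow> carrier R" shows "mon (\<lambda>b. b) (image_mset g m) = mon g m"
  using assms
proof (induction m)
  case (add i m)
  have "mon (\<lambda>b. b) (add_mset (g i) (image_mset g m)) = g i \<otimes> mon (\<lambda>b. b) (image_mset g m)"
    using add.prems by (intro mon_add_mset) auto
  then show ?case using add by (simp add: mon_add_mset)
qed simp

lemma image_Mons:
  "image_mset g ` Mons n = {m. set_mset m \<subseteq> g ` {..<n}}"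
proof
  show "{m. set_mset m \<subseteq> g ` {..<n}} \<subseteq> image_mset g ` Mons n"
  proof
    fix m assume "m \<in> {m. set_mset m \<subseteq> g ` {..<n}}"
    then have m: "set_mset m \<subseteq> g ` {..<n}" by simp
    have "m = image_mset g (image_mset (inv_into {..<n} g) m)"
      using m f_inv_into_f[of _ g "{..<n}"]
      by (auto simp: multiset.map_comp comp_def subset_iff intro!: multiset.map_ident_strong[symmetric])
    moreover have "image_mset (inv_into {..<n} g) m \<in> Mons n"
      using m inv_into_into[of _ g "{..<n}"] unfolding Mons_def by auto
    ultimately show "m \<in> image_mset g ` Mons n" by blast
  qed
qed (fastforce simp: Mons_def)

text \<open>\<open>alg_independent\<close> lets the elements of a set be their own variables,
  whereas ranks use numbered families; an injective numbering identifies the two.\<close>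

lemma indep_family_iff:
  assumes g: "inj_on g {..<n}" "g \<in> {..<n} \<rightarrow> carrier R" and S: "S \<subseteq> carrier R"
  shows "indep S (mon (\<lambda>b. b)) {m. set_mset m \<subseteq> g ` {..<n}} P \<longleftrightarrow> indep S (mon g) (Mons n) P"
proof -
  have inj: "inj_on (image_mset g) (Mons n)"
  proof (rule inj_onI)
    fix m m' assume m: "m \<in> Mons n" "m' \<in> Mons n" "image_mset g m = image_mset g m'"
    have "image_mset (inv_into {..<n} g) (image_mset g m) = m" if "m \<in> Mons n" for m
      using that g(1) unfolding Mons_def multiset.map_comp comp_def
      by (auto simp: subset_iff intro!: multiset.map_ident_strong)
    then show "m = m'" using m by metis
  qed
  show ?thesis
    unfolding image_Mons[symmetric]
    using g(2) by (intro indep_reindex[OF inj _ _ S] mon_image) (auto simp: Mons_def intro!: mon_closed)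
qed

text \<open>A repetition would give the relation \<open>X_i - X_j\<close>. Needed so that an
  independent family of length \<open>k\<close> yields a set of \<open>k\<close> elements.\<close>

lemma indep_inj_on:
  assumes K: "subfield K R" and g: "g \<in> {..<n} \<rightarrow> carrier R" "indep K (mon g) (Mons n) {\<zero>}"
  shows "inj_on g {..<n}"
proof (rule inj_onI, rule ccontr)
  fix i j assume ij: "i \<in> {..<n}" "j \<in> {..<n}" "g i = g j" "i \<noteq> j"
  note Ks = K_subring[OF K]
  have gc: "g i \<in> carrier R" "g j \<in> carrier R" using g(1) ij by auto
  define a where "a m = (if m = {#i#} then \<one> else \<ominus> \<one>)" for m
  have "(\<Oplus>m\<in>{{#i#}, {#j#}}. a m \<otimes> mon g m) = g i \<oplus> \<ominus> g j"
    using ij gc by (simp add: a_def mon_single l_minus)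
  then have "(\<Oplus>m\<in>{{#i#}, {#j#}}. a m \<otimes> mon g m) \<in> {\<zero>}" using ij gc by (simp add: r_neg)
  moreover have "a \<in> {{#i#}, {#j#}} \<rightarrow> K" using subringE(3,5)[OF Ks] unfolding a_def by auto
  moreover have "{{#i#}, {#j#}} \<subseteq> Mons n" using ij unfolding Mons_def by auto
  ultimately have "a {#i#} = \<zero>" using indepD[OF g(2), of "{{#i#}, {#j#}}" a "{#i#}"] by blast
  then show False using one_nonzero[OF K] unfolding a_def by simp
qed

lemma mon_scale:
  assumes "g \<in> set_mset m \<rightarrow> carrier R" "b \<in> carrier R"
  shows "mon (\<lambda>i. g i \<otimes> b) m = mon g m \<otimes> b [^] size m"
  using assms(1)
proof (induction m)
  case (add i m)
  then have "g i \<in> carrier R" "mon g m \<in> carrier R" by (auto intro: mon_closed)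
  moreover have "(\<lambda>i. g i \<otimes> b) \<in> set_mset (add_mset i m) \<rightarrow> carrier R" using add.prems assms(2) by auto
  ultimately show ?case using add assms(2) by (simp add: mon_add_mset m_ac)
qed (use assms in simp)

end

context affine_domain
begin

text \<open>A homogeneous relation of degree \<open>n\<close> between the numerators
  \<open>a i\<close> and the common denominator \<open>b\<close> becomes, divided by
  \<open>b^n\<close>, a relation between the fractions \<open>g i\<close>.\<close>

lemma Frac_rank_bound:
  assumes g: "g \<in> {..<j} \<rightarrow> carrier (Frac R)"
    and ind: "ring.indep (Frac R) ((\<lambda>a. ore_frac R a \<one>) ` K) (ring.mon (Frac R) g) (Mons j) {\<zero>\<^bsub>Frac R\<^esub>}"
    and nd: "normalised_domain R K y k V"
  shows "j \<le> k"
proof (rule ccontr)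
  assume "\<not> j \<le> k"
  then have kj: "k < j" by simp
  let ?\<iota> = "\<lambda>a. ore_frac R a \<one>"
  interpret h: ring_hom_cring R "Frac R" ?\<iota> by (rule Frac_embedding(1))
  interpret N: normalised_domain R K y k V by fact
  have one_nz: "\<one> \<in> carrier R - {\<zero>}" by simp
  obtain b a where b: "b \<in> carrier R - {\<zero>}" and a: "a \<in> {..<j} \<rightarrow> carrier R"
    and ga: "\<And>i. i < j \<Longrightarrow> g i = ore_frac R (a i) b"
  proof -
    have "\<exists>b \<in> carrier R - {\<zero>}. \<exists>a \<in> {..<j} \<rightarrow> carrier R. \<forall>i<j. g i = ore_frac R (a i) b"
      by (rule common_denominator) (use g in auto)
    then show thesis by (elim bexE) (rule that; simp)
  qed
  have bc: "b \<in> carrier R" using b by simp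
  have \<iota>a: "?\<iota> (a i) = g i \<otimes>\<^bsub>Frac R\<^esub> ?\<iota> b" if "i < j" for i
  proof -
    have "a i \<in> carrier R" using a that by auto
    then show ?thesis unfolding ga[OF that]
      using b one_nz by (simp add: Frac_mult ore_frac_eq_iff)
  qed
  define b' where "b' = ore_frac R \<one> b"
  have b': "b' \<in> carrier (Frac R)" unfolding b'_def using b by (intro Frac_carrierI) auto
  have "?\<iota> b \<otimes>\<^bsub>Frac R\<^esub> b' = ore_frac R (b \<otimes> \<one>) (\<one> \<otimes> b)"
    unfolding b'_def using b one_nz by (intro Frac_mult) auto
  also have "\<dots> = ?\<iota> \<one>" using b one_nz by (subst ore_frac_eq_iff) auto
  finally have bb': "?\<iota> b \<otimes>\<^bsub>Frac R\<^esub> b' = \<one>\<^bsub>Frac R\<^esub>" by simp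
  from homogeneous_relation[OF N.K N.y N.V N.gen a bc kj]
  obtain n J c where J: "finite J" "J \<subseteq> Mons j" "\<forall>m\<in>J. size m \<le> n" "c \<in> J \<rightarrow> K" "\<exists>m\<in>J. c m \<noteq> \<zero>"
    "(\<Oplus>m\<in>J. c m \<otimes> (mon a m \<otimes> b [^] (n - size m))) = \<zero>"
    by (elim exE conjE) (rule that)
  have cc: "c m \<in> carrier R" "mon a m \<in> carrier R" "h.S.mon g m \<in> carrier (Frac R)" if "m \<in> J" for m
  proof -
    show "c m \<in> carrier R" using that J(4) K_carrier[OF N.K] by auto
    show "mon a m \<in> carrier R" using that J(2) mon_Mons[OF N.K a] by auto
    show "h.S.mon g m \<in> carrier (Frac R)" using that J(2) g by (intro h.S.mon_closed) (auto simp: Mons_def)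
  qed
  have pb: "?\<iota> b [^]\<^bsub>Frac R\<^esub> n \<otimes>\<^bsub>Frac R\<^esub> b' [^]\<^bsub>Frac R\<^esub> n = \<one>\<^bsub>Frac R\<^esub>"
    using bb' b' bc by (simp add: h.S.nat_pow_distrib[symmetric])
  have scaled: "?\<iota> (mon a m \<otimes> b [^] (n - size m)) = ?\<iota> b [^]\<^bsub>Frac R\<^esub> n \<otimes>\<^bsub>Frac R\<^esub> h.S.mon g m"
    if m: "m \<in> J" for m
  proof -
    have mM: "set_mset m \<subseteq> {..<j}" using m J(2) unfolding Mons_def by auto
    have "?\<iota> (mon a m) = h.S.mon (\<lambda>i. ?\<iota> (a i)) m" using mM a by (intro h.hom_mon) auto
    also have "\<dots> = h.S.mon (\<lambda>i. g i \<otimes>\<^bsub>Frac R\<^esub> ?\<iota> b) m"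
      using mM \<iota>a g bc by (intro h.S.mon_cong) (auto simp: subset_iff Pi_iff)
    also have "\<dots> = h.S.mon g m \<otimes>\<^bsub>Frac R\<^esub> ?\<iota> b [^]\<^bsub>Frac R\<^esub> size m"
      using mM g bc by (intro h.S.mon_scale) auto
    finally have "?\<iota> (mon a m \<otimes> b [^] (n - size m))
        = h.S.mon g m \<otimes>\<^bsub>Frac R\<^esub> ?\<iota> b [^]\<^bsub>Frac R\<^esub> size m \<otimes>\<^bsub>Frac R\<^esub> ?\<iota> b [^]\<^bsub>Frac R\<^esub> (n - size m)"
      using cc[OF m] bc by (simp add: h.ring.hom_nat_pow)
    also have "\<dots> = h.S.mon g m \<otimes>\<^bsub>Frac R\<^esub> (?\<iota> b [^]\<^bsub>Frac R\<^esub> (size m + (n - size m)))"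
      using cc[OF m] bc by (simp add: h.S.m_assoc h.S.nat_pow_mult)
    finally show ?thesis using J(3) m cc[OF m] bc by (simp add: h.S.m_comm)
  qed
  have "\<zero>\<^bsub>Frac R\<^esub> = ?\<iota> (\<Oplus>m\<in>J. c m \<otimes> (mon a m \<otimes> b [^] (n - size m)))" unfolding J(6) by simp
  also have "\<dots> = (\<Oplus>\<^bsub>Frac R\<^esub>m\<in>J. ?\<iota> (c m) \<otimes>\<^bsub>Frac R\<^esub> ?\<iota> (mon a m \<otimes> b [^] (n - size m)))"
    using cc bc by (intro h.hom_lin_sum) auto
  also have "\<dots> = (\<Oplus>\<^bsub>Frac R\<^esub>m\<in>J. ?\<iota> b [^]\<^bsub>Frac R\<^esub> n \<otimes>\<^bsub>Frac R\<^esub> (?\<iota> (c m) \<otimes>\<^bsub>Frac R\<^esub> h.S.mon g m))"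
  proof (intro h.S.finsum_cong')
    fix m assume m: "m \<in> J"
    show "?\<iota> (c m) \<otimes>\<^bsub>Frac R\<^esub> ?\<iota> (mon a m \<otimes> b [^] (n - size m))
        = ?\<iota> b [^]\<^bsub>Frac R\<^esub> n \<otimes>\<^bsub>Frac R\<^esub> (?\<iota> (c m) \<otimes>\<^bsub>Frac R\<^esub> h.S.mon g m)"
      unfolding scaled[OF m] using cc[OF m] bc by (simp add: h.S.m_lcomm)
  qed (use cc bc in auto)
  also have "\<dots> = ?\<iota> b [^]\<^bsub>Frac R\<^esub> n \<otimes>\<^bsub>Frac R\<^esub> (\<Oplus>\<^bsub>Frac R\<^esub>m\<in>J. ?\<iota> (c m) \<otimes>\<^bsub>Frac R\<^esub> h.S.mon g m)"
    using cc bc J(1) by (intro h.S.finsum_rdistr[symmetric]) auto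
  finally have z: "?\<iota> b [^]\<^bsub>Frac R\<^esub> n \<otimes>\<^bsub>Frac R\<^esub> (\<Oplus>\<^bsub>Frac R\<^esub>m\<in>J. ?\<iota> (c m) \<otimes>\<^bsub>Frac R\<^esub> h.S.mon g m) = \<zero>\<^bsub>Frac R\<^esub>"
    by simp
  define s where "s = (\<Oplus>\<^bsub>Frac R\<^esub>m\<in>J. ?\<iota> (c m) \<otimes>\<^bsub>Frac R\<^esub> h.S.mon g m)"
  have sc: "s \<in> carrier (Frac R)" unfolding s_def using cc by (intro h.S.finsum_closed) auto
  have "s = (?\<iota> b [^]\<^bsub>Frac R\<^esub> n \<otimes>\<^bsub>Frac R\<^esub> b' [^]\<^bsub>Frac R\<^esub> n) \<otimes>\<^bsub>Frac R\<^esub> s" unfolding pb using sc by simp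
  also have "\<dots> = b' [^]\<^bsub>Frac R\<^esub> n \<otimes>\<^bsub>Frac R\<^esub> (?\<iota> b [^]\<^bsub>Frac R\<^esub> n \<otimes>\<^bsub>Frac R\<^esub> s)"
    using sc b' bc by (simp add: h.S.m_ac)
  also have "\<dots> = \<zero>\<^bsub>Frac R\<^esub>" using z b' unfolding s_def by simp
  finally have "(\<Oplus>\<^bsub>Frac R\<^esub>m\<in>J. ?\<iota> (c m) \<otimes>\<^bsub>Frac R\<^esub> h.S.mon g m) \<in> {\<zero>\<^bsub>Frac R\<^esub>}" unfolding s_def by simp
  moreover have "(\<lambda>m. ?\<iota> (c m)) \<in> J \<rightarrow> ?\<iota> ` K" using J(4) by auto
  ultimately have "?\<iota> (c m) = \<zero>\<^bsub>Frac R\<^esub>" if "m \<in> J" for m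
    using h.S.indepD[OF ind J(1,2)] that by blast
  then have "c m = \<zero>" if "m \<in> J" for m
    using inj_onD[OF Frac_embedding(2), of "c m" \<zero>] cc(1)[OF that] that by simp
  then show False using J(5) by blast
qed

text \<open>\<open>F\<close> and its image \<open>K\<close> are kept apart because
  \<open>trans_degree\<close> takes a structure map whereas ranks use a subfield.
  \<open>Frac_rank_bound\<close> limits independent sets of fractions, and the variables of a
  normalisation attain the limit.\<close>

lemma trans_degree_Frac:
  assumes F: "field F" and f: "f \<in> ring_hom F R" and img: "f ` carrier F = K"
  shows "trans_degree F (\<lambda>x. ore_frac R (f x) \<one>) (centre (Frac R)) = enat (\<rho> {\<zero>})"
proof -
  let ?\<iota> = "\<lambda>a. ore_frac R a \<one>"
  interpret F: field F by fact
  interpret h: ring_hom_cring R "Frac R" ?\<iota> by (rule Frac_embedding(1))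
  have inj_f: "inj_on f (carrier F)"
  proof -
    interpret f: ring_hom_ring F R f using f by (intro ring_hom_ringI2 F.ring_axioms ring_axioms)
    show ?thesis using f.img_is_subfield(1)[OF F.carrier_is_subfield] one_not_zero by simp
  qed
  have fR: "f ` carrier F \<subseteq> carrier R" using K_carrier[OF subfield_K] img by simp
  have inj: "inj_on (\<lambda>x. ?\<iota> (f x)) (carrier F)"
    using comp_inj_on[OF inj_f inj_on_subset[OF Frac_embedding(2) fR]] by (simp add: comp_def)
  have hom: "(\<lambda>x. ?\<iota> (f x)) \<in> ring_hom F (Frac R)"
    using ring_hom_trans[OF f h.homh] by (simp add: comp_def)
  interpret e: ring_hom_cring F "Frac R" "\<lambda>x. ?\<iota> (f x)"
    by (intro RingHom.ring_hom_cringI ring_hom_ringI2 hom F.ring_axioms F.is_cring h.S.ring_axioms h.S.is_cring)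
  have imgF: "(\<lambda>x. ?\<iota> (f x)) ` carrier F = ?\<iota> ` K" using img by (auto simp: image_image[symmetric])
  have nz: "\<one>\<^bsub>Frac R\<^esub> \<noteq> \<zero>\<^bsub>Frac R\<^esub>"
  proof
    assume "\<one>\<^bsub>Frac R\<^esub> = \<zero>\<^bsub>Frac R\<^esub>"
    then have "?\<iota> \<one> = ?\<iota> \<zero>" by simp
    then show False using inj_onD[OF Frac_embedding(2), of \<one> \<zero>] by simp
  qed
  have KF: "subfield (?\<iota> ` K) (Frac R)" using h.ring.img_is_subfield(2)[OF subfield_K nz] .
  note KFc = h.S.K_carrier[OF KF]
  have iff: "alg_independent F (\<lambda>x. ?\<iota> (f x)) (Frac R) (g ` {..<n}) \<longleftrightarrow>
      h.S.indep (?\<iota> ` K) (h.S.mon g) (Mons n) {\<zero>\<^bsub>Frac R\<^esub>}"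
    if g: "inj_on g {..<n}" "g \<in> {..<n} \<rightarrow> carrier (Frac R)" for g n
  proof -
    have "g ` {..<n} \<subseteq> carrier (Frac R)" using g(2) by auto
    then show ?thesis
      using e.alg_independent_iff[OF inj] h.S.indep_family_iff[OF g KFc] imgF by simp
  qed
  obtain y k V where nd: "normalised_domain R K y k V" using normalised by blast
  interpret N: normalised_domain R K y k V by fact
  have k: "\<rho> {\<zero>} = k"
  proof (rule antisym)
    obtain z where "z \<in> {..<\<rho> {\<zero>}} \<rightarrow> carrier R" "indep K (mon z) (Mons (\<rho> {\<zero>})) {\<zero>}"
      using rank_attained[OF zeroprimeideal] .
    then show "\<rho> {\<zero>} \<le> k" using independent_bound[OF N.K N.y N.V N.gen] by blast
    show "k \<le> \<rho> {\<zero>}" using rank_max[OF zeroprimeideal N.y N.y_indep] .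
  qed
  have "trans_degree F (\<lambda>x. ?\<iota> (f x)) (Frac R) = enat k"
    unfolding trans_degree_def
  proof (rule antisym)
    show "Sup {enat (card B) |B. finite B \<and> alg_independent F (\<lambda>x. ?\<iota> (f x)) (Frac R) B} \<le> enat k"
    proof (rule Sup_least)
      fix d assume "d \<in> {enat (card B) |B. finite B \<and> alg_independent F (\<lambda>x. ?\<iota> (f x)) (Frac R) B}"
      then obtain B where B: "d = enat (card B)" "finite B"
        "alg_independent F (\<lambda>x. ?\<iota> (f x)) (Frac R) B" by blast
      obtain g where g: "bij_betw g {..<card B} B"
        using ex_bij_betw_nat_finite[OF B(2)] by (auto simp: atLeast0LessThan)
      have Bg: "B = g ` {..<card B}" using g by (simp add: bij_betw_def)
      have "B \<subseteq> carrier (Frac R)" using B(3) unfolding alg_independent_def by blast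
      then have gc: "g \<in> {..<card B} \<rightarrow> carrier (Frac R)" using Bg by auto
      have "h.S.indep (?\<iota> ` K) (h.S.mon g) (Mons (card B)) {\<zero>\<^bsub>Frac R\<^esub>}"
        using iff[OF bij_betw_imp_inj_on[OF g] gc] B(3) Bg by simp
      then show "d \<le> enat k" using Frac_rank_bound[OF gc _ nd] B(1) by simp
    qed
    define g where "g i = ?\<iota> (y i)" for i
    have gc: "g \<in> {..<k} \<rightarrow> carrier (Frac R)" using N.y unfolding g_def by auto
    have ind: "h.S.indep (?\<iota> ` K) (h.S.mon g) (Mons k) {\<zero>\<^bsub>Frac R\<^esub>}"
    proof -
      have "indep K (mon y) (Mons k) {\<zero>} \<longleftrightarrow> h.S.indep (?\<iota> ` K) (h.S.mon g) (Mons k) {\<zero>\<^bsub>Frac R\<^esub>}"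
      proof (rule h.indep_hom_iff)
        show "K \<subseteq> carrier R" using K_carrier[OF subfield_K] .
        then show "inj_on ?\<iota> K" using inj_on_subset[OF Frac_embedding(2)] by blast
        show "\<zero> \<in> K" using subringE(2)[OF K_subring[OF subfield_K]] .
        show "mon y \<in> Mons k \<rightarrow> carrier R" using mon_Mons[OF subfield_K N.y] .
        show "h.S.mon g m = ?\<iota> (mon y m)" if "m \<in> Mons k" for m
          unfolding g_def using that N.y by (intro h.hom_mon[symmetric]) (auto simp: Mons_def)
        show "x \<in> {\<zero>} \<longleftrightarrow> ?\<iota> x \<in> {\<zero>\<^bsub>Frac R\<^esub>}" if "x \<in> carrier R" for x
          using inj_onD[OF Frac_embedding(2), of x \<zero>] that by auto
      qed
      then show ?thesis using N.y_indep by simp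
    qed
    have inj_g: "inj_on g {..<k}" using h.S.indep_inj_on[OF KF gc ind] .
    have "alg_independent F (\<lambda>x. ?\<iota> (f x)) (Frac R) (g ` {..<k})" using iff[OF inj_g gc] ind by simp
    moreover have "card (g ` {..<k}) = k" using card_image[OF inj_g] by simp
    ultimately show "enat k \<le> Sup {enat (card B) |B. finite B \<and> alg_independent F (\<lambda>x. ?\<iota> (f x)) (Frac R) B}"
      by (intro Sup_upper) (auto intro!: exI[of _ "g ` {..<k}"])
  qed
  then show ?thesis using k centre_Frac by simp
qed

end

section \<open>The strong Dixmier-Moeglin equivalence\<close>

lemma (in algebra) structure_hom: "(\<lambda>k. k \<odot>\<^bsub>M\<^esub> \<one>\<^bsub>M\<^esub>) \<in> ring_hom R M"
proof (rule ring_hom_memI)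
  fix a b assume ab: "a \<in> carrier R" "b \<in> carrier R"
  show "(a \<otimes> b) \<odot>\<^bsub>M\<^esub> \<one>\<^bsub>M\<^esub> = (a \<odot>\<^bsub>M\<^esub> \<one>\<^bsub>M\<^esub>) \<otimes>\<^bsub>M\<^esub> (b \<odot>\<^bsub>M\<^esub> \<one>\<^bsub>M\<^esub>)"
    using ab by (simp add: smult_assoc1 smult_assoc2)
  show "(a \<oplus> b) \<odot>\<^bsub>M\<^esub> \<one>\<^bsub>M\<^esub> = (a \<odot>\<^bsub>M\<^esub> \<one>\<^bsub>M\<^esub>) \<oplus>\<^bsub>M\<^esub> (b \<odot>\<^bsub>M\<^esub> \<one>\<^bsub>M\<^esub>)"
    using ab by (simp add: smult_l_distr)
qed auto

text \<open>The scalars are replaced by their image in \<open>R\<close>, a subfield since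
  \<open>R\<close> is nontrivial, and the finite generating set by an enumeration.\<close>

lemma affine_domain_of_algebra:
  assumes "field K" "algebra K R" "finitely_generated_algebra K R" "domain R"
  shows "affine_domain R ((\<lambda>k. k \<odot>\<^bsub>R\<^esub> \<one>\<^bsub>R\<^esub>) ` carrier K)"
proof -
  interpret K: field K by fact
  interpret R: domain R by fact
  interpret A: algebra K R by fact
  let ?f = "\<lambda>k. k \<odot>\<^bsub>R\<^esub> \<one>\<^bsub>R\<^esub>"
  interpret f: ring_hom_ring K R ?f
    using A.structure_hom by (intro ring_hom_ringI2 K.ring_axioms R.ring_axioms)
  have sf: "subfield (?f ` carrier K) R"
    using f.img_is_subfield(2)[OF K.carrier_is_subfield R.one_not_zero] .
  obtain E where E: "finite E" "E \<subseteq> carrier R" "generate_ring R (?f ` carrier K \<union> E) = carrier R"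
    using assms(3) unfolding finitely_generated_algebra_def by blast
  obtain e where e: "bij_betw e {..<card E} E"
    using ex_bij_betw_nat_finite[OF E(1)] by (auto simp: atLeast0LessThan)
  then have eE: "e ` {..<card E} = E" by (simp add: bij_betw_def)
  then have ec: "e \<in> {..<card E} \<rightarrow> carrier R" using E(2) by auto
  note S = R.Alg_subring[OF sf ec]
  have "?f ` carrier K \<union> E \<subseteq> R.Alg (?f ` carrier K) e (card E)"
  proof -
    have "E \<subseteq> R.Alg (?f ` carrier K) e (card E)"
    proof
      fix x assume "x \<in> E"
      then obtain i where "i < card E" "x = e i" using eE by blast
      then show "x \<in> R.Alg (?f ` carrier K) e (card E)" using R.var_mem_Alg[OF sf ec] by simp
    qed
    then show ?thesis using R.K_subset_Alg[OF sf ec] by simp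
  qed
  then have "generate_ring R (?f ` carrier K \<union> E) \<subseteq> R.Alg (?f ` carrier K) e (card E)"
    using E(2) R.K_carrier[OF sf] by (intro R.generate_ring_min_subring1[OF _ S]) auto
  then have "carrier R \<subseteq> R.Alg (?f ` carrier K) e (card E)" unfolding E(3) .
  then have "carrier R = R.Alg (?f ` carrier K) e (card E)" using R.Alg_carrier[OF sf ec] by blast
  then show ?thesis
    using sf ec R.domain_axioms by (intro affine_domain.intro affine_domain_axioms.intro) blast+
qed

theorem proposition3p2:
  fixes K :: "('k, 'm) ring_scheme" and R :: "('k, 'a, 'n) module_scheme"
  assumes "field K" and "infinite (carrier K)"
    and "algebra K R" and "finitely_generated_algebra K R" and "domain R"
  shows "strong_Dixmier_Moeglin K R"
  unfolding strong_Dixmier_Moeglin_def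
proof (intro allI impI)
  fix P assume P: "prime_ideal P R"
  let ?f = "\<lambda>k. k \<odot>\<^bsub>R\<^esub> \<one>\<^bsub>R\<^esub>"
  let ?K = "?f ` carrier K"
  interpret A: affine_domain R ?K by (rule affine_domain_of_algebra[OF assms(1,3,4,5)])
  have prime: "primeideal P R" using P prime_ideal_cring_iff[OF A.is_cring] by simp
  interpret D: affine_domain "R Quot P" "(+>\<^bsub>R\<^esub>) P ` ?K" by (rule A.quotient(1)[OF prime])
  have hom: "(\<lambda>k. P +>\<^bsub>R\<^esub> ?f k) \<in> ring_hom K (R Quot P)"
    using ring_hom_trans[OF algebra.structure_hom[OF assms(3)] ring_hom_cring.homh[OF A.quotient(2)[OF prime]]]
    by (simp add: comp_def)
  \<comment> \<open>Each of the three degrees of \<open>P\<close> is computed in the affine domain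
    \<open>R/P\<close> and equals the rank of its zero ideal.\<close>
  have "rat_deg K R P = enat (D.\<rho> {\<zero>\<^bsub>R Quot P\<^esub>})"
    unfolding rat_deg_def using D.trans_degree_Frac[OF assms(1) hom] by (simp add: image_image)
  moreover have "prim_deg R P = enat (D.\<rho> {\<zero>\<^bsub>R Quot P\<^esub>})"
    unfolding prim_deg_def by (rule D.primitivity)
  moreover have "loc_deg R P = enat (D.\<rho> {\<zero>\<^bsub>R Quot P\<^esub>})"
    unfolding loc_deg_def by (rule D.locality)
  ultimately show "loc_deg R P = prim_deg R P \<and> prim_deg R P = rat_deg K R P" by simp
qed

end
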